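(* Let $H$ be the Hopf algebra associated to a group datum $(G,\chi,g,1)$ of non-nilpotent type, as in the context. If $i\in\Omega_0$ and $j\in\Omega_1$, then as $\Bbbk G$-modules $V_i\otimes V_j\cong\bigoplus_sV_s$, where $s$ runs over a finite family (with multiplicity) of indices in $\Omega_1$. In this case, as $H$-modules, $$M(k,i)\otimes P_j\cong P_j\otimes M(k,i)\cong\bigoplus_{t=0}^{k-1}\bigoplus_sP_{\tau^t(s)}$$ for any $1\le k\le n$.
   Context: $\Bbbk$ is an algebraically closed field of characteristic zero; modules are finite-dimensional left modules; $\otimes=\otimes_\Bbbk$. Fix a finite group $G$, a $\Bbbk$-linear character $\chi$ of $G$ and a central element $g\in G$; let $n\ge 2$ be the order of $q=\chi(g)$, and assume $\chi^n=1$ and $g^n\neq 1$. $H$ is the Hopf algebra generated as an algebra by $y$ and $G$, with $\Bbbk G$ as a subalgebra and relations $y^n=g^n-1$, $yh=\chi(h)hy$ for $h\in G$; $\Delta(y)=y\otimes g+1\otimes y$, $\varepsilon(y)=0$, $S(y)=-yg^{-1}$, and the elements of $G$ are group-like. It has $\Bbbk$-basis $\{y^ih\mid h\in G,\ 0\le i\le n-1\}$. Tensor products of $H$-modules are $H$-modules via $\Delta$. Let $\{V_i\mid i\in\Omega\}$ be a complete set of simple $\Bbbk G$-modules up to isomorphism; $g^n$ acts on $V_i$ by a nonzero scalar $\lambda_i$; $\Omega_0=\{i\in\Omega\mid\lambda_i=1\}$, $\Omega_1=\{i\in\Omega\mid\lambda_i\ne1\}$. For $k\ge0$, $x^kV_i=\{x^kv\mid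 v\in V_i\}$ is a copy of the vector space $V_i$ ($x$ a formal variable) with $G$-action $h(x^kv)=\chi^{-k}(h)x^k(hv)$. For $i\in\Omega_0$, $1\le k\le n$, $M(k,i)=V_i\oplus xV_i\oplus\cdots\oplus x^{k-1}V_i$ is the $H$-module with this $G$-action and $y(x^sv)=x^{s+1}v$ for $0\le s\le k-2$, $y(x^{k-1}v)=0$. For $j\in\Omega_1$, $P_j=V_j\oplus xV_j\oplus\cdots\oplus x^{n-1}V_j$ is the $H$-module with this $G$-action and $y(x^sv)=x^{s+1}v$ for $0\le s\le n-2$, $y(x^{n-1}v)=(\lambda_j-1)v$. Let $V_{\chi^{-1}}$ be the one-dimensional $\Bbbk G$-module with character $\chi^{-1}$; $\tau$ is the permutation of $\Omega$ with $V_{\chi^{-1}}\otimes V_s\cong V_{\tau(s)}$; it preserves $\Omega_0$ and $\Omega_1$. *)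

theory Defs
  imports "HOL-Algebra.Group" "HOL-Library.Function_Algebras"
    "HOL-Computational_Algebra.Polynomial"
begin

section \<open>Vector spaces, algebras and modules\<close>

text \<open>
  A vector space over the type \<open>'k\<close> is a subspace \<open>carrier V\<close> of an ambient abelian group type
  on which \<open>scl V\<close> is a scalar multiplication. Function types carry the pointwise addition
  of \<^theory>\<open>HOL-Library.Function_Algebras\<close>.
\<close>

record ('k, 'a) vsp = "'a partial_object" +
  scl :: "'k \<Rightarrow> 'a \<Rightarrow> 'a"

record ('k, 'a) alg = "('k, 'a) vsp" +
  amul :: "'a \<Rightarrow> 'a \<Rightarrow> 'a"
  aone :: 'a

record ('k, 'a, 'm) lmod = "('k, 'm) vsp" +
  act :: "'a \<Rightarrow> 'm \<Rightarrow> 'm"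

definition is_vsp :: "('k::field, 'a::ab_group_add, 'z) vsp_scheme \<Rightarrow> bool" where
  "is_vsp V \<longleftrightarrow> vector_space (scl V) \<and> module.subspace (scl V) (carrier V)"

definition fin_dim :: "('k::field, 'a::ab_group_add, 'z) vsp_scheme \<Rightarrow> bool" where
  "fin_dim V \<longleftrightarrow> (\<exists>B. finite B \<and> B \<subseteq> carrier V \<and> module.span (scl V) B = carrier V)"

definition is_alg :: "('k::field, 'a::ab_group_add, 'z) alg_scheme \<Rightarrow> bool" where
  "is_alg A \<longleftrightarrow> is_vsp A \<and> aone A \<in> carrier A \<and>
     (\<forall>a\<in>carrier A. \<forall>b\<in>carrier A. amul A a b \<in> carrier A) \<and>
     (\<forall>a\<in>carrier A. amul A (aone A) a = a \<and> amul A a (aone A) = a) \<and>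
     (\<forall>a\<in>carrier A. \<forall>b\<in>carrier A. \<forall>c\<in>carrier A.
        amul A (amul A a b) c = amul A a (amul A b c) \<and>
        amul A (a + b) c = amul A a c + amul A b c \<and>
        amul A a (b + c) = amul A a b + amul A a c) \<and>
     (\<forall>r. \<forall>a\<in>carrier A. \<forall>b\<in>carrier A.
        amul A (scl A r a) b = scl A r (amul A a b) \<and>
        amul A a (scl A r b) = scl A r (amul A a b))"

definition left_module ::
    "('k::field, 'a::ab_group_add, 'z) alg_scheme \<Rightarrow> ('k, 'a, 'm::ab_group_add) lmod \<Rightarrow> bool" where
  "left_module A M \<longleftrightarrow> is_vsp M \<and> fin_dim M \<and>
     (\<forall>a\<in>carrier A. \<forall>x\<in>carrier M. act M a x \<in> carrier M) \<and>
     (\<forall>x\<in>carrier M. act M (aone A) x = x) \<and>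
     (\<forall>a\<in>carrier A. \<forall>b\<in>carrier A. \<forall>x\<in>carrier M.
        act M (amul A a b) x = act M a (act M b x) \<and>
        act M (a + b) x = act M a x + act M b x) \<and>
     (\<forall>a\<in>carrier A. \<forall>x\<in>carrier M. \<forall>y\<in>carrier M.
        act M a (x + y) = act M a x + act M a y) \<and>
     (\<forall>r. \<forall>a\<in>carrier A. \<forall>x\<in>carrier M.
        act M (scl A r a) x = scl M r (act M a x) \<and>
        act M a (scl M r x) = scl M r (act M a x))"

definition simple_module ::
    "('k::field, 'a::ab_group_add, 'z) alg_scheme \<Rightarrow> ('k, 'a, 'm::ab_group_add) lmod \<Rightarrow> bool" where
  "simple_module A M \<longleftrightarrow> left_module A M \<and> carrier M \<noteq> {0} \<and>
     (\<forall>U. module.subspace (scl M) U \<and> U \<subseteq> carrier M \<and>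
          (\<forall>a\<in>carrier A. \<forall>u\<in>U. act M a u \<in> U) \<longrightarrow> U = {0} \<or> U = carrier M)"

definition module_iso ::
    "('k::field, 'a, 'z) alg_scheme \<Rightarrow> ('k, 'a, 'm::ab_group_add) lmod \<Rightarrow>
     ('k, 'a, 'n::ab_group_add) lmod \<Rightarrow> bool" where
  "module_iso A M N \<longleftrightarrow> (\<exists>f. bij_betw f (carrier M) (carrier N) \<and>
     (\<forall>x\<in>carrier M. \<forall>y\<in>carrier M. f (x + y) = f x + f y) \<and>
     (\<forall>r. \<forall>x\<in>carrier M. f (scl M r x) = scl N r (f x)) \<and>
     (\<forall>a\<in>carrier A. \<forall>x\<in>carrier M. f (act M a x) = act N a (f x)))"

definition direct_sum ::
    "nat \<Rightarrow> (nat \<Rightarrow> ('k, 'a, 'm::ab_group_add) lmod) \<Rightarrow> ('k, 'a, nat \<Rightarrow> 'm) lmod" where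
  "direct_sum m M =
     \<lparr>carrier = {f. (\<forall>s<m. f s \<in> carrier (M s)) \<and> (\<forall>s\<ge>m. f s = 0)},
      scl = (\<lambda>r f s. scl (M s) r (f s)),
      act = (\<lambda>a f s. if s < m then act (M s) a (f s) else 0)\<rparr>"


section \<open>Tensor products\<close>

text \<open>
  The tensor product of \<open>V\<close> and \<open>W\<close> is the space of finitely supported functions on
  \<open>B \<times> C\<close>, for chosen bases \<open>B\<close> of \<open>V\<close> and \<open>C\<close> of \<open>W\<close>; the function
  \<open>t\<close> stands for the sum of the \<open>t (b, c) \<cdot> b \<otimes> c\<close>. The universal property is
  \<open>tensor_universal\<close> below.
\<close>

definition some_basis :: "('k::field, 'a::ab_group_add, 'z) vsp_scheme \<Rightarrow> 'a set" where
  "some_basis V = (SOME B. B \<subseteq> carrier V \<and> \<not> module.dependent (scl V) B \<and>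
                           carrier V \<subseteq> module.span (scl V) B)"

definition fscale :: "'k::field \<Rightarrow> ('x \<Rightarrow> 'k) \<Rightarrow> 'x \<Rightarrow> 'k" where
  "fscale r f = (\<lambda>x. r * f x)"

definition tensor_space ::
    "('k::field, 'a::ab_group_add, 'z) vsp_scheme \<Rightarrow> ('k, 'b::ab_group_add, 'w) vsp_scheme \<Rightarrow>
     ('k, 'a \<times> 'b \<Rightarrow> 'k) vsp" where
  "tensor_space V W =
     \<lparr>carrier = {t. finite {p. t p \<noteq> 0} \<and> {p. t p \<noteq> 0} \<subseteq> some_basis V \<times> some_basis W},
      scl = fscale\<rparr>"

definition pure_tensor ::
    "('k::field, 'a::ab_group_add, 'z) vsp_scheme \<Rightarrow> ('k, 'b::ab_group_add, 'w) vsp_scheme \<Rightarrow>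
     'a \<Rightarrow> 'b \<Rightarrow> ('a \<times> 'b \<Rightarrow> 'k)" where
  "pure_tensor V W v w =
     (\<lambda>(b, c). module.representation (scl V) (some_basis V) v b *
               module.representation (scl W) (some_basis W) w c)"

text \<open>The linear map on a tensor product induced by a bilinear map \<open>f\<close> with values in
  a space with scalar multiplication \<open>s\<close>.\<close>

definition tensor_lift ::
    "('k \<Rightarrow> 'u \<Rightarrow> 'u) \<Rightarrow> ('a \<Rightarrow> 'b \<Rightarrow> 'u) \<Rightarrow> ('a \<times> 'b \<Rightarrow> 'k::field) \<Rightarrow> 'u::ab_group_add" where
  "tensor_lift s f t = (\<Sum>(b, c) | t (b, c) \<noteq> 0. s (t (b, c)) (f b c))"

definition bilinear_on ::
    "('k::field, 'a::ab_group_add, 'z) vsp_scheme \<Rightarrow> ('k, 'b::ab_group_add, 'w) vsp_scheme \<Rightarrow>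
     ('k, 'u::ab_group_add, 'x) vsp_scheme \<Rightarrow> ('a \<Rightarrow> 'b \<Rightarrow> 'u) \<Rightarrow> bool" where
  "bilinear_on V W U f \<longleftrightarrow>
     (\<forall>v\<in>carrier V. \<forall>w\<in>carrier W. f v w \<in> carrier U) \<and>
     (\<forall>v\<in>carrier V. \<forall>v'\<in>carrier V. \<forall>w\<in>carrier W. f (v + v') w = f v w + f v' w) \<and>
     (\<forall>v\<in>carrier V. \<forall>w\<in>carrier W. \<forall>w'\<in>carrier W. f v (w + w') = f v w + f v w') \<and>
     (\<forall>r. \<forall>v\<in>carrier V. \<forall>w\<in>carrier W.
        f (scl V r v) w = scl U r (f v w) \<and> f v (scl W r w) = scl U r (f v w))"

definition linear_on ::
    "('k::field, 'a::ab_group_add, 'z) vsp_scheme \<Rightarrow> ('k, 'u::ab_group_add, 'x) vsp_scheme \<Rightarrow>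
     ('a \<Rightarrow> 'u) \<Rightarrow> bool" where
  "linear_on V U F \<longleftrightarrow>
     (\<forall>v\<in>carrier V. F v \<in> carrier U) \<and>
     (\<forall>v\<in>carrier V. \<forall>v'\<in>carrier V. F (v + v') = F v + F v') \<and>
     (\<forall>r. \<forall>v\<in>carrier V. F (scl V r v) = scl U r (F v))"

lemma some_basis:
  assumes "is_vsp V"
  shows "some_basis V \<subseteq> carrier V" "\<not> module.dependent (scl V) (some_basis V)"
    "module.span (scl V) (some_basis V) = carrier V"
proof -
  interpret vector_space "scl V" using assms by (simp add: is_vsp_def)
  have sub: "subspace (carrier V)" using assms by (simp add: is_vsp_def)
  obtain B where "B \<subseteq> carrier V" "independent B" "carrier V \<subseteq> span B"
    using maximal_independent_subset[of "carrier V"] by blast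
  then have "\<exists>B. B \<subseteq> carrier V \<and> independent B \<and> carrier V \<subseteq> span B" by blast
  then have *: "some_basis V \<subseteq> carrier V \<and> \<not> dependent (some_basis V) \<and>
      carrier V \<subseteq> span (some_basis V)"
    unfolding some_basis_def by (rule someI_ex)
  then show "some_basis V \<subseteq> carrier V" "\<not> dependent (some_basis V)"
    by blast+
  show "span (some_basis V) = carrier V"
    using * sub by (meson span_minimal subset_antisym)
qed

lemma fscale_vector_space: "vector_space (fscale :: 'k::field \<Rightarrow> ('x \<Rightarrow> 'k) \<Rightarrow> 'x \<Rightarrow> 'k)"
  by unfold_locales (auto simp: fscale_def fun_eq_iff algebra_simps)

lemma tensor_lift_eq_sum:
  assumes "vector_space s" "finite F" "{p. t p \<noteq> 0} \<subseteq> F"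
  shows "tensor_lift s f t = (\<Sum>p\<in>F. s (t p) (f (fst p) (snd p)))"
proof -
  interpret vector_space s by fact
  have "tensor_lift s f t = (\<Sum>p | t p \<noteq> 0. s (t p) (f (fst p) (snd p)))"
    unfolding tensor_lift_def by (rule sum.cong) auto
  also have "\<dots> = (\<Sum>p\<in>F. s (t p) (f (fst p) (snd p)))"
    using assms(2,3) by (intro sum.mono_neutral_left) auto
  finally show ?thesis .
qed

lemma linear_on_sum:
  assumes V: "is_vsp V" and U: "is_vsp U" and F: "linear_on V U F"
    and "finite I" "\<And>p. p \<in> I \<Longrightarrow> x p \<in> carrier V"
  shows "F (\<Sum>p\<in>I. scl V (r p) (x p)) = (\<Sum>p\<in>I. scl U (r p) (F (x p)))"
proof -
  interpret v: vector_space "scl V" using V by (simp add: is_vsp_def)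
  interpret u: vector_space "scl U" using U by (simp add: is_vsp_def)
  have sub: "v.subspace (carrier V)" using V by (simp add: is_vsp_def)
  have F0: "F 0 = 0"
    using F v.subspace_0[OF sub] unfolding linear_on_def
    by (metis u.scale_zero_left v.scale_zero_left)
  show ?thesis using assms(4,5)
  proof (induction I rule: finite_induct)
    case empty then show ?case by (simp add: F0)
  next
    case (insert p I)
    have "scl V (r p) (x p) \<in> carrier V" "(\<Sum>p\<in>I. scl V (r p) (x p)) \<in> carrier V"
      using insert by (auto intro!: v.subspace_scale[OF sub] v.subspace_sum[OF sub])
    then show ?case using insert F by (simp add: linear_on_def)
  qed
qed

lemma sum_fun_apply: "(\<Sum>i\<in>I. F i) x = (\<Sum>i\<in>I. F i x)"
  for F :: "'i \<Rightarrow> 'x \<Rightarrow> 'y::comm_monoid_add"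
  by (induction I rule: infinite_finite_induct) auto

theorem tensor_universal:
  fixes V :: "('k::field, 'a::ab_group_add, 'z) vsp_scheme"
    and W :: "('k, 'b::ab_group_add, 'w) vsp_scheme"
    and U :: "('k, 'u::ab_group_add, 'x) vsp_scheme"
  assumes V: "is_vsp V" and W: "is_vsp W" and U: "is_vsp U"
  shows "is_vsp (tensor_space V W)"
    and "bilinear_on V W (tensor_space V W) (pure_tensor V W)"
    and "bilinear_on V W U f \<Longrightarrow> linear_on (tensor_space V W) U (tensor_lift (scl U) f)"
    and "bilinear_on V W U f \<Longrightarrow> v \<in> carrier V \<Longrightarrow> w \<in> carrier W \<Longrightarrow>
           tensor_lift (scl U) f (pure_tensor V W v w) = f v w"
    and "linear_on (tensor_space V W) U F \<Longrightarrow>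
           (\<And>v w. v \<in> carrier V \<Longrightarrow> w \<in> carrier W \<Longrightarrow> F (pure_tensor V W v w) = f v w) \<Longrightarrow>
           t \<in> carrier (tensor_space V W) \<Longrightarrow> F t = tensor_lift (scl U) f t"
proof -
  interpret v: vector_space "scl V" using V by (simp add: is_vsp_def)
  interpret w: vector_space "scl W" using W by (simp add: is_vsp_def)
  interpret u: vector_space "scl U" using U by (simp add: is_vsp_def)
  interpret t: vector_space "fscale :: 'k \<Rightarrow> ('a \<times> 'b \<Rightarrow> 'k) \<Rightarrow> 'a \<times> 'b \<Rightarrow> 'k"
    by (rule fscale_vector_space)
  note bV = some_basis[OF V] and bW = some_basis[OF W]
  have subV: "v.subspace (carrier V)" and subW: "w.subspace (carrier W)"
    and subU: "u.subspace (carrier U)"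
    using V W U by (simp_all add: is_vsp_def)
  define B C where "B = some_basis V" and "C = some_basis W"
  let ?T = "tensor_space V W" and ?p = "pure_tensor V W"
  let ?R = "v.representation B" and ?S = "w.representation C"
  have carrT: "carrier ?T = {t. finite {p. t p \<noteq> 0} \<and> {p. t p \<noteq> 0} \<subseteq> B \<times> C}"
    and sclT: "scl ?T = fscale"
    by (simp_all add: tensor_space_def B_def C_def)
  have carrI: "t \<in> carrier ?T" if "finite S" "S \<subseteq> B \<times> C" "{p. t p \<noteq> 0} \<subseteq> S" for t S
    using finite_subset[OF that(3,1)] order.trans[OF that(3,2)] by (simp add: carrT)
  have pure: "?p x y = (\<lambda>q. ?R x (fst q) * ?S y (snd q))" for x y
    by (auto simp: pure_tensor_def B_def C_def split: prod.split)
  have supp: "{q. ?p x y q \<noteq> 0} \<subseteq> {b. ?R x b \<noteq> 0} \<times> {c. ?S y c \<noteq> 0}" for x y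
    by (auto simp: pure)
  have pure_in: "?p x y \<in> carrier ?T" for x y
  proof -
    have "finite {q. ?p x y q \<noteq> 0}"
      by (rule finite_subset[OF supp])
        (auto intro!: finite_cartesian_product v.finite_representation w.finite_representation)
    moreover have "fst q \<in> B \<and> snd q \<in> C" if "?p x y q \<noteq> 0" for q
      using that v.representation_ne_zero[of B x "fst q"] w.representation_ne_zero[of C y "snd q"]
      by (simp add: pure)
    ultimately show ?thesis
      by (auto simp: carrT)
  qed
  show T: "is_vsp ?T"
    unfolding is_vsp_def sclT
  proof (intro conjI t.vector_space_axioms t.subspaceI)
    show "0 \<in> carrier ?T" by (simp add: carrT)
    fix x y assume "x \<in> carrier ?T" "y \<in> carrier ?T"
    then have "finite ({p. x p \<noteq> 0} \<union> {p. y p \<noteq> 0})" "{p. x p \<noteq> 0} \<union> {p. y p \<noteq> 0} \<subseteq> B \<times> C"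
      by (auto simp: carrT)
    moreover have "{p. (x + y) p \<noteq> 0} \<subseteq> {p. x p \<noteq> 0} \<union> {p. y p \<noteq> 0}" by auto
    ultimately show "x + y \<in> carrier ?T"
      by (rule carrI)
  next
    fix r x assume "x \<in> carrier ?T"
    then have "finite {p. x p \<noteq> 0}" "{p. x p \<noteq> 0} \<subseteq> B \<times> C"
      by (auto simp: carrT)
    moreover have "{p. fscale r x p \<noteq> 0} \<subseteq> {p. x p \<noteq> 0}" by (auto simp: fscale_def)
    ultimately show "fscale r x \<in> carrier ?T"
      by (rule carrI)
  qed
  have indB: "v.independent B" and indC: "w.independent C"
    and spB: "\<And>x. x \<in> carrier V \<Longrightarrow> x \<in> v.span B" and spC: "\<And>y. y \<in> carrier W \<Longrightarrow> y \<in> w.span C"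
    using bV bW by (auto simp: B_def C_def)
  show "bilinear_on V W ?T ?p"
    unfolding bilinear_on_def sclT
    by (simp add: pure_in)
      (simp add: pure fun_eq_iff fscale_def distrib_left distrib_right mult.assoc
        mult.left_commute spB spC v.representation_add[OF indB] w.representation_add[OF indC]
        v.representation_scale[OF indB] w.representation_scale[OF indC])
  show "linear_on ?T U (tensor_lift (scl U) f)" if f: "bilinear_on V W U f"
  proof -
    have lin: "tensor_lift (scl U) f x = (\<Sum>p\<in>F. scl U (x p) (f (fst p) (snd p)))"
      if "finite F" "{p. x p \<noteq> 0} \<subseteq> F" for F x
      by (rule tensor_lift_eq_sum[OF u.vector_space_axioms that])
    show ?thesis
      unfolding linear_on_def sclT
    proof (intro conjI ballI allI)
      fix x assume x: "x \<in> carrier ?T"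
      have "f (fst p) (snd p) \<in> carrier U" if "x p \<noteq> 0" for p
        using x that bV(1) bW(1) f by (force simp: carrT bilinear_on_def B_def C_def)
      then show "tensor_lift (scl U) f x \<in> carrier U"
        using x by (subst lin[of "{p. x p \<noteq> 0}"])
          (auto simp: carrT intro!: u.subspace_sum[OF subU] u.subspace_scale[OF subU])
      fix r
      show "tensor_lift (scl U) f (fscale r x) = scl U r (tensor_lift (scl U) f x)"
        using x by (subst (1 2) lin[of "{p. x p \<noteq> 0}"])
          (auto simp: carrT fscale_def u.scale_sum_right)
    next
      fix x y assume "x \<in> carrier ?T" "y \<in> carrier ?T"
      then have fin: "finite ({p. x p \<noteq> 0} \<union> {p. y p \<noteq> 0})" by (auto simp: carrT)
      show "tensor_lift (scl U) f (x + y) = tensor_lift (scl U) f x + tensor_lift (scl U) f y"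
        by (subst (1 2 3) lin[OF fin]) (auto simp: u.scale_left_distrib sum.distrib)
    qed
  qed
  show "tensor_lift (scl U) f (?p x y) = f x y"
    if f: "bilinear_on V W U f" and x: "x \<in> carrier V" and y: "y \<in> carrier W" for x y
  proof -
    define X Y where "X = {b. ?R x b \<noteq> 0}" and "Y = {c. ?S y c \<noteq> 0}"
    have fin: "finite X" "finite Y"
      by (auto simp: X_def Y_def v.finite_representation w.finite_representation)
    have X: "b \<in> carrier V" if "b \<in> X" for b
      using that v.representation_ne_zero[of B x b] bV(1) by (auto simp: X_def B_def)
    have Y: "c \<in> carrier W" if "c \<in> Y" for c
      using that w.representation_ne_zero[of C y c] bW(1) by (auto simp: Y_def C_def)
    have linX: "linear_on V U (\<lambda>x. f x y')" if "y' \<in> carrier W" for y'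
      using f that by (auto simp: bilinear_on_def linear_on_def)
    have linY: "linear_on W U (f x')" if "x' \<in> carrier V" for x'
      using f that by (auto simp: bilinear_on_def linear_on_def)
    have xe: "x = (\<Sum>b\<in>X. scl V (?R x b) b)"
      unfolding X_def using v.sum_nonzero_representation_eq[OF indB spB[OF x]] by simp
    have ye: "y = (\<Sum>c\<in>Y. scl W (?S y c) c)"
      unfolding Y_def using w.sum_nonzero_representation_eq[OF indC spC[OF y]] by simp
    have "tensor_lift (scl U) f (?p x y) =
        (\<Sum>q\<in>X \<times> Y. scl U (?p x y q) (f (fst q) (snd q)))"
      using fin supp[of x y]
      by (intro tensor_lift_eq_sum u.vector_space_axioms) (auto simp: X_def Y_def)
    also have "\<dots> = (\<Sum>b\<in>X. scl U (?R x b) (\<Sum>c\<in>Y. scl U (?S y c) (f b c)))"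
      by (simp add: sum.cartesian_product' pure u.scale_sum_right)
    also have "\<dots> = (\<Sum>b\<in>X. scl U (?R x b) (f b y))"
    proof (rule sum.cong[OF refl])
      fix b assume "b \<in> X"
      have "f b y = f b (\<Sum>c\<in>Y. scl W (?S y c) c)" using ye by simp
      also have "\<dots> = (\<Sum>c\<in>Y. scl U (?S y c) (f b c))"
        by (rule linear_on_sum[OF W U linY[OF X[OF \<open>b \<in> X\<close>]] fin(2) Y])
      finally show "scl U (?R x b) (\<Sum>c\<in>Y. scl U (?S y c) (f b c)) = scl U (?R x b) (f b y)"
        by simp
    qed
    also have "\<dots> = f (\<Sum>b\<in>X. scl V (?R x b) b) y"
      by (rule linear_on_sum[OF V U linX[OF y] fin(1) X, symmetric])
    also have "\<dots> = f x y" using xe by simp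
    finally show ?thesis .
  qed
  show "F t = tensor_lift (scl U) f t"
    if F: "linear_on ?T U F" and t: "t \<in> carrier ?T"
      and Ff: "\<And>v w. v \<in> carrier V \<Longrightarrow> w \<in> carrier W \<Longrightarrow> F (?p v w) = f v w"
  proof -
    let ?I = "{q. t q \<noteq> 0}"
    have fin: "finite ?I" and sub: "?I \<subseteq> B \<times> C" using t by (auto simp: carrT)
    have pb: "?p b c = (\<lambda>q. if q = (b, c) then 1 else 0)" if "b \<in> B" "c \<in> C" for b c
      using that
      by (auto simp: pure fun_eq_iff v.representation_basis[OF indB] w.representation_basis[OF indC])
    have "t = (\<Sum>q\<in>?I. fscale (t q) (?p (fst q) (snd q)))"
    proof
      fix q
      have "(\<Sum>q\<in>?I. fscale (t q) (?p (fst q) (snd q))) q =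
          (\<Sum>q'\<in>?I. fscale (t q') (?p (fst q') (snd q')) q)"
        by (rule sum_fun_apply)
      also have "\<dots> = (\<Sum>q'\<in>?I. if q' = q then t q else 0)"
        using sub by (intro sum.cong) (auto simp: fscale_def pb subset_iff)
      also have "\<dots> = t q" using fin by simp
      finally show "t q = (\<Sum>q\<in>?I. fscale (t q) (?p (fst q) (snd q))) q" by simp
    qed
    then have "F t = F (\<Sum>q\<in>?I. fscale (t q) (?p (fst q) (snd q)))" by simp
    also have "\<dots> = (\<Sum>q\<in>?I. scl U (t q) (F (?p (fst q) (snd q))))"
      using linear_on_sum[OF T U F fin, of "\<lambda>q. ?p (fst q) (snd q)" t] pure_in
      by (simp add: sclT)
    also have "\<dots> = (\<Sum>q\<in>?I. scl U (t q) (f (fst q) (snd q)))"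
      using sub bV(1) bW(1) by (intro sum.cong refl) (subst Ff; force simp: B_def C_def)
    also have "\<dots> = tensor_lift (scl U) f t"
      using tensor_lift_eq_sum[OF u.vector_space_axioms fin, of t f] by simp
    finally show ?thesis .
  qed
qed

definition tensor_mul ::
    "('k::field, 'a::ab_group_add, 'z) alg_scheme \<Rightarrow>
     ('a \<times> 'a \<Rightarrow> 'k) \<Rightarrow> ('a \<times> 'a \<Rightarrow> 'k) \<Rightarrow> ('a \<times> 'a \<Rightarrow> 'k)" where
  "tensor_mul A t u =
     tensor_lift fscale (\<lambda>a a'. tensor_lift fscale
       (\<lambda>b b'. pure_tensor A A (amul A a b) (amul A a' b')) u) t"

text \<open>Algebras with a comultiplication \<open>comult A\<close>, and the action
  \<open>a (m \<otimes> n) = \<Sum> a\<^sub>1 m \<otimes> a\<^sub>2 n\<close> on tensor products of modules.\<close>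

record ('k, 'a) coalg = "('k, 'a) alg" +
  comult :: "'a \<Rightarrow> ('a \<times> 'a \<Rightarrow> 'k)"

definition tensor_module ::
    "('k::field, 'a::ab_group_add, 'z) coalg_scheme \<Rightarrow> ('k, 'a, 'm::ab_group_add) lmod \<Rightarrow>
     ('k, 'a, 'n::ab_group_add) lmod \<Rightarrow> ('k, 'a, 'm \<times> 'n \<Rightarrow> 'k) lmod" where
  "tensor_module A M N =
     \<lparr>carrier = carrier (tensor_space M N),
      scl = fscale,
      act = (\<lambda>a t. tensor_lift fscale (\<lambda>a\<^sub>1 a\<^sub>2. tensor_lift fscale
               (\<lambda>m n. pure_tensor M N (act M a\<^sub>1 m) (act N a\<^sub>2 n)) t) (comult A a))\<rparr>"


section \<open>The group algebra and the Hopf algebra of a group datum\<close>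

definition basis_vec :: "'x \<Rightarrow> 'x \<Rightarrow> 'k::field" where
  "basis_vec x = (\<lambda>z. if z = x then 1 else 0)"

lemma is_alg_structure_constants:
  fixes c :: "'x \<Rightarrow> 'x \<Rightarrow> 'x \<Rightarrow> 'k::field"
  assumes S: "finite S" and e: "e \<in> S"
    and supp: "\<And>p q x. p \<in> S \<Longrightarrow> q \<in> S \<Longrightarrow> x \<notin> S \<Longrightarrow> c p q x = 0"
    and unit: "\<And>p. p \<in> S \<Longrightarrow> c e p = basis_vec p" "\<And>p. p \<in> S \<Longrightarrow> c p e = basis_vec p"
    and assoc: "\<And>p q r x. p \<in> S \<Longrightarrow> q \<in> S \<Longrightarrow> r \<in> S \<Longrightarrow> x \<in> S \<Longrightarrow>
      (\<Sum>u\<in>S. c p q u * c u r x) = (\<Sum>u\<in>S. c q r u * c p u x)"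
  shows "is_alg \<lparr>carrier = {a. \<forall>x. x \<notin> S \<longrightarrow> a x = 0}, scl = fscale,
    amul = (\<lambda>a b. \<Sum>p\<in>S. \<Sum>q\<in>S. fscale (a p * b q) (c p q)), aone = basis_vec e\<rparr>"
proof -
  define m where "m a b = (\<Sum>p\<in>S. \<Sum>q\<in>S. fscale (a p * b q) (c p q))" for a b
  interpret t: vector_space "fscale :: 'k \<Rightarrow> ('x \<Rightarrow> 'k) \<Rightarrow> 'x \<Rightarrow> 'k"
    by (rule fscale_vector_space)
  have m: "m a b x = (\<Sum>p\<in>S. \<Sum>q\<in>S. a p * b q * c p q x)" for a b x
    by (simp add: m_def sum_fun_apply fscale_def)
  have delta: "(\<Sum>p\<in>S. a p * basis_vec p x) = (if x \<in> S then a x else 0)" for a x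
  proof -
    have "(\<Sum>p\<in>S. a p * basis_vec p x) = (\<Sum>p\<in>S. if p = x then a p else 0)"
      by (rule sum.cong) (auto simp: basis_vec_def)
    then show ?thesis using S by simp
  qed
  have single: "(\<Sum>p\<in>S. basis_vec e p * F p) = F e" for F :: "'x \<Rightarrow> 'k"
  proof -
    have "(\<Sum>p\<in>S. basis_vec e p * F p) = (\<Sum>p\<in>S. if p = e then F p else 0)"
      by (rule sum.cong) (auto simp: basis_vec_def)
    then show ?thesis using S e by simp
  qed
  have one_left: "m (basis_vec e) a = a" if "\<And>x. x \<notin> S \<Longrightarrow> a x = 0" for a
  proof
    fix x
    have "m (basis_vec e) a x = (\<Sum>p\<in>S. basis_vec e p * (\<Sum>q\<in>S. a q * c p q x))"
      by (simp add: m sum_distrib_left mult.assoc)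
    also have "\<dots> = (\<Sum>q\<in>S. a q * basis_vec q x)"
      using unit(1) by (simp add: single)
    finally show "m (basis_vec e) a x = a x" using that by (simp add: delta)
  qed
  have one_right: "m a (basis_vec e) = a" if "\<And>x. x \<notin> S \<Longrightarrow> a x = 0" for a
  proof
    fix x
    have "m a (basis_vec e) x = (\<Sum>p\<in>S. a p * (\<Sum>q\<in>S. basis_vec e q * c p q x))"
      by (simp add: m sum_distrib_left mult.assoc)
    also have "\<dots> = (\<Sum>p\<in>S. a p * basis_vec p x)"
      using unit(2) by (simp add: single)
    finally show "m a (basis_vec e) x = a x" using that by (simp add: delta)
  qed
  have assoc': "m (m a b) d x = m a (m b d) x" if x: "x \<in> S" for a b d x
  proof -
    have "m (m a b) d x =
        (\<Sum>u\<in>S. \<Sum>r\<in>S. \<Sum>p\<in>S. \<Sum>q\<in>S. a p * b q * d r * (c p q u * c u r x))"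
      by (simp add: m sum_distrib_left sum_distrib_right algebra_simps)
    also have "\<dots> = (\<Sum>r\<in>S. \<Sum>p\<in>S. \<Sum>q\<in>S. \<Sum>u\<in>S. a p * b q * d r * (c p q u * c u r x))"
      by (subst sum.swap, rule sum.cong[OF refl], subst sum.swap, rule sum.cong[OF refl],
        subst sum.swap, rule refl)
    also have "\<dots> = (\<Sum>r\<in>S. \<Sum>p\<in>S. \<Sum>q\<in>S. \<Sum>u\<in>S. a p * b q * d r * (c q r u * c p u x))"
      by (rule sum.cong[OF refl], rule sum.cong[OF refl], rule sum.cong[OF refl])
        (simp only: sum_distrib_left[symmetric] assoc x)
    also have "\<dots> = (\<Sum>p\<in>S. \<Sum>q\<in>S. \<Sum>r\<in>S. \<Sum>u\<in>S. a p * b q * d r * (c q r u * c p u x))"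
      by (subst sum.swap, rule sum.cong[OF refl], rule sum.swap)
    also have "\<dots> = (\<Sum>p\<in>S. \<Sum>u\<in>S. \<Sum>q\<in>S. \<Sum>r\<in>S. a p * b q * d r * (c q r u * c p u x))"
      by (rule sum.cong[OF refl], subst (2) sum.swap, rule sum.cong[OF refl], rule sum.swap)
    also have "\<dots> = m a (m b d) x"
      by (simp add: m sum_distrib_left sum_distrib_right algebra_simps)
    finally show ?thesis .
  qed
  have closed: "m a b x = 0" if "x \<notin> S" for a b x
    using that by (simp add: m supp)
  have "m (m a b) d = m a (m b d)" for a b d
    using assoc' closed by (metis ext)
  moreover have "m (a + b) d = m a d + m b d" "m a (b + d) = m a b + m a d" for a b d
    by (auto simp: m fun_eq_iff algebra_simps sum.distrib)
  moreover have "m (fscale r a) b = fscale r (m a b)" "m a (fscale r b) = fscale r (m a b)" for r a b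
    by (auto simp: m fun_eq_iff fscale_def algebra_simps sum_distrib_left)
  moreover have "t.subspace {a. \<forall>x. x \<notin> S \<longrightarrow> a x = 0}"
    by (auto simp: t.subspace_def fscale_def)
  ultimately have "is_alg \<lparr>carrier = {a. \<forall>x. x \<notin> S \<longrightarrow> a x = 0}, scl = fscale,
      amul = m, aone = basis_vec e\<rparr>"
    using e one_left one_right closed t.vector_space_axioms
    by (auto simp: is_alg_def is_vsp_def basis_vec_def[of e])
  then show ?thesis by (simp add: m_def[abs_def])
qed

definition group_alg_alg :: "('g, 'b) monoid_scheme \<Rightarrow> ('k::field, 'g \<Rightarrow> 'k) alg" where
  "group_alg_alg G =
     \<lparr>carrier = {a. \<forall>x. x \<notin> carrier G \<longrightarrow> a x = 0},
      scl = fscale,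
      amul = (\<lambda>a b. \<Sum>x\<in>carrier G. \<Sum>y\<in>carrier G. fscale (a x * b y) (basis_vec (x \<otimes>\<^bsub>G\<^esub> y))),
      aone = basis_vec \<one>\<^bsub>G\<^esub>\<rparr>"

lemma (in group) is_alg_group_alg_alg:
  assumes "finite (carrier G)"
  shows "is_alg (group_alg_alg G :: ('k::field, 'a \<Rightarrow> 'k) alg)"
proof -
  have eval: "(\<Sum>u\<in>carrier G. basis_vec p u * F u) = F p"
    if "p \<in> carrier G" for p and F :: "'a \<Rightarrow> 'k"
  proof -
    have "(\<Sum>u\<in>carrier G. basis_vec p u * F u) = (\<Sum>u\<in>carrier G. if u = p then F u else 0)"
      by (rule sum.cong) (auto simp: basis_vec_def)
    then show ?thesis using assms that by simp
  qed
  show ?thesis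
    unfolding group_alg_alg_def
    by (rule is_alg_structure_constants[OF assms])
      (auto simp: eval m_assoc, auto simp: basis_vec_def)
qed

definition group_alg :: "('g, 'b) monoid_scheme \<Rightarrow> ('k::field, 'g \<Rightarrow> 'k) coalg" where
  "group_alg G = alg.extend (group_alg_alg G)
     \<lparr>comult = (\<lambda>a. \<Sum>x\<in>carrier G. fscale (a x)
        (pure_tensor (group_alg_alg G) (group_alg_alg G) (basis_vec x) (basis_vec x)))\<rparr>"

locale group_datum = group G for G :: "('g, 'b) monoid_scheme" (structure) +
  fixes \<chi> :: "'g \<Rightarrow> 'k::field" and g :: 'g and n :: nat
  assumes finite_G: "finite (carrier G)"
    and char_one: "\<chi> \<one> = 1"
    and char_mult: "\<And>x y. x \<in> carrier G \<Longrightarrow> y \<in> carrier G \<Longrightarrow> \<chi> (x \<otimes> y) = \<chi> x * \<chi> y"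
    and g_in_G: "g \<in> carrier G"
    and g_central: "\<And>x. x \<in> carrier G \<Longrightarrow> g \<otimes> x = x \<otimes> g"
    and n_ge_2: "n \<ge> 2"
    and q_pow_n: "\<chi> g ^ n = 1"
    and q_order: "\<And>m. 0 < m \<Longrightarrow> m < n \<Longrightarrow> \<chi> g ^ m \<noteq> 1"
    and char_pow_n: "\<And>x. x \<in> carrier G \<Longrightarrow> \<chi> x ^ n = 1"
    and g_pow_n: "g [^] n \<noteq> \<one>"

text \<open>
  \<open>H\<close> is realised on its basis \<open>y\<^sup>i h\<close>, indexed by the pairs \<open>(i, h)\<close> with \<open>i < n\<close>.
  For \<open>m < 2 n\<close>, \<open>hopf_monom G g n m h\<close> is \<open>y\<^sup>m h\<close>, reduced by \<open>y\<^sup>n = g\<^sup>n - 1\<close>, and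
  \<open>(y\<^sup>i h) (y\<^sup>j h') = \<chi>(h)\<^sup>-\<^sup>j y\<^sup>i\<^sup>+\<^sup>j h h'\<close> because \<open>y h = \<chi>(h) h y\<close>.
\<close>

definition hopf_monom ::
    "('g, 'b) monoid_scheme \<Rightarrow> 'g \<Rightarrow> nat \<Rightarrow> nat \<Rightarrow> 'g \<Rightarrow> (nat \<times> 'g \<Rightarrow> 'k::field)" where
  "hopf_monom G g n m h =
     (if m < n then basis_vec (m, h)
      else basis_vec (m - n, (g [^]\<^bsub>G\<^esub> n) \<otimes>\<^bsub>G\<^esub> h) - basis_vec (m - n, h))"

definition hopf_alg_alg ::
    "('g, 'b) monoid_scheme \<Rightarrow> ('g \<Rightarrow> 'k::field) \<Rightarrow> 'g \<Rightarrow> nat \<Rightarrow> ('k, nat \<times> 'g \<Rightarrow> 'k) alg" where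
  "hopf_alg_alg G \<chi> g n =
     \<lparr>carrier = {a. \<forall>p. p \<notin> {..<n} \<times> carrier G \<longrightarrow> a p = 0},
      scl = fscale,
      amul = (\<lambda>a b. \<Sum>(i, h)\<in>{..<n} \<times> carrier G. \<Sum>(j, h')\<in>{..<n} \<times> carrier G.
         fscale (a (i, h) * b (j, h') * inverse (\<chi> h) ^ j) (hopf_monom G g n (i + j) (h \<otimes>\<^bsub>G\<^esub> h'))),
      aone = basis_vec (0, \<one>\<^bsub>G\<^esub>)\<rparr>"

definition hopf_y :: "('g, 'b) monoid_scheme \<Rightarrow> (nat \<times> 'g \<Rightarrow> 'k::field)" where
  "hopf_y G = basis_vec (1, \<one>\<^bsub>G\<^esub>)"

definition hopf_grp :: "'g \<Rightarrow> (nat \<times> 'g \<Rightarrow> 'k::field)" where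
  "hopf_grp h = basis_vec (0, h)"

context group_datum
begin

abbreviation (input) "H \<equiv> hopf_alg_alg G \<chi> g n"

abbreviation (input) "ymono \<equiv> hopf_monom G g n"

lemma char_nonzero: "x \<in> carrier G \<Longrightarrow> \<chi> x \<noteq> 0"
  using char_mult[of x "inv x"] char_one by auto

lemma char_g_pow: "\<chi> (g [^] (m::nat)) = \<chi> g ^ m"
  by (induction m) (auto simp: char_one char_mult g_in_G)

lemma g_pow_central: "x \<in> carrier G \<Longrightarrow> g [^] (m::nat) \<otimes> x = x \<otimes> g [^] m"
proof (induction m)
  case (Suc m)
  have "g [^] Suc m \<otimes> x = g [^] m \<otimes> (x \<otimes> g)"
    using Suc.prems g_in_G g_central by (simp add: m_assoc)
  also have "\<dots> = x \<otimes> g [^] m \<otimes> g"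
    using Suc g_in_G by (simp flip: m_assoc)
  finally show ?case using Suc.prems g_in_G by (simp add: m_assoc)
qed simp

lemma hopf_amul:
  "amul H = (\<lambda>a b. \<Sum>p\<in>{..<n} \<times> carrier G. \<Sum>q\<in>{..<n} \<times> carrier G.
     fscale (a p * b q)
       (fscale (inverse (\<chi> (snd p)) ^ fst q) (ymono (fst p + fst q) (snd p \<otimes> snd q))))"
  by (simp add: hopf_alg_alg_def case_prod_beta fscale_def mult.assoc)

theorem is_alg_hopf_alg_alg: "is_alg H"
proof -
  let ?S = "{..<n} \<times> carrier G" and ?\<gamma> = "g [^] n"
  define c where "c p q = fscale (inverse (\<chi> (snd p)) ^ fst q) (ymono (fst p + fst q) (snd p \<otimes> snd q))"
    for p q
  have n: "n > 0" using n_ge_2 by simp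
  have \<gamma>: "?\<gamma> \<in> carrier G" "\<chi> ?\<gamma> = 1" using g_in_G by (simp_all add: char_g_pow q_pow_n)
  have finS: "finite ?S" using finite_G by simp
  have eval: "(\<Sum>u\<in>?S. basis_vec p u * F u) = F p" if "p \<in> ?S" for p and F :: "nat \<times> 'g \<Rightarrow> 'k"
  proof -
    have "(\<Sum>u\<in>?S. basis_vec p u * F u) = (\<Sum>u\<in>?S. if u = p then F u else 0)"
      by (rule sum.cong) (auto simp: basis_vec_def)
    then show ?thesis using finS that by simp
  qed
  have eval_ymono: "(\<Sum>u\<in>?S. ymono m x u * F u) =
      (if m < n then F (m, x) else F (m - n, ?\<gamma> \<otimes> x) - F (m - n, x))"
    if "m < 2 * n" "x \<in> carrier G" for m x and F :: "nat \<times> 'g \<Rightarrow> 'k"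
  proof (cases "m < n")
    case True then show ?thesis using that by (simp add: hopf_monom_def eval)
  next
    case False
    then have "(m - n, ?\<gamma> \<otimes> x) \<in> ?S" "(m - n, x) \<in> ?S" using that \<gamma> by auto
    then show ?thesis using False
      by (simp add: hopf_monom_def left_diff_distrib sum_subtractf eval)
  qed
  define ymono3 :: "nat \<Rightarrow> 'g \<Rightarrow> nat \<times> 'g \<Rightarrow> 'k" where "ymono3 m x =
    (if m < n then basis_vec (m, x)
     else if m < 2 * n then basis_vec (m - n, ?\<gamma> \<otimes> x) - basis_vec (m - n, x)
     else basis_vec (m - 2 * n, ?\<gamma> \<otimes> (?\<gamma> \<otimes> x)) - basis_vec (m - 2 * n, ?\<gamma> \<otimes> x)
       - (basis_vec (m - 2 * n, ?\<gamma> \<otimes> x) - basis_vec (m - 2 * n, x)))" for m x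
  have ymono3: "ymono3 m x = ymono m x" if "m < 2 * n" for m x
    using that by (simp add: ymono3_def hopf_monom_def)
  have ymono3': "ymono3 m x = ymono (m - n) (?\<gamma> \<otimes> x) - ymono (m - n) x" if "n \<le> m" for m x
  proof (cases "m < 2 * n")
    case True
    then have "m - n < n" using that by simp
    then show ?thesis using that True by (simp add: ymono3_def hopf_monom_def)
  next
    case False
    then have "\<not> m - n < n" "m - n - n = m - 2 * n" by simp_all
    then show ?thesis using that False by (simp add: ymono3_def hopf_monom_def)
  qed
  have left: "(\<Sum>u\<in>?S. c p q u * c u r x) =
      inverse (\<chi> (snd p)) ^ (fst q + fst r) * inverse (\<chi> (snd q)) ^ fst r *
      ymono3 (fst p + fst q + fst r) (snd p \<otimes> snd q \<otimes> snd r) x"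
    if "p \<in> ?S" "q \<in> ?S" "r \<in> ?S" for p q r x
  proof -
    obtain i h j k l d where pqr: "p = (i, h)" "q = (j, k)" "r = (l, d)" by fastforce
    have G: "h \<in> carrier G" "k \<in> carrier G" "d \<in> carrier G" and lt: "i < n" "j < n" "l < n"
      using that by (auto simp: pqr)
    have "(\<Sum>u\<in>?S. c p q u * c u r x) =
        inverse (\<chi> h) ^ j * (\<Sum>u\<in>?S. ymono (i + j) (h \<otimes> k) u * c u r x)"
      by (simp add: c_def pqr fscale_def sum_distrib_left mult.assoc)
    also have "\<dots> = inverse (\<chi> h) ^ j * (inverse (\<chi> h * \<chi> k) ^ l *
        ymono3 (i + j + l) (h \<otimes> k \<otimes> d) x)"
    proof (cases "i + j < n")
      case True
      then show ?thesis using G lt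
        by (subst eval_ymono) (auto simp: c_def pqr fscale_def ymono3 char_mult)
    next
      case False
      then show ?thesis using G lt \<gamma>
        by (subst eval_ymono)
          (auto simp: c_def pqr fscale_def ymono3' char_mult m_assoc right_diff_distrib)
    qed
    finally show ?thesis
      by (simp add: pqr power_add power_mult_distrib mult_ac)
  qed
  have right: "(\<Sum>u\<in>?S. c q r u * c p u x) =
      inverse (\<chi> (snd p)) ^ (fst q + fst r) * inverse (\<chi> (snd q)) ^ fst r *
      ymono3 (fst p + fst q + fst r) (snd p \<otimes> snd q \<otimes> snd r) x"
    if "p \<in> ?S" "q \<in> ?S" "r \<in> ?S" for p q r x
  proof -
    obtain i h j k l d where pqr: "p = (i, h)" "q = (j, k)" "r = (l, d)" by fastforce
    have G: "h \<in> carrier G" "k \<in> carrier G" "d \<in> carrier G" and lt: "i < n" "j < n" "l < n"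
      using that by (auto simp: pqr)
    have "(\<Sum>u\<in>?S. c q r u * c p u x) =
        inverse (\<chi> k) ^ l * (\<Sum>u\<in>?S. ymono (j + l) (k \<otimes> d) u * c p u x)"
      by (simp add: c_def pqr fscale_def sum_distrib_left mult.assoc)
    also have "\<dots> = inverse (\<chi> k) ^ l * (inverse (\<chi> h) ^ (j + l) *
        ymono3 (i + j + l) (h \<otimes> k \<otimes> d) x)"
    proof (cases "j + l < n")
      case True
      then show ?thesis using G lt
        by (subst eval_ymono) (auto simp: c_def pqr fscale_def ymono3 m_assoc add.assoc)
    next
      case False
      have pow: "inverse (\<chi> h) ^ (j + l) = inverse (\<chi> h) ^ (j + l - n)"
      proof -
        have "inverse (\<chi> h) ^ (j + l) = inverse (\<chi> h) ^ (j + l - n) * inverse (\<chi> h) ^ n"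
          using False by (simp flip: power_add)
        then show ?thesis using char_pow_n[OF G(1)] by (simp add: power_inverse)
      qed
      have comm: "h \<otimes> (?\<gamma> \<otimes> (k \<otimes> d)) = ?\<gamma> \<otimes> (h \<otimes> k \<otimes> d)"
      proof -
        have "h \<otimes> (?\<gamma> \<otimes> (k \<otimes> d)) = (h \<otimes> ?\<gamma>) \<otimes> (k \<otimes> d)" using G \<gamma> by (simp add: m_assoc)
        also have "\<dots> = (?\<gamma> \<otimes> h) \<otimes> (k \<otimes> d)" using g_pow_central[OF G(1)] by simp
        finally show ?thesis using G \<gamma> by (simp add: m_assoc)
      qed
      have idx: "i + (j + l - n) = i + j + l - n" using False by simp
      have "(\<Sum>u\<in>?S. ymono (j + l) (k \<otimes> d) u * c p u x) =
          c p (j + l - n, ?\<gamma> \<otimes> (k \<otimes> d)) x - c p (j + l - n, k \<otimes> d) x"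
        using False G lt by (subst eval_ymono) auto
      also have "\<dots> = inverse (\<chi> h) ^ (j + l) *
          (ymono (i + j + l - n) (?\<gamma> \<otimes> (h \<otimes> k \<otimes> d)) x - ymono (i + j + l - n) (h \<otimes> k \<otimes> d) x)"
        using G by (simp add: c_def pqr fscale_def pow comm idx m_assoc right_diff_distrib)
      also have "\<dots> = inverse (\<chi> h) ^ (j + l) * ymono3 (i + j + l) (h \<otimes> k \<otimes> d) x"
        using False by (simp add: ymono3')
      finally show ?thesis by simp
    qed
    finally show ?thesis
      by (simp add: pqr power_add mult_ac)
  qed
  have "is_alg \<lparr>carrier = {a. \<forall>x. x \<notin> ?S \<longrightarrow> a x = 0}, scl = fscale,
      amul = (\<lambda>a b. \<Sum>p\<in>?S. \<Sum>q\<in>?S. fscale (a p * b q) (c p q)), aone = basis_vec (0, \<one>)\<rparr>"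
  proof (rule is_alg_structure_constants[OF finS])
    fix p q x assume "p \<in> ?S" "q \<in> ?S" "x \<notin> ?S"
    then show "c p q x = 0"
      using \<gamma> by (auto simp: c_def fscale_def hopf_monom_def basis_vec_def)
  next
    fix p assume "p \<in> ?S"
    then show "c (0, \<one>) p = basis_vec p" "c p (0, \<one>) = basis_vec p"
      by (auto simp: c_def fscale_def hopf_monom_def char_one)
  qed (use n in \<open>auto simp: left right\<close>)
  moreover have "H = \<lparr>carrier = {a. \<forall>x. x \<notin> ?S \<longrightarrow> a x = 0}, scl = fscale,
      amul = (\<lambda>a b. \<Sum>p\<in>?S. \<Sum>q\<in>?S. fscale (a p * b q) (c p q)), aone = basis_vec (0, \<one>)\<rparr>"
    unfolding c_def by (simp add: hopf_amul[symmetric]) (simp add: hopf_alg_alg_def)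
  ultimately show ?thesis by simp
qed

lemma hopf_mul_basis:
  assumes "i < n" "j < n" "h \<in> carrier G" "h' \<in> carrier G"
  shows "amul H (basis_vec (i, h)) (basis_vec (j, h')) =
    fscale (inverse (\<chi> h) ^ j) (ymono (i + j) (h \<otimes> h'))"
proof -
  let ?S = "{..<n} \<times> carrier G"
  have eval: "(\<Sum>u\<in>?S. fscale (r * basis_vec p u) (F u)) = fscale r (F p)"
    if "p \<in> ?S" for p r and F :: "nat \<times> 'g \<Rightarrow> nat \<times> 'g \<Rightarrow> 'k"
  proof -
    have "(\<Sum>u\<in>?S. fscale (r * basis_vec p u) (F u)) =
        (\<Sum>u\<in>?S. if u = p then fscale r (F u) else 0)"
      by (rule sum.cong) (auto simp: basis_vec_def fscale_def)
    then show ?thesis using finite_G that by simp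
  qed
  have "amul H (basis_vec (i, h)) (basis_vec (j, h')) = (\<Sum>p\<in>?S. fscale (basis_vec (i, h) p)
      (fscale (inverse (\<chi> (snd p)) ^ j) (ymono (fst p + j) (snd p \<otimes> h'))))"
    unfolding hopf_amul using assms by (simp add: eval)
  also have "\<dots> = fscale 1 (fscale (inverse (\<chi> h) ^ j) (ymono (i + j) (h \<otimes> h')))"
    using assms eval[of "(i, h)" 1] by simp
  finally show ?thesis by (simp add: fscale_def)
qed

text \<open>The generators \<open>y\<close> and \<open>h \<in> G\<close>, the defining relations, and the basis elements
  as monomials in the generators.\<close>

theorem hopf_relations:
  shows "aone H = hopf_grp \<one>"
    and "h \<in> carrier G \<Longrightarrow> h' \<in> carrier G \<Longrightarrow>
           amul H (hopf_grp h) (hopf_grp h') = hopf_grp (h \<otimes> h')"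
    and "h \<in> carrier G \<Longrightarrow>
           amul H (hopf_y G) (hopf_grp h) = fscale (\<chi> h) (amul H (hopf_grp h) (hopf_y G))"
    and "(amul H (hopf_y G) ^^ n) (aone H) = hopf_grp (g [^] n) - aone H"
    and "i < n \<Longrightarrow> h \<in> carrier G \<Longrightarrow>
           (amul H (hopf_y G) ^^ i) (hopf_grp h) = basis_vec (i, h)"
proof -
  show one: "aone H = hopf_grp \<one>" by (simp add: hopf_alg_alg_def hopf_grp_def)
  show "amul H (hopf_grp h) (hopf_grp h') = hopf_grp (h \<otimes> h')"
    if "h \<in> carrier G" "h' \<in> carrier G"
    using that n_ge_2 by (simp add: hopf_grp_def hopf_mul_basis hopf_monom_def fscale_def)
  show "amul H (hopf_y G) (hopf_grp h) = fscale (\<chi> h) (amul H (hopf_grp h) (hopf_y G))"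
    if "h \<in> carrier G"
    using that n_ge_2 char_nonzero[OF that]
    by (simp add: hopf_grp_def hopf_y_def hopf_mul_basis hopf_monom_def fscale_def mult.assoc[symmetric])
  have y: "amul H (hopf_y G) (basis_vec (i, h)) = ymono (Suc i) h" if "i < n" "h \<in> carrier G" for i h
    using that n_ge_2 by (simp add: hopf_y_def hopf_mul_basis char_one fscale_def)
  show pow: "(amul H (hopf_y G) ^^ i) (hopf_grp h) = basis_vec (i, h)"
    if "i < n" "h \<in> carrier G" for i h
    using that by (induction i) (auto simp: hopf_grp_def y hopf_monom_def)
  obtain k where k: "n = Suc k" using n_ge_2 by (cases n) auto
  have lt: "k < n" by (simp add: k)
  have iter: "(f ^^ n) z = f ((f ^^ k) z)" for f :: "(nat \<times> 'g \<Rightarrow> 'k) \<Rightarrow> nat \<times> 'g \<Rightarrow> 'k" and z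
    by (simp add: k)
  have "(amul H (hopf_y G) ^^ n) (aone H) = amul H (hopf_y G) ((amul H (hopf_y G) ^^ k) (hopf_grp \<one>))"
    unfolding one by (rule iter)
  also have "\<dots> = ymono n \<one>"
    using y[OF lt one_closed] by (simp add: pow[OF lt one_closed] flip: k)
  also have "\<dots> = hopf_grp (g [^] n) - aone H"
    using g_in_G by (simp add: hopf_monom_def one hopf_grp_def)
  finally show "(amul H (hopf_y G) ^^ n) (aone H) = hopf_grp (g [^] n) - aone H" .
qed

end

text \<open>The comultiplication is the linear extension of
  \<open>\<Delta>(y\<^sup>i h) = (y \<otimes> g + 1 \<otimes> y)\<^sup>i (h \<otimes> h)\<close>.\<close>

definition hopf_alg ::
    "('g, 'b) monoid_scheme \<Rightarrow> ('g \<Rightarrow> 'k::field) \<Rightarrow> 'g \<Rightarrow> nat \<Rightarrow> ('k, nat \<times> 'g \<Rightarrow> 'k) coalg" where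
  "hopf_alg G \<chi> g n =
     (let H = hopf_alg_alg G \<chi> g n;
          \<Delta>y = pure_tensor H H (hopf_y G) (hopf_grp g) + pure_tensor H H (aone H) (hopf_y G)
      in alg.extend H
        \<lparr>comult = (\<lambda>a. \<Sum>(i, h)\<in>{..<n} \<times> carrier G. fscale (a (i, h))
           ((tensor_mul H \<Delta>y ^^ i) (pure_tensor H H (hopf_grp h) (hopf_grp h))))\<rparr>)"


section \<open>Modules\<close>

definition char_inv_module ::
    "('g, 'b) monoid_scheme \<Rightarrow> ('g \<Rightarrow> 'k::field) \<Rightarrow> ('k, 'g \<Rightarrow> 'k, 'k) lmod" where
  "char_inv_module G \<chi> =
     \<lparr>carrier = UNIV, scl = (*), act = (\<lambda>a c. \<Sum>h\<in>carrier G. a h * inverse (\<chi> h) * c)\<rparr>"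

text \<open>
  \<open>V \<oplus> xV \<oplus> \<dots> \<oplus> x\<^sup>k\<^sup>-\<^sup>1V\<close>, the element \<open>f\<close> standing for the sum of the
  \<open>x\<^sup>s (f s)\<close>, with \<open>y (x\<^sup>s v) = x\<^sup>s\<^sup>+\<^sup>1 v\<close> for \<open>s \<le> k - 2\<close> and
  \<open>y (x\<^sup>k\<^sup>-\<^sup>1 v) = c v\<close>.
\<close>

definition x_grp ::
    "('g \<Rightarrow> 'k::field) \<Rightarrow> ('k, 'g \<Rightarrow> 'k, 'v) lmod \<Rightarrow> 'g \<Rightarrow> (nat \<Rightarrow> 'v) \<Rightarrow> (nat \<Rightarrow> 'v)" where
  "x_grp \<chi> V h f = (\<lambda>s. scl V (inverse (\<chi> h) ^ s) (act V (basis_vec h) (f s)))"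

definition x_shift ::
    "('k, 'g \<Rightarrow> 'k, 'v::ab_group_add) lmod \<Rightarrow> nat \<Rightarrow> 'k \<Rightarrow> (nat \<Rightarrow> 'v) \<Rightarrow> (nat \<Rightarrow> 'v)" where
  "x_shift V k c f =
     (\<lambda>s. if s = 0 then scl V c (f (k - 1)) else if s < k then f (s - 1) else 0)"

definition x_module ::
    "('g, 'b) monoid_scheme \<Rightarrow> ('g \<Rightarrow> 'k::field) \<Rightarrow> nat \<Rightarrow> ('k, 'g \<Rightarrow> 'k, 'v::ab_group_add) lmod \<Rightarrow>
     nat \<Rightarrow> 'k \<Rightarrow> ('k, nat \<times> 'g \<Rightarrow> 'k, nat \<Rightarrow> 'v) lmod" where
  "x_module G \<chi> n V k c =
     \<lparr>carrier = {f. (\<forall>s<k. f s \<in> carrier V) \<and> (\<forall>s\<ge>k. f s = 0)},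
      scl = (\<lambda>r f s. scl V r (f s)),
      act = (\<lambda>a f. \<Sum>(i, h)\<in>{..<n} \<times> carrier G.
         (\<lambda>s. scl V (a (i, h)) ((x_shift V k c ^^ i) (x_grp \<chi> V h f) s)))\<rparr>"

definition M_module ::
    "('g, 'b) monoid_scheme \<Rightarrow> ('g \<Rightarrow> 'k::field) \<Rightarrow> nat \<Rightarrow> ('k, 'g \<Rightarrow> 'k, 'v::ab_group_add) lmod \<Rightarrow>
     nat \<Rightarrow> ('k, nat \<times> 'g \<Rightarrow> 'k, nat \<Rightarrow> 'v) lmod" where
  "M_module G \<chi> n V k = x_module G \<chi> n V k 0"

definition P_module ::
    "('g, 'b) monoid_scheme \<Rightarrow> ('g \<Rightarrow> 'k::field) \<Rightarrow> nat \<Rightarrow> ('k, 'g \<Rightarrow> 'k, 'v::ab_group_add) lmod \<Rightarrow>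
     'k \<Rightarrow> ('k, nat \<times> 'g \<Rightarrow> 'k, nat \<Rightarrow> 'v) lmod" where
  "P_module G \<chi> n V l = x_module G \<chi> n V n (l - 1)"

text \<open>
  The index set \<open>\<Omega>\<close> is the type \<open>'i\<close>. Completeness is required for modules on subspaces of
  \<open>nat \<Rightarrow> 'k\<close>; this suffices, since a finite-dimensional space is isomorphic to such a
  subspace.
\<close>

definition complete_simples ::
    "('g, 'b) monoid_scheme \<Rightarrow> ('i \<Rightarrow> ('k::field, 'g \<Rightarrow> 'k, 'v::ab_group_add) lmod) \<Rightarrow> bool" where
  "complete_simples G V \<longleftrightarrow>
     (\<forall>i. simple_module (group_alg G) (V i)) \<and>
     (\<forall>i j. module_iso (group_alg G) (V i) (V j) \<longrightarrow> i = j) \<and>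
     (\<forall>W :: ('k, 'g \<Rightarrow> 'k, nat \<Rightarrow> 'k) lmod. simple_module (group_alg G) W \<longrightarrow>
        (\<exists>i. module_iso (group_alg G) W (V i)))"

end

theory Submission
  imports Defs
begin

text \<open>
  On a tensor product of modules, \<open>y\<close> acts as \<open>y \<otimes> g + 1 \<otimes> y\<close>, a sum of two operators that commute up to
  the primitive \<open>n\<close>-th root of unity \<open>q\<close>; by the Gaussian binomial theorem its \<open>n\<close>-th power is \<open>g\<^sup>n - 1\<close>.
  Therefore every \<open>G\<close>-linear map \<open>\<psi>\<close> from \<open>V\<^sub>s\<close> to an \<open>H\<close>-module extends to an \<open>H\<close>-linear map on \<open>P\<^sub>s\<close> by
  \<open>x\<^sup>r v \<mapsto> y\<^sup>r \<psi>(v)\<close>. In \<open>M(k,i) \<otimes> P\<^sub>j\<close> the subspace \<open>x\<^sup>t V\<^sub>i \<otimes> V\<^sub>j\<close> is \<open>V\<^sub>i \<otimes> V\<^sub>j\<close> twisted by \<open>\<chi>\<^sup>-\<^sup>t\<close>, hence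
  isomorphic to the sum of the \<open>V\<close> with index \<open>\<tau>\<^sup>t(s)\<close>. The induced map from the sum of the corresponding \<open>P\<close>
  is triangular for the filtration of \<open>M(k,i)\<close> by powers of \<open>x\<close>, because \<open>y\<close> raises the degree in \<open>x\<close> of
  the first factor or acts on the second factor alone; so it is bijective. The same argument with
  the factors exchanged applies to \<open>P\<^sub>j \<otimes> M(k,i)\<close>. The decomposition of \<open>V\<^sub>i \<otimes> V\<^sub>j\<close> is Maschke's theorem,
  and its summands have \<open>\<lambda> = \<lambda>\<^sub>j\<close> because \<open>g\<^sup>n\<close> acts on \<open>V\<^sub>i \<otimes> V\<^sub>j\<close> by \<open>\<lambda>\<^sub>i \<lambda>\<^sub>j = \<lambda>\<^sub>j\<close>.
\<close>

section \<open>Linear maps between subspaces\<close>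

text \<open>No dimension count is made: the map out of the sum of the \<open>P\<close> is inverted
  by forward substitution along the degree in \<open>x\<close> of \<open>M(k,i)\<close>, which
  yields injectivity and surjectivity alike. Two facts keep the diagonal clean. The copies of
  \<open>V\<^sub>i \<otimes> V\<^sub>j\<close> sit in degree 0 of \<open>P\<^sub>j\<close> and only
  \<open>y\<^sup>s\<close> with \<open>s < n\<close> is applied, so the wrap-around constant of
  \<open>P\<^sub>j\<close> never reaches a diagonal block; and \<open>M(k,i)\<close> has wrap-around
  constant 0. But \<open>\<Delta>(y)\<close> is not symmetric: in \<open>M \<otimes> P\<close> the
  diagonal part of \<open>y\<close> is \<open>1 \<otimes> y\<close>, a plain shift, whereas in
  \<open>P \<otimes> M\<close> it is \<open>y \<otimes> g\<close>, a shift followed by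
  \<open>g\<close> on \<open>x\<^sup>t V\<^sub>i\<close>, that is by \<chi>(g)^(-t) times
  \<open>1 \<otimes> g\<close>. This is why the criterion below allows an automorphism
  \<open>L t\<close> in row t. The flip of the factors respects the group elements but need not
  respect \<open>y\<close>, so both orders are compared with one common direct sum. The map is
  H-linear at the top degree because \<open>y\<^sup>n = g\<^sup>n - 1\<close> on the target and
  \<open>g\<^sup>n\<close> acts on \<open>V\<^sub>s\<close> by the scalar that defines
  \<open>P\<^sub>s\<close>; twisting by \<chi> leaves this scalar alone, since \<chi>(g^n) = q^n =
  1.\<close>

lemma
  assumes "is_vsp V"
  shows vsp_zero: "0 \<in> carrier V"
    and vsp_add: "x \<in> carrier V \<Longrightarrow> y \<in> carrier V \<Longrightarrow> x + y \<in> carrier V"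
    and vsp_scale: "x \<in> carrier V \<Longrightarrow> scl V r x \<in> carrier V"
    and vsp_neg: "x \<in> carrier V \<Longrightarrow> - x \<in> carrier V"
    and vsp_diff: "x \<in> carrier V \<Longrightarrow> y \<in> carrier V \<Longrightarrow> x - y \<in> carrier V"
    and vsp_sum: "(\<And>i. i \<in> I \<Longrightarrow> f i \<in> carrier V) \<Longrightarrow> sum f I \<in> carrier V"
proof -
  interpret vector_space "scl V" using assms by (simp add: is_vsp_def)
  have sub: "subspace (carrier V)" using assms by (simp add: is_vsp_def)
  show "0 \<in> carrier V" "x \<in> carrier V \<Longrightarrow> y \<in> carrier V \<Longrightarrow> x + y \<in> carrier V"
    "x \<in> carrier V \<Longrightarrow> scl V r x \<in> carrier V" "x \<in> carrier V \<Longrightarrow> - x \<in> carrier V"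
    "x \<in> carrier V \<Longrightarrow> y \<in> carrier V \<Longrightarrow> x - y \<in> carrier V"
    "(\<And>i. i \<in> I \<Longrightarrow> f i \<in> carrier V) \<Longrightarrow> sum f I \<in> carrier V"
    using sub by (auto simp: subspace_0 subspace_add subspace_scale subspace_neg subspace_diff
        intro: subspace_sum)
qed

lemmas vsp_closed = vsp_zero vsp_add vsp_scale vsp_neg vsp_diff

lemma vsp_scl:
  assumes "is_vsp V"
  shows "scl V r (x + y) = scl V r x + scl V r y" "scl V (r + s) x = scl V r x + scl V s x"
    "scl V r (x - y) = scl V r x - scl V r y" "scl V (r - s) x = scl V r x - scl V s x"
    "scl V r (scl V s x) = scl V (r * s) x" "scl V 1 x = x" "scl V 0 x = 0" "scl V r 0 = 0"
    "scl V r (- x) = - scl V r x"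
proof -
  interpret vector_space "scl V" using assms by (simp add: is_vsp_def)
  show "scl V r (x + y) = scl V r x + scl V r y" "scl V (r + s) x = scl V r x + scl V s x"
    "scl V r (x - y) = scl V r x - scl V r y" "scl V (r - s) x = scl V r x - scl V s x"
    "scl V r (scl V s x) = scl V (r * s) x" "scl V 1 x = x" "scl V 0 x = 0" "scl V r 0 = 0"
    "scl V r (- x) = - scl V r x"
    by (simp_all add: scale_right_distrib scale_left_distrib scale_right_diff_distrib
        scale_left_diff_distrib)
qed

lemma vsp_scl_sum:
  assumes "is_vsp V"
  shows "scl V r (sum f I) = (\<Sum>i\<in>I. scl V r (f i))" "scl V (sum c I) x = (\<Sum>i\<in>I. scl V (c i) x)"
proof -
  interpret vector_space "scl V" using assms by (simp add: is_vsp_def)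
  show "scl V r (sum f I) = (\<Sum>i\<in>I. scl V r (f i))" "scl V (sum c I) x = (\<Sum>i\<in>I. scl V (c i) x)"
    by (simp_all add: scale_sum_right scale_sum_left)
qed

lemma is_vspI:
  assumes "vector_space (scl V)" "0 \<in> carrier V"
    "\<And>x y. x \<in> carrier V \<Longrightarrow> y \<in> carrier V \<Longrightarrow> x + y \<in> carrier V"
    "\<And>r x. x \<in> carrier V \<Longrightarrow> scl V r x \<in> carrier V"
  shows "is_vsp V"
proof -
  interpret vector_space "scl V" by fact
  show ?thesis
    unfolding is_vsp_def subspace_def using assms by blast
qed

lemma linear_onI:
  assumes "\<And>x. x \<in> carrier V \<Longrightarrow> F x \<in> carrier U"
    "\<And>x y. x \<in> carrier V \<Longrightarrow> y \<in> carrier V \<Longrightarrow> F (x + y) = F x + F y"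
    "\<And>r x. x \<in> carrier V \<Longrightarrow> F (scl V r x) = scl U r (F x)"
  shows "linear_on V U F"
  using assms by (simp add: linear_on_def)

lemma linear_onD:
  assumes "linear_on V U F"
  shows "x \<in> carrier V \<Longrightarrow> F x \<in> carrier U"
    "x \<in> carrier V \<Longrightarrow> y \<in> carrier V \<Longrightarrow> F (x + y) = F x + F y"
    "x \<in> carrier V \<Longrightarrow> F (scl V r x) = scl U r (F x)"
  using assms by (auto simp: linear_on_def)

lemma linear_on_0:
  assumes "is_vsp V" "is_vsp U" "linear_on V U F"
  shows "F 0 = 0"
proof -
  have "F (scl V 0 0) = scl U 0 (F 0)" using assms linear_onD(3) vsp_zero by blast
  then show ?thesis using assms by (simp add: vsp_scl)
qed

lemma linear_on_neg:
  assumes "is_vsp V" "is_vsp U" "linear_on V U F" "x \<in> carrier V"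
  shows "F (- x) = - F x"
proof -
  have "F (x + - x) = F x + F (- x)" using assms by (blast intro: linear_onD vsp_neg)
  then show ?thesis using linear_on_0[OF assms(1-3)] by (simp add: eq_neg_iff_add_eq_0 add.commute)
qed

lemma linear_on_diff:
  assumes "is_vsp V" "is_vsp U" "linear_on V U F" "x \<in> carrier V" "y \<in> carrier V"
  shows "F (x - y) = F x - F y"
  using linear_onD(2)[OF assms(3,4) vsp_neg[OF assms(1,5)]] linear_on_neg[OF assms(1-3,5)] by simp

lemma linear_on_setsum:
  assumes "is_vsp V" "is_vsp U" "linear_on V U F" "\<And>i. i \<in> I \<Longrightarrow> x i \<in> carrier V"
  shows "F (sum x I) = (\<Sum>i\<in>I. F (x i))"
  using assms(4)
proof (induction I rule: infinite_finite_induct)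
  case (insert p I)
  have "sum x I \<in> carrier V" by (rule vsp_sum[OF assms(1)]) (use insert in auto)
  then show ?case using insert linear_onD(2)[OF assms(3)] by simp
qed (simp_all add: linear_on_0[OF assms(1-3)])

lemma linear_on_id: "linear_on V V (\<lambda>x. x)"
  by (simp add: linear_on_def)

lemma linear_on_comp:
  "linear_on V U F \<Longrightarrow> linear_on U W E \<Longrightarrow> linear_on V W (\<lambda>x. E (F x))"
  by (simp add: linear_on_def)

lemma linear_on_zero: "is_vsp U \<Longrightarrow> linear_on V U (\<lambda>x. 0)"
  by (simp add: linear_on_def vsp_closed vsp_scl)

lemma linear_on_add:
  "is_vsp U \<Longrightarrow> linear_on V U F \<Longrightarrow> linear_on V U E \<Longrightarrow> linear_on V U (\<lambda>x. F x + E x)"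
  by (simp add: linear_on_def vsp_closed vsp_scl)

lemma linear_on_sub:
  "is_vsp U \<Longrightarrow> linear_on V U F \<Longrightarrow> linear_on V U E \<Longrightarrow> linear_on V U (\<lambda>x. F x - E x)"
  by (simp add: linear_on_def vsp_closed vsp_scl)

lemma linear_on_scl:
  "is_vsp U \<Longrightarrow> linear_on V U F \<Longrightarrow> linear_on V U (\<lambda>x. scl U r (F x))"
  by (simp add: linear_on_def vsp_closed vsp_scl mult.commute)

lemma linear_on_sum_fun:
  assumes "is_vsp U" "\<And>i. i \<in> I \<Longrightarrow> linear_on V U (F i)"
  shows "linear_on V U (\<lambda>x. \<Sum>i\<in>I. F i x)"
  using assms(2)
  by (induction I rule: infinite_finite_induct) (auto intro: linear_on_zero linear_on_add assms(1))

lemma linear_on_funpow: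
  "linear_on V V F \<Longrightarrow> linear_on V V (F ^^ i)"
  by (induction i) (auto simp: linear_on_def)

lemma linear_on_cong:
  assumes "linear_on V U F" "is_vsp V" "\<And>x. x \<in> carrier V \<Longrightarrow> F x = E x"
  shows "linear_on V U E"
  using assms by (simp add: linear_on_def vsp_closed)

lemma linear_on_inj:
  assumes "is_vsp V" "is_vsp U" "linear_on V U F" "\<And>x. x \<in> carrier V \<Longrightarrow> F x = 0 \<Longrightarrow> x = 0"
  shows "inj_on F (carrier V)"
proof (rule inj_onI)
  fix x y assume "x \<in> carrier V" "y \<in> carrier V" "F x = F y"
  then show "x = y"
    using assms(4)[of "x - y"] by (simp add: linear_on_diff[OF assms(1-3)] vsp_diff[OF assms(1)])
qed

section \<open>Tensor products of linear maps\<close>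

lemma is_vsp_tensor_space: "is_vsp V \<Longrightarrow> is_vsp W \<Longrightarrow> is_vsp (tensor_space V W)"
  by (rule tensor_universal(1)[where U = V])

lemma
  assumes "is_vsp V" "is_vsp W"
  shows pure_tensor_in: "v \<in> carrier V \<Longrightarrow> w \<in> carrier W \<Longrightarrow> pure_tensor V W v w \<in> carrier (tensor_space V W)"
    and pure_tensor_add_left: "v \<in> carrier V \<Longrightarrow> v' \<in> carrier V \<Longrightarrow> w \<in> carrier W \<Longrightarrow>
      pure_tensor V W (v + v') w = pure_tensor V W v w + pure_tensor V W v' w"
    and pure_tensor_add_right: "v \<in> carrier V \<Longrightarrow> w \<in> carrier W \<Longrightarrow> w' \<in> carrier W \<Longrightarrow>
      pure_tensor V W v (w + w') = pure_tensor V W v w + pure_tensor V W v w'"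
    and pure_tensor_scl_left: "v \<in> carrier V \<Longrightarrow> w \<in> carrier W \<Longrightarrow>
      pure_tensor V W (scl V r v) w = fscale r (pure_tensor V W v w)"
    and pure_tensor_scl_right: "v \<in> carrier V \<Longrightarrow> w \<in> carrier W \<Longrightarrow>
      pure_tensor V W v (scl W r w) = fscale r (pure_tensor V W v w)"
  using tensor_universal(2)[OF assms assms(1)] by (auto simp: bilinear_on_def tensor_space_def)

lemmas pure_tensor_bilinear = pure_tensor_add_left pure_tensor_add_right
  pure_tensor_scl_left pure_tensor_scl_right

text \<open>The uniqueness half of the universal property. Identities between linear maps on a
  tensor product are tested on pure tensors through this rule, so that the chosen bases stay out of
  sight.\<close>

lemma tensor_ext:
  assumes V: "is_vsp V" and W: "is_vsp W" and U: "is_vsp U"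
    and F: "linear_on (tensor_space V W) U F" "linear_on (tensor_space V W) U F'"
    and eq: "\<And>v w. v \<in> carrier V \<Longrightarrow> w \<in> carrier W \<Longrightarrow> F (pure_tensor V W v w) = F' (pure_tensor V W v w)"
    and t: "t \<in> carrier (tensor_space V W)"
  shows "F t = F' t"
  using tensor_universal(5)[OF V W U F(1) eq t] tensor_universal(5)[OF V W U F(2) refl t] by simp

lemma scl_tensor_space [simp]: "scl (tensor_space V W) = fscale"
  by (simp add: tensor_space_def)

text \<open>\<open>F \<otimes> E\<close>, where the two space arguments are the codomains. The
  domains enter only through the support of the tensor to which the map is applied.\<close>

definition tmap ::
    "('k::field, 'c::ab_group_add, 'z) vsp_scheme \<Rightarrow> ('k, 'd::ab_group_add, 'w) vsp_scheme \<Rightarrow>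
     ('a::ab_group_add \<Rightarrow> 'c) \<Rightarrow> ('b::ab_group_add \<Rightarrow> 'd) \<Rightarrow> ('a \<times> 'b \<Rightarrow> 'k) \<Rightarrow> ('c \<times> 'd \<Rightarrow> 'k)" where
  "tmap V W F E = tensor_lift fscale (\<lambda>v w. pure_tensor V W (F v) (E w))"

lemma
  assumes V: "is_vsp V" and W: "is_vsp W" and V': "is_vsp V'" and W': "is_vsp W'"
    and F: "linear_on V V' F" and E: "linear_on W W' E"
  shows linear_on_tmap: "linear_on (tensor_space V W) (tensor_space V' W') (tmap V' W' F E)"
    and tmap_pure: "v \<in> carrier V \<Longrightarrow> w \<in> carrier W \<Longrightarrow>
      tmap V' W' F E (pure_tensor V W v w) = pure_tensor V' W' (F v) (E w)"
proof -
  have "bilinear_on V W (tensor_space V' W') (\<lambda>v w. pure_tensor V' W' (F v) (E w))"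
    unfolding bilinear_on_def
    by (simp add: pure_tensor_in[OF V' W'] pure_tensor_bilinear[OF V' W'] linear_onD[OF F] linear_onD[OF E])
  note univ = tensor_universal(3,4)[OF V W is_vsp_tensor_space[OF V' W'] this, unfolded scl_tensor_space]
  show "linear_on (tensor_space V W) (tensor_space V' W') (tmap V' W' F E)"
    unfolding tmap_def by (rule univ)
  show "tmap V' W' F E (pure_tensor V W v w) = pure_tensor V' W' (F v) (E w)"
    if "v \<in> carrier V" "w \<in> carrier W"
    unfolding tmap_def using that by (rule univ)
qed

lemma tmap_in:
  assumes "is_vsp V" "is_vsp W" "is_vsp V'" "is_vsp W'" "linear_on V V' F" "linear_on W W' E"
    "t \<in> carrier (tensor_space V W)"
  shows "tmap V' W' F E t \<in> carrier (tensor_space V' W')"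
  using linear_onD(1)[OF linear_on_tmap[OF assms(1-6)] assms(7)] .

lemma tmap_comp:
  assumes V: "is_vsp V" and W: "is_vsp W" and V': "is_vsp V'" and W': "is_vsp W'"
    and V'': "is_vsp V''" and W'': "is_vsp W''"
    and F: "linear_on V V' F" and E: "linear_on W W' E"
    and F': "linear_on V' V'' F'" and E': "linear_on W' W'' E'"
    and t: "t \<in> carrier (tensor_space V W)"
  shows "tmap V'' W'' F' E' (tmap V' W' F E t) = tmap V'' W'' (\<lambda>x. F' (F x)) (\<lambda>x. E' (E x)) t"
proof (rule tensor_ext[OF V W is_vsp_tensor_space[OF V'' W''] _ _ _ t])
  note F'' = linear_on_comp[OF F F'] and E'' = linear_on_comp[OF E E']
  show "linear_on (tensor_space V W) (tensor_space V'' W'') (\<lambda>t. tmap V'' W'' F' E' (tmap V' W' F E t))"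
    by (rule linear_on_comp[OF linear_on_tmap[OF V W V' W' F E] linear_on_tmap[OF V' W' V'' W'' F' E']])
  show "linear_on (tensor_space V W) (tensor_space V'' W'') (tmap V'' W'' (\<lambda>x. F' (F x)) (\<lambda>x. E' (E x)))"
    by (rule linear_on_tmap[OF V W V'' W'' F'' E''])
  show "tmap V'' W'' F' E' (tmap V' W' F E (pure_tensor V W v w)) =
      tmap V'' W'' (\<lambda>x. F' (F x)) (\<lambda>x. E' (E x)) (pure_tensor V W v w)"
    if "v \<in> carrier V" "w \<in> carrier W" for v w
    using that by (simp add: tmap_pure[OF V W V' W' F E] tmap_pure[OF V W V'' W'' F'' E'']
        tmap_pure[OF V' W' V'' W'' F' E'] linear_onD[OF F] linear_onD[OF E])
qed

text \<open>Linear maps are total functions that are constrained on the carrier only, so maps that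
  agree there may differ as functions. This rule replaces rewriting inside
  \<open>tmap\<close>.\<close>

lemma tmap_cong:
  assumes V: "is_vsp V" and W: "is_vsp W" and V': "is_vsp V'" and W': "is_vsp W'"
    and F: "linear_on V V' F" and E: "linear_on W W' E"
    and eq: "\<And>v. v \<in> carrier V \<Longrightarrow> F v = F' v" "\<And>w. w \<in> carrier W \<Longrightarrow> E w = E' w"
    and t: "t \<in> carrier (tensor_space V W)"
  shows "tmap V' W' F E t = tmap V' W' F' E' t"
proof -
  have F': "linear_on V V' F'" by (rule linear_on_cong[OF F V]) (rule eq)
  have E': "linear_on W W' E'" by (rule linear_on_cong[OF E W]) (rule eq)
  show ?thesis
    by (rule tensor_ext[OF V W is_vsp_tensor_space[OF V' W'] linear_on_tmap[OF V W V' W' F E]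
          linear_on_tmap[OF V W V' W' F' E'] _ t])
      (simp add: tmap_pure[OF V W V' W' F E] tmap_pure[OF V W V' W' F' E'] eq)
qed

lemma tmap_id:
  assumes V: "is_vsp V" and W: "is_vsp W" and t: "t \<in> carrier (tensor_space V W)"
  shows "tmap V W (\<lambda>v. v) (\<lambda>w. w) t = t"
  by (rule tensor_ext[OF V W is_vsp_tensor_space[OF V W] linear_on_tmap[OF V W V W] linear_on_id _ t])
    (simp_all add: linear_on_id tmap_pure[OF V W V W])

lemma
  assumes V: "is_vsp V" and W: "is_vsp W" and V': "is_vsp V'" and W': "is_vsp W'"
    and F: "linear_on V V' F" and E: "linear_on W W' E"
    and t: "t \<in> carrier (tensor_space V W)"
  shows tmap_scl_left: "tmap V' W' (\<lambda>v. scl V' r (F v)) E t = fscale r (tmap V' W' F E t)"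
    and tmap_scl_right: "tmap V' W' F (\<lambda>w. scl W' r (E w)) t = fscale r (tmap V' W' F E t)"
    and tmap_add_left: "linear_on V V' F' \<Longrightarrow>
      tmap V' W' (\<lambda>v. F v + F' v) E t = tmap V' W' F E t + tmap V' W' F' E t"
    and tmap_add_right: "linear_on W W' E' \<Longrightarrow>
      tmap V' W' F (\<lambda>w. E w + E' w) t = tmap V' W' F E t + tmap V' W' F E' t"
    and tmap_zero_left: "tmap V' W' (\<lambda>v. 0) E t = 0"
    and tmap_zero_right: "tmap V' W' F (\<lambda>w. 0) t = 0"
proof -
  note T' = is_vsp_tensor_space[OF V' W']
  note lt = linear_on_tmap[OF V W V' W'] and pt = tmap_pure[OF V W V' W']
  note ext = tensor_ext[OF V W T' lt _ _ t]
  note sc = linear_on_scl[OF T', unfolded scl_tensor_space]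
  show sl: "tmap V' W' (\<lambda>v. scl V' r (F v)) E t = fscale r (tmap V' W' F E t)" for r
    by (rule ext[OF linear_on_scl[OF V' F] E sc[OF lt[OF F E]]])
      (simp add: pt[OF linear_on_scl[OF V' F] E] pt[OF F E] pure_tensor_bilinear[OF V' W']
        linear_onD[OF F] linear_onD[OF E])
  show sr: "tmap V' W' F (\<lambda>w. scl W' r (E w)) t = fscale r (tmap V' W' F E t)" for r
    by (rule ext[OF F linear_on_scl[OF W' E] sc[OF lt[OF F E]]])
      (simp add: pt[OF F linear_on_scl[OF W' E]] pt[OF F E] pure_tensor_bilinear[OF V' W']
        linear_onD[OF F] linear_onD[OF E])
  show "tmap V' W' (\<lambda>v. F v + F' v) E t = tmap V' W' F E t + tmap V' W' F' E t"
    if F': "linear_on V V' F'"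
    by (rule ext[OF linear_on_add[OF V' F F'] E linear_on_add[OF T' lt[OF F E] lt[OF F' E]]])
      (simp add: pt[OF linear_on_add[OF V' F F'] E] pt[OF F E] pt[OF F' E] pure_tensor_bilinear[OF V' W']
        linear_onD[OF F] linear_onD[OF F'] linear_onD[OF E])
  show "tmap V' W' F (\<lambda>w. E w + E' w) t = tmap V' W' F E t + tmap V' W' F E' t"
    if E': "linear_on W W' E'"
    by (rule ext[OF F linear_on_add[OF W' E E'] linear_on_add[OF T' lt[OF F E] lt[OF F E']]])
      (simp add: pt[OF F linear_on_add[OF W' E E']] pt[OF F E] pt[OF F E'] pure_tensor_bilinear[OF V' W']
        linear_onD[OF F] linear_onD[OF E'] linear_onD[OF E])

  \<comment> \<open>The zero map is the multiple of \<open>F\<close> by the scalar 0, so this is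
    homogeneity at \<open>r = 0\<close>.\<close>
  show "tmap V' W' (\<lambda>v. 0) E t = 0"
    using sl[of 0] by (simp add: vsp_scl[OF V'] fscale_def fun_eq_iff)
  show "tmap V' W' F (\<lambda>w. 0) t = 0"
    using sr[of 0] by (simp add: vsp_scl[OF W'] fscale_def fun_eq_iff)
qed

lemma tmap_sum_left:
  assumes V: "is_vsp V" and W: "is_vsp W" and V': "is_vsp V'" and W': "is_vsp W'"
    and F: "\<And>i. i \<in> I \<Longrightarrow> linear_on V V' (F i)" and E: "linear_on W W' E"
    and t: "t \<in> carrier (tensor_space V W)"
  shows "tmap V' W' (\<lambda>v. \<Sum>i\<in>I. F i v) E t = (\<Sum>i\<in>I. tmap V' W' (F i) E t)"
  using F
  by (induction I rule: infinite_finite_induct)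
    (simp_all add: tmap_zero_left[OF V W V' W' linear_on_zero[OF V'] E t]
      tmap_add_left[OF V W V' W' _ E t] linear_on_sum_fun[OF V'])

lemma tmap_sum_right:
  assumes V: "is_vsp V" and W: "is_vsp W" and V': "is_vsp V'" and W': "is_vsp W'"
    and F: "linear_on V V' F" and E: "\<And>i. i \<in> I \<Longrightarrow> linear_on W W' (E i)"
    and t: "t \<in> carrier (tensor_space V W)"
  shows "tmap V' W' F (\<lambda>w. \<Sum>i\<in>I. E i w) t = (\<Sum>i\<in>I. tmap V' W' F (E i) t)"
  using E
  by (induction I rule: infinite_finite_induct)
    (simp_all add: tmap_zero_right[OF V W V' W' F linear_on_zero[OF W'] t]
      tmap_add_right[OF V W V' W' F _ t] linear_on_sum_fun[OF W'])

text \<open>Evaluates the two pure powers of \<open>y \<otimes> g\<close> and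
  \<open>1 \<otimes> y\<close> that survive in the Gaussian binomial theorem.\<close>

lemma tmap_funpow:
  assumes V: "is_vsp V" and W: "is_vsp W" and F: "linear_on V V F" and E: "linear_on W W E"
    and t: "t \<in> carrier (tensor_space V W)"
  shows "(tmap V W F E ^^ i) t = tmap V W (F ^^ i) (E ^^ i) t"
proof (induction i)
  case 0
  show ?case using tmap_id[OF V W t] by (simp add: id_def[abs_def])
next
  case (Suc i)
  have "(tmap V W F E ^^ Suc i) t = tmap V W F E (tmap V W (F ^^ i) (E ^^ i) t)"
    using Suc by simp
  also have "\<dots> = tmap V W (\<lambda>v. F ((F ^^ i) v)) (\<lambda>w. E ((E ^^ i) w)) t"
    by (rule tmap_comp[OF V W V W V W linear_on_funpow[OF F] linear_on_funpow[OF E] F E t])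
  finally show ?case by (simp add: comp_def)
qed

section \<open>Actions on tensor products\<close>

text \<open>Bilinearity of the action is exactly what makes \<open>A \<otimes> A\<close> act on
  \<open>M \<otimes> N\<close>. Keeping the notion this weak lets it cover group representations,
  the regular module and every \<open>hopf_acts\<close>.\<close>

definition lin_act ::
    "('k::field, 'a::ab_group_add, 'z) alg_scheme \<Rightarrow> ('k, 'a, 'm::ab_group_add) lmod \<Rightarrow> bool" where
  "lin_act A M \<longleftrightarrow> is_vsp A \<and> is_vsp M \<and> (\<forall>a\<in>carrier A. linear_on M M (act M a)) \<and>
     (\<forall>x\<in>carrier M. linear_on A M (\<lambda>a. act M a x))"

text \<open>The orbit map of \<open>t\<close> for the action of \<open>A \<otimes> A\<close>. With
  \<open>t\<close> as a fixed parameter it is a linear map on \<open>tensor_space A A\<close>, to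
  which \<open>tensor_ext\<close> applies; the action on \<open>tensor_module\<close> is this map
  after the comultiplication.\<close>

definition tensor_act ::
    "('k::field, 'a::ab_group_add, 'm::ab_group_add) lmod \<Rightarrow> ('k, 'a, 'n::ab_group_add) lmod \<Rightarrow>
     ('m \<times> 'n \<Rightarrow> 'k) \<Rightarrow> ('a \<times> 'a \<Rightarrow> 'k) \<Rightarrow> ('m \<times> 'n \<Rightarrow> 'k)" where
  "tensor_act M N t = tensor_lift fscale (\<lambda>a b. tmap M N (act M a) (act N b) t)"

lemma tensor_module_simps [simp]:
  "carrier (tensor_module C M N) = carrier (tensor_space M N)"
  "scl (tensor_module C M N) = fscale"
  "act (tensor_module C M N) a t = tensor_act M N t (comult C a)"
  by (simp_all add: tensor_module_def tensor_act_def tmap_def)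

lemma is_vsp_tensor_module: "is_vsp M \<Longrightarrow> is_vsp N \<Longrightarrow> is_vsp (tensor_module C M N)"
  using is_vsp_tensor_space[of M N] by (simp add: is_vsp_def)

lemma linear_on_tensor_module:
  "linear_on (tensor_module C M N) U F \<longleftrightarrow> linear_on (tensor_space M N) U F"
  "linear_on U (tensor_module C M N) E \<longleftrightarrow> linear_on U (tensor_space M N) E"
  by (simp_all add: linear_on_def)

lemma
  assumes M: "lin_act A M" and N: "lin_act A N" and t: "t \<in> carrier (tensor_space M N)"
  shows linear_on_tensor_act: "linear_on (tensor_space A A) (tensor_space M N) (tensor_act M N t)"
    and tensor_act_pure: "a \<in> carrier A \<Longrightarrow> b \<in> carrier A \<Longrightarrow>
      tensor_act M N t (pure_tensor A A a b) = tmap M N (act M a) (act N b) t"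
proof -
  have A: "is_vsp A" and V: "is_vsp M" and W: "is_vsp N" using M N by (auto simp: lin_act_def)
  have lM: "linear_on M M (act M a)" and lN: "linear_on N N (act N a)" if "a \<in> carrier A" for a
    using M N that by (auto simp: lin_act_def)
  have dM: "act M (a + b) x = act M a x + act M b x" "act M (scl A r a) x = scl M r (act M a x)"
    if "x \<in> carrier M" "a \<in> carrier A" "b \<in> carrier A" for x a b r
    using M that by (auto simp: lin_act_def linear_on_def)
  have dN: "act N (a + b) x = act N a x + act N b x" "act N (scl A r a) x = scl N r (act N a x)"
    if "x \<in> carrier N" "a \<in> carrier A" "b \<in> carrier A" for x a b r
    using N that by (auto simp: lin_act_def linear_on_def)
  note cong = tmap_cong[OF V W V W _ _ _ _ t]
  have "bilinear_on A A (tensor_space M N) (\<lambda>a b. tmap M N (act M a) (act N b) t)"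
    unfolding bilinear_on_def
  proof (intro conjI ballI allI)
    fix a b assume a: "a \<in> carrier A" and b: "b \<in> carrier A"
    show "tmap M N (act M a) (act N b) t \<in> carrier (tensor_space M N)"
      by (rule tmap_in[OF V W V W lM[OF a] lN[OF b] t])
    fix r
    have "tmap M N (act M (scl A r a)) (act N b) t = tmap M N (\<lambda>x. scl M r (act M a x)) (act N b) t"
      using a b dM by (intro cong lM lN vsp_closed A) auto
    then show "tmap M N (act M (scl A r a)) (act N b) t = scl (tensor_space M N) r (tmap M N (act M a) (act N b) t)"
      by (simp add: tmap_scl_left[OF V W V W lM[OF a] lN[OF b] t])
    have "tmap M N (act M a) (act N (scl A r b)) t = tmap M N (act M a) (\<lambda>x. scl N r (act N b x)) t"
      using a b dN by (intro cong lM lN vsp_closed A) auto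
    then show "tmap M N (act M a) (act N (scl A r b)) t = scl (tensor_space M N) r (tmap M N (act M a) (act N b) t)"
      by (simp add: tmap_scl_right[OF V W V W lM[OF a] lN[OF b] t])
  next
    fix a a' b assume a: "a \<in> carrier A" "a' \<in> carrier A" and b: "b \<in> carrier A"
    have "tmap M N (act M (a + a')) (act N b) t = tmap M N (\<lambda>x. act M a x + act M a' x) (act N b) t"
      using a b dM by (intro cong lM lN vsp_closed A) auto
    then show "tmap M N (act M (a + a')) (act N b) t =
        tmap M N (act M a) (act N b) t + tmap M N (act M a') (act N b) t"
      by (simp add: tmap_add_left[OF V W V W lM[OF a(1)] lN[OF b] t lM[OF a(2)]])
  next
    fix a b b' assume a: "a \<in> carrier A" and b: "b \<in> carrier A" "b' \<in> carrier A"
    have "tmap M N (act M a) (act N (b + b')) t = tmap M N (act M a) (\<lambda>x. act N b x + act N b' x) t"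
      using a b dN by (intro cong lM lN vsp_closed A) auto
    then show "tmap M N (act M a) (act N (b + b')) t =
        tmap M N (act M a) (act N b) t + tmap M N (act M a) (act N b') t"
      by (simp add: tmap_add_right[OF V W V W lM[OF a] lN[OF b(1)] t lN[OF b(2)]])
  qed
  note univ = tensor_universal(3,4)[OF A A is_vsp_tensor_space[OF V W] this, unfolded scl_tensor_space]
  show "linear_on (tensor_space A A) (tensor_space M N) (tensor_act M N t)"
    unfolding tensor_act_def by (rule univ)
  show "tensor_act M N t (pure_tensor A A a b) = tmap M N (act M a) (act N b) t"
    if "a \<in> carrier A" "b \<in> carrier A"
    unfolding tensor_act_def using that by (rule univ)
qed

lemma finite_support_expand:
  assumes "finite S" "\<And>p. p \<notin> S \<Longrightarrow> a p = 0"
  shows "a = (\<Sum>p\<in>S. fscale (a p) (basis_vec p))"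
proof
  fix x
  have "(\<Sum>p\<in>S. fscale (a p) (basis_vec p)) x = (\<Sum>p\<in>S. if p = x then a x else 0)"
    unfolding sum_fun_apply by (rule sum.cong) (auto simp: fscale_def basis_vec_def)
  then show "a x = (\<Sum>p\<in>S. fscale (a p) (basis_vec p)) x"
    using assms by simp
qed

lemma vsp_sum_basis_vec:
  assumes "is_vsp V" "finite S" "p \<in> S"
  shows "(\<Sum>q\<in>S. scl V (basis_vec p q) (F q)) = F p"
proof -
  have "(\<Sum>q\<in>S. scl V (basis_vec p q) (F q)) = (\<Sum>q\<in>S. if q = p then F q else 0)"
    by (rule sum.cong) (auto simp: basis_vec_def vsp_scl[OF assms(1)])
  then show ?thesis using assms by simp
qed

section \<open>Representations of a finite group\<close>

text \<open>Modules over the group algebra in terms of the operators of the group elements, without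
  finite dimension. The last clause makes every element act through these operators, so equivariance
  for group elements already gives linearity over the group algebra.\<close>

definition group_rep ::
    "('g, 'b) monoid_scheme \<Rightarrow> ('k::field, 'g \<Rightarrow> 'k, 'm::ab_group_add) lmod \<Rightarrow> bool" where
  "group_rep G N \<longleftrightarrow> is_vsp N \<and>
     (\<forall>h\<in>carrier G. linear_on N N (act N (basis_vec h))) \<and>
     (\<forall>x\<in>carrier N. act N (basis_vec \<one>\<^bsub>G\<^esub>) x = x) \<and>
     (\<forall>h\<in>carrier G. \<forall>h'\<in>carrier G. \<forall>x\<in>carrier N.
        act N (basis_vec (h \<otimes>\<^bsub>G\<^esub> h')) x = act N (basis_vec h) (act N (basis_vec h') x)) \<and>
     (\<forall>a\<in>carrier (group_alg G). \<forall>x\<in>carrier N.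
        act N a x = (\<Sum>h\<in>carrier G. scl N (a h) (act N (basis_vec h) x)))"

lemma group_repD:
  assumes "group_rep G N"
  shows "is_vsp N" "h \<in> carrier G \<Longrightarrow> linear_on N N (act N (basis_vec h))"
    "x \<in> carrier N \<Longrightarrow> act N (basis_vec \<one>\<^bsub>G\<^esub>) x = x"
    "h \<in> carrier G \<Longrightarrow> h' \<in> carrier G \<Longrightarrow> x \<in> carrier N \<Longrightarrow>
        act N (basis_vec (h \<otimes>\<^bsub>G\<^esub> h')) x = act N (basis_vec h) (act N (basis_vec h') x)"
    "a \<in> carrier (group_alg G) \<Longrightarrow> x \<in> carrier N \<Longrightarrow>
        act N a x = (\<Sum>h\<in>carrier G. scl N (a h) (act N (basis_vec h) x))"
  using assms by (auto simp: group_rep_def)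

lemma group_alg_simps [simp]:
  "carrier (group_alg G) = carrier (group_alg_alg G)"
  "scl (group_alg G) = fscale" "amul (group_alg G) = amul (group_alg_alg G)"
  "aone (group_alg G) = aone (group_alg_alg G)" "scl (group_alg_alg G) = fscale"
  by (simp_all add: group_alg_def alg.defs group_alg_alg_def)

lemma basis_vec_in_group_alg [simp]: "h \<in> carrier G \<Longrightarrow> basis_vec h \<in> carrier (group_alg_alg G)"
  by (auto simp: group_alg_alg_def basis_vec_def)

lemma group_rep_lin_act:
  fixes N :: "('k::field, 'g \<Rightarrow> 'k, 'm::ab_group_add) lmod"
  assumes A: "is_vsp (group_alg_alg G :: ('k, 'g \<Rightarrow> 'k) alg)" and N: "group_rep G N"
  shows "lin_act (group_alg_alg G) N"
proof -
  note V = group_repD(1)[OF N] and lin = group_repD(2)[OF N] and act = group_repD(5)[OF N, simplified]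
  have in_N: "act N (basis_vec h) x \<in> carrier N" if "h \<in> carrier G" "x \<in> carrier N" for h x
    using linear_onD(1)[OF lin] that by blast
  have "linear_on N N (act N a)" if "a \<in> carrier (group_alg_alg G)" for a
    by (rule linear_on_cong[OF linear_on_sum_fun[OF V linear_on_scl[OF V lin]] V])
      (simp_all add: act[OF that])
  moreover have "linear_on (group_alg_alg G) N (\<lambda>a. act N a x)" if x: "x \<in> carrier N" for x
  proof (rule linear_onI)
    fix a b :: "'g \<Rightarrow> 'k"
    assume a: "a \<in> carrier (group_alg_alg G)" and b: "b \<in> carrier (group_alg_alg G)"
    show "act N a x \<in> carrier N"
      using x in_N by (auto simp: act[OF a x] intro!: vsp_sum[OF V] vsp_scale[OF V])
    show "act N (a + b) x = act N a x + act N b x"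
      by (simp add: act[OF a x] act[OF b x] act[OF vsp_add[OF A a b] x] vsp_scl[OF V] sum.distrib)
  next
    fix a :: "'g \<Rightarrow> 'k" and r assume a: "a \<in> carrier (group_alg_alg G)"
    have "fscale r a \<in> carrier (group_alg_alg G)" using vsp_scale[OF A a] by simp
    note eq = act[OF this x]
    show "act N (scl (group_alg_alg G) r a) x = scl N r (act N a x)"
      by (simp add: eq act[OF a x] vsp_scl[OF V] vsp_scl_sum[OF V]) (simp add: fscale_def vsp_scl[OF V])
  qed
  ultimately show ?thesis using A V by (simp add: lin_act_def)
qed

context group
begin

lemma is_vsp_group_alg: "finite (carrier G) \<Longrightarrow> is_vsp (group_alg_alg G :: ('k::field, 'a \<Rightarrow> 'k) alg)"
  using is_alg_group_alg_alg by (auto simp: is_alg_def)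

lemma group_alg_mult_basis:
  assumes "finite (carrier G)" "h \<in> carrier G" "h' \<in> carrier G"
  shows "amul (group_alg_alg G) (basis_vec h) (basis_vec h') = (basis_vec (h \<otimes> h') :: 'a \<Rightarrow> 'k::field)"
proof -
  have eval: "(\<Sum>y\<in>carrier G. fscale (r * basis_vec p y) (F y)) = fscale r (F p)"
    if "p \<in> carrier G" for p r and F :: "'a \<Rightarrow> 'a \<Rightarrow> 'k"
  proof -
    have "(\<Sum>y\<in>carrier G. fscale (r * basis_vec p y) (F y)) = (\<Sum>y\<in>carrier G. if y = p then fscale r (F y) else 0)"
      by (rule sum.cong) (auto simp: basis_vec_def fscale_def)
    then show ?thesis using assms that by simp
  qed
  have "amul (group_alg_alg G) (basis_vec h) (basis_vec h') =
      (\<Sum>x\<in>carrier G. fscale (1 * basis_vec h x) (basis_vec (x \<otimes> h') :: 'a \<Rightarrow> 'k))"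
    using assms by (simp add: group_alg_alg_def eval)
  also have "\<dots> = basis_vec (h \<otimes> h')"
    using assms by (simp only: eval) (simp add: fscale_def)
  finally show ?thesis .
qed

lemma left_module_group_rep:
  fixes N :: "('k::field, 'a \<Rightarrow> 'k, 'm::ab_group_add) lmod"
  assumes fin: "finite (carrier G)" and N: "left_module (group_alg G) N"
  shows "group_rep G N"
proof -
  have V: "is_vsp N" using N by (simp add: left_module_def)
  have A: "is_vsp (group_alg_alg G :: ('k, 'a \<Rightarrow> 'k) alg)" by (rule is_vsp_group_alg[OF fin])
  have "linear_on (group_alg_alg G) N (\<lambda>a. act N a x)" if "x \<in> carrier N" for x
    using N that by (auto simp: linear_on_def left_module_def)
  note sum = linear_on_sum[OF A V this fin]
  have "act N a x = (\<Sum>h\<in>carrier G. scl N (a h) (act N (basis_vec h) x))"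
    if a: "a \<in> carrier (group_alg_alg G)" and x: "x \<in> carrier N" for a x
  proof -
    have "a = (\<Sum>h\<in>carrier G. fscale (a h) (basis_vec h))"
      using a by (intro finite_support_expand fin) (auto simp: group_alg_alg_def)
    then have "act N a x = act N (\<Sum>h\<in>carrier G. fscale (a h) (basis_vec h)) x" by simp
    also have "\<dots> = (\<Sum>h\<in>carrier G. scl N (a h) (act N (basis_vec h) x))"
      using sum[OF x, of "\<lambda>h. basis_vec h" a] by simp
    finally show ?thesis .
  qed
  moreover have "act N (basis_vec (h \<otimes> h')) x = act N (basis_vec h) (act N (basis_vec h') x)"
    if "h \<in> carrier G" "h' \<in> carrier G" "x \<in> carrier N" for h h' x
    using N that by (simp add: left_module_def flip: group_alg_mult_basis[OF fin])
  moreover have "act N (basis_vec \<one>) x = x" if "x \<in> carrier N" for x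
    using N that by (simp add: left_module_def group_alg_alg_def)
  moreover have "linear_on N N (act N (basis_vec h))" if "h \<in> carrier G" for h
    using N that by (simp add: left_module_def linear_on_def)
  ultimately show ?thesis using V unfolding group_rep_def group_alg_simps by blast
qed

text \<open>Group elements are group-like: \<open>h\<close> acts by \<open>h \<otimes> h\<close>,
  and the axioms of a representation are inherited from the two factors.\<close>

lemma
  assumes fin: "finite (carrier G)" and M: "group_rep G M" and N: "group_rep G N"
  shows group_rep_tensor: "group_rep G (tensor_module (group_alg G) M N)"
    and group_tensor_act: "h \<in> carrier G \<Longrightarrow> t \<in> carrier (tensor_space M N) \<Longrightarrow>
      tensor_act M N t (comult (group_alg G) (basis_vec h)) =
      tmap M N (act M (basis_vec h)) (act N (basis_vec h)) t"
proof -
  let ?A = "group_alg_alg G" and ?T = "tensor_module (group_alg G) M N"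
  let ?\<rho> = "\<lambda>h. tmap M N (act M (basis_vec h)) (act N (basis_vec h))"
  note A = is_vsp_group_alg[OF fin]
  note V = group_repD(1)[OF M] and W = group_repD(1)[OF N]
  note T = is_vsp_tensor_space[OF V W]
  note lM = group_repD(2)[OF M] and lN = group_repD(2)[OF N]
  have laM: "lin_act ?A M" and laN: "lin_act ?A N"
    using group_rep_lin_act[OF A] M N by auto
  have comult: "comult (group_alg G) a = (\<Sum>x\<in>carrier G. fscale (a x) (pure_tensor ?A ?A (basis_vec x) (basis_vec x)))"
    for a by (simp add: group_alg_def alg.defs)
  have act: "tensor_act M N t (comult (group_alg G) a) = (\<Sum>h\<in>carrier G. fscale (a h) (?\<rho> h t))"
    if t: "t \<in> carrier (tensor_space M N)" for a t
    unfolding comult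
    using linear_on_sum[OF is_vsp_tensor_space[OF A A] T linear_on_tensor_act[OF laM laN t] fin,
        of "\<lambda>x. pure_tensor ?A ?A (basis_vec x) (basis_vec x)" a]
    by (simp add: pure_tensor_in[OF A A] tensor_act_pure[OF laM laN t])
  show *: "tensor_act M N t (comult (group_alg G) (basis_vec h)) = ?\<rho> h t"
    if "h \<in> carrier G" "t \<in> carrier (tensor_space M N)" for h t
    using that vsp_sum_basis_vec[OF T fin that(1)] by (simp add: act)
  have lin: "linear_on (tensor_space M N) (tensor_space M N) (?\<rho> h)" if "h \<in> carrier G" for h
    by (rule linear_on_tmap[OF V W V W lM[OF that] lN[OF that]])
  have one: "?\<rho> \<one> t = t" if t: "t \<in> carrier (tensor_space M N)" for t
  proof -
    have "?\<rho> \<one> t = tmap M N (\<lambda>x. x) (\<lambda>x. x) t"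
      by (rule tmap_cong[OF V W V W lM lN _ _ t]) (simp_all add: group_repD(3)[OF M] group_repD(3)[OF N])
    then show ?thesis by (simp add: tmap_id[OF V W t])
  qed
  have mult: "?\<rho> (h \<otimes> h') t = ?\<rho> h (?\<rho> h' t)"
    if h: "h \<in> carrier G" "h' \<in> carrier G" and t: "t \<in> carrier (tensor_space M N)" for h h' t
  proof -
    have "?\<rho> (h \<otimes> h') t = tmap M N (\<lambda>x. act M (basis_vec h) (act M (basis_vec h') x))
        (\<lambda>x. act N (basis_vec h) (act N (basis_vec h') x)) t"
      by (rule tmap_cong[OF V W V W lM lN _ _ t])
        (simp_all add: h group_repD(4)[OF M] group_repD(4)[OF N])
    then show ?thesis using h by (simp add: tmap_comp[OF V W V W V W lM lN lM lN t])
  qed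
  show "group_rep G ?T"
    unfolding group_rep_def linear_on_tensor_module group_alg_simps tensor_module_simps(1,2)
  proof (intro conjI ballI)
    show "is_vsp ?T" by (rule is_vsp_tensor_module[OF V W])
    show "linear_on (tensor_space M N) (tensor_space M N) (act ?T (basis_vec h))" if "h \<in> carrier G" for h
      by (rule linear_on_cong[OF lin[OF that] T]) (simp add: * that)
    show "act ?T (basis_vec \<one>) t = t" if "t \<in> carrier (tensor_space M N)" for t
      using that by (simp add: * one)
    show "act ?T (basis_vec (h \<otimes> h')) t = act ?T (basis_vec h) (act ?T (basis_vec h') t)"
      if "h \<in> carrier G" "h' \<in> carrier G" "t \<in> carrier (tensor_space M N)" for h h' t
      using that linear_onD(1)[OF lin] by (simp add: * mult)
    show "act ?T a t = (\<Sum>h\<in>carrier G. fscale (a h) (act ?T (basis_vec h) t))"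
      if "t \<in> carrier (tensor_space M N)" for a t
      unfolding tensor_module_simps act[OF that, of a] using that by (intro sum.cong) (simp_all add: *)
  qed
qed

end

section \<open>The Gaussian binomial theorem at a root of unity\<close>

text \<open>The q-binomial coefficients by the q-Pascal rule. The usual quotient of products of
  factors \<open>q\<^sup>i - 1\<close> would break down at the root of unity where they are
  needed.\<close>

fun gauss_binomial :: "'k::comm_ring_1 \<Rightarrow> nat \<Rightarrow> nat \<Rightarrow> 'k" where
  "gauss_binomial q m 0 = 1"
| "gauss_binomial q 0 (Suc k) = 0"
| "gauss_binomial q (Suc m) (Suc k) =
     gauss_binomial q m k + q ^ Suc k * gauss_binomial q m (Suc k)"

lemma gauss_binomial_ends: "gauss_binomial q m m = 1" "m < k \<Longrightarrow> gauss_binomial q m k = 0"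
proof -
  show gt: "gauss_binomial q m k = 0" if "m < k" for m k
    using that by (induction q m k rule: gauss_binomial.induct) auto
  show "gauss_binomial q m m = 1" by (induction m) (simp_all add: gt)
qed

text \<open>The q-analogue of (k+1) C(m,k+1) = (m-k) C(m,k), with \<open>q\<^sup>i - 1\<close> in
  place of the integer i so that no division occurs.\<close>

lemma gauss_binomial_absorb:
  "k \<le> m \<Longrightarrow> gauss_binomial q m (Suc k) * (q ^ Suc k - 1) = gauss_binomial q m k * (q ^ (m - k) - 1)"
proof (induction m arbitrary: k)
  case (Suc m)
  show ?case
  proof (cases k)
    case 0
    have "gauss_binomial q m 1 * (q - 1) = q ^ m - 1" using Suc.IH[of 0] by simp
    then show ?thesis by (simp add: 0 algebra_simps)
  next
    case (Suc j)
    have j: "j \<le> m" using Suc.prems Suc by simp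
    let ?G = "gauss_binomial q m"
    have IH1: "?G (Suc j) * (q ^ Suc j - 1) = ?G j * (q ^ (m - j) - 1)"
      by (rule Suc.IH[OF j])
    \<comment> \<open>Both sides of the claim are reduced to the common value
      \<open>?G k * (q ^ Suc m - 1)\<close>, the analogue of (m+1) C(m,k); this is the left side,
      and the right side follows below.\<close>
    have L: "gauss_binomial q (Suc m) (Suc k) * (q ^ Suc k - 1) = ?G k * (q ^ Suc m - 1)"
    proof (cases "k \<le> m")
      case True
      have pw: "q ^ Suc k * q ^ (m - k) = q ^ Suc m"
        using True by (simp del: power_Suc flip: power_add)
      have "gauss_binomial q (Suc m) (Suc k) * (q ^ Suc k - 1) =
          ?G k * (q ^ Suc k - 1) + q ^ Suc k * (?G (Suc k) * (q ^ Suc k - 1))"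
        by (simp only: gauss_binomial.simps ring_distribs mult_ac mult_1_right mult_1_left)
      also have "\<dots> = ?G k * (q ^ Suc k - 1) + q ^ Suc k * (?G k * (q ^ (m - k) - 1))"
        using Suc.IH[OF True] by (simp only:)
      also have "\<dots> = ?G k * (q ^ Suc k - 1 + (q ^ Suc k * q ^ (m - k) - q ^ Suc k))"
        by (simp only: ring_distribs mult_ac mult_1_right mult_1_left)
      finally show ?thesis by (simp only: pw) simp
    next
      case False
      then have "?G k = 0" "?G (Suc k) = 0" by (simp_all add: gauss_binomial_ends)
      then show ?thesis by simp
    qed
    have pw: "q ^ Suc j * q ^ (m - j) = q ^ Suc m"
      using j by (simp del: power_Suc flip: power_add)
    have "gauss_binomial q (Suc m) k * (q ^ (Suc m - k) - 1) =
        ?G j * (q ^ (m - j) - 1) + q ^ Suc j * (?G (Suc j) * (q ^ (m - j) - 1))"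
      by (simp only: Suc gauss_binomial.simps ring_distribs mult_ac diff_Suc_Suc mult_1_right mult_1_left)
    also have "\<dots> = ?G (Suc j) * (q ^ Suc j - 1) + q ^ Suc j * (?G (Suc j) * (q ^ (m - j) - 1))"
      by (simp only: IH1)
    also have "\<dots> = ?G (Suc j) * (q ^ Suc j - 1 + (q ^ Suc j * q ^ (m - j) - q ^ Suc j))"
      by (simp only: ring_distribs mult_ac mult_1_right mult_1_left)
    also have "\<dots> = ?G k * (q ^ Suc m - 1)" by (simp only: pw Suc) simp
    finally show ?thesis using L by simp
  qed
qed simp

text \<open>In the absorption identity the factor on the right is zero at k = 0 because
  \<open>q ^ n = 1\<close>. Below n the factor on the left is nonzero, so the vanishing propagates
  from each coefficient to the next.\<close>

lemma gauss_binomial_root_of_unity: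
  fixes q :: "'k::field"
  assumes q: "q ^ n = 1" "\<And>m. 0 < m \<Longrightarrow> m < n \<Longrightarrow> q ^ m \<noteq> 1" and k: "0 < k" "k < n"
  shows "gauss_binomial q n k = 0"
  using k
proof (induction k)
  case (Suc k)
  have "gauss_binomial q n (Suc k) * (q ^ Suc k - 1) = gauss_binomial q n k * (q ^ (n - k) - 1)"
    using Suc.prems by (intro gauss_binomial_absorb) simp
  also have "\<dots> = 0"
  proof (cases "k = 0")
    case True then show ?thesis using q(1) by simp
  next
    case False then show ?thesis using Suc by simp
  qed
  finally show ?case using q(2)[OF Suc.prems] by simp
qed simp

text \<open>All powers of \<open>A\<close> are collected on the left. Moving a new \<open>B\<close>
  past \<open>A ^^ k\<close> costs \<open>q ^ k\<close>, which is the power of q in the Pascal rule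
  of \<open>gauss_binomial\<close>.\<close>

lemma q_commuting_power:
  fixes q :: "'k::field"
  assumes V: "is_vsp V" and A: "linear_on V V A" and B: "linear_on V V B"
    and comm: "\<And>x. x \<in> carrier V \<Longrightarrow> B (A x) = scl V q (A (B x))"
    and x: "x \<in> carrier V"
  shows "((\<lambda>x. A x + B x) ^^ m) x =
    (\<Sum>k\<le>m. scl V (gauss_binomial q m k) ((A ^^ k) ((B ^^ (m - k)) x)))"
proof (induction m)
  case 0 then show ?case by (simp add: vsp_scl[OF V])
next
  case (Suc m)
  let ?G = "gauss_binomial q"
  let ?X = "\<lambda>k l. (A ^^ k) ((B ^^ l) x)"
  have in_V: "?X k l \<in> carrier V" for k l
    using x linear_onD(1)[OF linear_on_funpow[OF A]] linear_onD(1)[OF linear_on_funpow[OF B]] by blast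
  have BA: "B ((A ^^ k) y) = scl V (q ^ k) ((A ^^ k) (B y))" if y: "y \<in> carrier V" for k y
  proof (induction k)
    case (Suc k)
    have "(A ^^ k) y \<in> carrier V" using y linear_onD(1)[OF linear_on_funpow[OF A]] by blast
    then have "B ((A ^^ Suc k) y) = scl V q (A (scl V (q ^ k) ((A ^^ k) (B y))))"
      using Suc by (simp add: comm)
    also have "A (scl V (q ^ k) ((A ^^ k) (B y))) = scl V (q ^ k) (A ((A ^^ k) (B y)))"
      by (intro linear_onD(3)[OF A] linear_onD(1)[OF linear_on_funpow[OF A]] linear_onD(1)[OF B] y)
    finally show ?case by (simp add: vsp_scl[OF V])
  qed (simp add: vsp_scl[OF V])
  have AB: "linear_on V V (\<lambda>x. A x + B x)" by (rule linear_on_add[OF V A B])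
  have "((\<lambda>x. A x + B x) ^^ Suc m) x = (\<Sum>k\<le>m. scl V (?G m k) (A (?X k (m - k)) + B (?X k (m - k))))"
    using linear_on_setsum[OF V V AB, of "{..m}" "\<lambda>k. scl V (?G m k) (?X k (m - k))"] Suc in_V
      linear_onD(3)[OF AB in_V] vsp_scale[OF V] by simp
  also have "\<dots> = (\<Sum>k\<le>m. scl V (?G m k) (?X (Suc k) (m - k)) + scl V (q ^ k * ?G m k) (?X k (Suc m - k)))"
  proof (rule sum.cong[OF refl])
    fix k assume "k \<in> {..m}"
    then have "Suc m - k = Suc (m - k)" by auto
    moreover have "(B ^^ (m - k)) x \<in> carrier V"
      using x linear_onD(1)[OF linear_on_funpow[OF B]] by blast
    ultimately show "scl V (?G m k) (A (?X k (m - k)) + B (?X k (m - k))) =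
        scl V (?G m k) (?X (Suc k) (m - k)) + scl V (q ^ k * ?G m k) (?X k (Suc m - k))"
      by (simp add: BA vsp_scl[OF V] mult.commute)
  qed
  \<comment> \<open>The second sum may be extended to \<open>Suc m\<close>, since
    \<open>gauss_binomial q m (Suc m) = 0\<close>. Splitting off its term at 0 then aligns the
    indices of the two sums.\<close>
  also have "\<dots> = (\<Sum>k\<le>m. scl V (?G m k) (?X (Suc k) (m - k))) +
      (\<Sum>k\<le>Suc m. scl V (q ^ k * ?G m k) (?X k (Suc m - k)))"
    by (simp add: sum.distrib gauss_binomial_ends vsp_scl[OF V])
  also have "\<dots> = ?X 0 (Suc m) + (\<Sum>k\<le>m. scl V (?G m k) (?X (Suc k) (m - k)) +
      scl V (q ^ Suc k * ?G m (Suc k)) (?X (Suc k) (m - k)))"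
    unfolding sum.atMost_Suc_shift[of _ m] by (simp add: sum.distrib vsp_scl[OF V])
  also have "\<dots> = (\<Sum>k\<le>Suc m. scl V (?G (Suc m) k) (?X k (Suc m - k)))"
    unfolding sum.atMost_Suc_shift[of _ m] by (simp add: vsp_scl[OF V])
  finally show ?case .
qed

lemma q_commuting_power_root_of_unity:
  fixes q :: "'k::field"
  assumes V: "is_vsp V" and A: "linear_on V V A" and B: "linear_on V V B"
    and comm: "\<And>x. x \<in> carrier V \<Longrightarrow> B (A x) = scl V q (A (B x))"
    and x: "x \<in> carrier V"
    and q: "q ^ n = 1" "\<And>m. 0 < m \<Longrightarrow> m < n \<Longrightarrow> q ^ m \<noteq> 1" and n: "0 < n"
  shows "((\<lambda>x. A x + B x) ^^ n) x = (A ^^ n) x + (B ^^ n) x"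
proof -
  let ?X = "\<lambda>k. (A ^^ k) ((B ^^ (n - k)) x)"
  have "((\<lambda>x. A x + B x) ^^ n) x = (\<Sum>k\<le>n. scl V (gauss_binomial q n k) (?X k))"
    by (rule q_commuting_power[OF V A B comm x])
  also have "\<dots> = (\<Sum>k\<in>{0, n}. scl V (gauss_binomial q n k) (?X k))"
    using gauss_binomial_root_of_unity[OF q]
    by (intro sum.mono_neutral_right) (auto simp: vsp_scl[OF V])
  also have "\<dots> = (A ^^ n) x + (B ^^ n) x"
    using n by (simp add: gauss_binomial_ends vsp_scl[OF V])
  finally show ?thesis .
qed

section \<open>Modules over the Hopf algebra\<close>

lemma
  fixes A :: "('k::field, 'a::ab_group_add) alg"
  assumes alg: "is_alg A" and u: "u \<in> carrier (tensor_space A A)"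
  shows linear_on_tensor_mul: "linear_on (tensor_space A A) (tensor_space A A) (\<lambda>t. tensor_mul A t u)"
    and tensor_mul_pure: "a \<in> carrier A \<Longrightarrow> b \<in> carrier A \<Longrightarrow>
      tensor_mul A (pure_tensor A A a b) u = tmap A A (amul A a) (amul A b) u"
proof -
  \<comment> \<open>The product of \<open>A \<otimes> A\<close> is its action on the tensor square of the regular module.\<close>
  define R :: "('k, 'a, 'a) lmod" where "R = \<lparr>carrier = carrier A, scl = scl A, act = amul A\<rparr>"
  have R [simp]: "carrier R = carrier A" "scl R = scl A" "act R = amul A"
    by (simp_all add: R_def)
  have b: "some_basis R = some_basis A" by (simp add: some_basis_def)
  have "lin_act A R"
    using alg by (auto simp: lin_act_def is_alg_def linear_on_def is_vsp_def)
  moreover have p: "pure_tensor R R = pure_tensor A A"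
    by (simp add: pure_tensor_def b fun_eq_iff)
  moreover have t: "tensor_space R R = tensor_space A A"
    by (simp add: tensor_space_def b)
  moreover have m: "tmap R R F E = tmap A A F E" for F E :: "'a \<Rightarrow> 'a"
    by (simp add: tmap_def p)
  moreover have "tensor_act R R u = (\<lambda>t. tensor_mul A t u)"
    by (simp add: tensor_act_def tensor_mul_def m fun_eq_iff) (simp add: tmap_def)
  ultimately show "linear_on (tensor_space A A) (tensor_space A A) (\<lambda>t. tensor_mul A t u)"
    "a \<in> carrier A \<Longrightarrow> b \<in> carrier A \<Longrightarrow>
      tensor_mul A (pure_tensor A A a b) u = tmap A A (amul A a) (amul A b) u"
    using linear_on_tensor_act[of A R R u] tensor_act_pure[of A R R u a b] u by simp_all
qed

lemma hopf_alg_simps [simp]: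
  "carrier (hopf_alg G \<chi> g n) = carrier (hopf_alg_alg G \<chi> g n)"
  "scl (hopf_alg G \<chi> g n) = fscale" "scl (hopf_alg_alg G \<chi> g n) = fscale"
  "comult (hopf_alg G \<chi> g n) a = (\<Sum>p\<in>{..<n} \<times> carrier G. fscale (a p)
     ((tensor_mul (hopf_alg_alg G \<chi> g n)
        (pure_tensor (hopf_alg_alg G \<chi> g n) (hopf_alg_alg G \<chi> g n) (hopf_y G) (hopf_grp g) +
         pure_tensor (hopf_alg_alg G \<chi> g n) (hopf_alg_alg G \<chi> g n) (aone (hopf_alg_alg G \<chi> g n)) (hopf_y G))
       ^^ fst p) (pure_tensor (hopf_alg_alg G \<chi> g n) (hopf_alg_alg G \<chi> g n) (hopf_grp (snd p)) (hopf_grp (snd p)))))"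
  by (simp_all add: hopf_alg_def alg.defs hopf_alg_alg_def Let_def case_prod_beta)

context group_datum
begin

text \<open>\<open>hopf_acts\<close> says that \<open>y\<^sup>i h\<close> acts as \<open>Y\<^sup>i \<circ> \<rho> h\<close> and imposes no relations, which is enough
  to recognise isomorphisms; \<open>hopf_rep\<close> adds the defining relations.\<close>

definition hopf_acts ::
    "('k, nat \<times> 'g \<Rightarrow> 'k, 'm::ab_group_add) lmod \<Rightarrow> ('m \<Rightarrow> 'm) \<Rightarrow> ('g \<Rightarrow> 'm \<Rightarrow> 'm) \<Rightarrow> bool" where
  "hopf_acts N Y \<rho> \<longleftrightarrow> is_vsp N \<and> linear_on N N Y \<and> (\<forall>h\<in>carrier G. linear_on N N (\<rho> h)) \<and>
     (\<forall>a\<in>carrier H. \<forall>x\<in>carrier N.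
        act N a x = (\<Sum>p\<in>{..<n} \<times> carrier G. scl N (a p) ((Y ^^ fst p) (\<rho> (snd p) x))))"

definition hopf_rep ::
    "('k, nat \<times> 'g \<Rightarrow> 'k, 'm::ab_group_add) lmod \<Rightarrow> ('m \<Rightarrow> 'm) \<Rightarrow> ('g \<Rightarrow> 'm \<Rightarrow> 'm) \<Rightarrow> bool" where
  "hopf_rep N Y \<rho> \<longleftrightarrow> hopf_acts N Y \<rho> \<and>
     (\<forall>x\<in>carrier N. \<rho> \<one> x = x \<and> (Y ^^ n) x = \<rho> (g [^] n) x - x \<and>
       (\<forall>h\<in>carrier G. Y (\<rho> h x) = scl N (\<chi> h) (\<rho> h (Y x)) \<and>
         (\<forall>h'\<in>carrier G. \<rho> (h \<otimes> h') x = \<rho> h (\<rho> h' x))))"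

lemma hopf_actsD:
  assumes "hopf_acts N Y \<rho>"
  shows "is_vsp N" "linear_on N N Y" "h \<in> carrier G \<Longrightarrow> linear_on N N (\<rho> h)"
    "a \<in> carrier H \<Longrightarrow> x \<in> carrier N \<Longrightarrow>
      act N a x = (\<Sum>p\<in>{..<n} \<times> carrier G. scl N (a p) ((Y ^^ fst p) (\<rho> (snd p) x)))"
  using assms by (auto simp: hopf_acts_def)

lemma hopf_repD:
  assumes "hopf_rep N Y \<rho>"
  shows "hopf_acts N Y \<rho>" "x \<in> carrier N \<Longrightarrow> \<rho> \<one> x = x"
    "x \<in> carrier N \<Longrightarrow> (Y ^^ n) x = \<rho> (g [^] n) x - x"
    "h \<in> carrier G \<Longrightarrow> x \<in> carrier N \<Longrightarrow> Y (\<rho> h x) = scl N (\<chi> h) (\<rho> h (Y x))"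
    "h \<in> carrier G \<Longrightarrow> h' \<in> carrier G \<Longrightarrow> x \<in> carrier N \<Longrightarrow> \<rho> (h \<otimes> h') x = \<rho> h (\<rho> h' x)"
  using assms by (auto simp: hopf_rep_def)

lemma is_vsp_H: "is_vsp H"
  using is_alg_hopf_alg_alg by (simp add: is_alg_def)

lemma basis_vec_in_H: "i < n \<Longrightarrow> h \<in> carrier G \<Longrightarrow> basis_vec (i, h) \<in> carrier H"
  by (auto simp: hopf_alg_alg_def basis_vec_def)

lemma hopf_gens_in_H: "hopf_y G \<in> carrier H" "h \<in> carrier G \<Longrightarrow> hopf_grp h \<in> carrier H" "aone H \<in> carrier H"
  using n_ge_2 by (auto simp: hopf_y_def hopf_grp_def hopf_alg_alg_def basis_vec_def)

lemma H_ext: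
  assumes U: "is_vsp U" and F: "linear_on H U F" "linear_on H U F'"
    and eq: "\<And>i h. i < n \<Longrightarrow> h \<in> carrier G \<Longrightarrow> F (basis_vec (i, h)) = F' (basis_vec (i, h))"
    and a: "a \<in> carrier H"
  shows "F a = F' a"
proof -
  let ?S = "{..<n} \<times> carrier G"
  have fin: "finite ?S" using finite_G by simp
  have in_H: "basis_vec p \<in> carrier H" if "p \<in> ?S" for p
    using that basis_vec_in_H by auto
  have "a = (\<Sum>p\<in>?S. fscale (a p) (basis_vec p))"
    using a by (intro finite_support_expand fin) (auto simp: hopf_alg_alg_def)
  then have "F a = F (\<Sum>p\<in>?S. fscale (a p) (basis_vec p))"
    "F' a = F' (\<Sum>p\<in>?S. fscale (a p) (basis_vec p))" by simp_all
  then have "F a = (\<Sum>p\<in>?S. scl U (a p) (F (basis_vec p)))"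
    "F' a = (\<Sum>p\<in>?S. scl U (a p) (F' (basis_vec p)))"
    using linear_on_sum[OF is_vsp_H U F(1) fin, of basis_vec a] in_H
      linear_on_sum[OF is_vsp_H U F(2) fin, of basis_vec a]
    by simp_all
  moreover have "F (basis_vec p) = F' (basis_vec p)" if "p \<in> ?S" for p
    using that eq by (cases p) auto
  ultimately show ?thesis by simp
qed

lemma hopf_acts_lin_act:
  assumes N: "hopf_acts N Y \<rho>"
  shows "lin_act H N"
proof -
  note V = hopf_actsD(1)[OF N]
  have lin: "linear_on N N (\<lambda>x. (Y ^^ i) (\<rho> h x))" if "h \<in> carrier G" for i h
    by (rule linear_on_comp[OF hopf_actsD(3)[OF N that] linear_on_funpow[OF hopf_actsD(2)[OF N]]])
  have "linear_on N N (act N a)" if "a \<in> carrier H" for a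
    by (rule linear_on_cong[OF linear_on_sum_fun[OF V linear_on_scl[OF V lin]] V])
      (auto simp: hopf_actsD(4)[OF N that])
  moreover have "linear_on H N (\<lambda>a. act N a x)" if x: "x \<in> carrier N" for x
  proof (rule linear_onI)
    fix a b :: "nat \<times> 'g \<Rightarrow> 'k" assume a: "a \<in> carrier H" and b: "b \<in> carrier H"
    show "act N a x \<in> carrier N"
      using x linear_onD(1)[OF lin] unfolding hopf_actsD(4)[OF N a x]
      by (auto intro!: vsp_sum[OF V] vsp_scale[OF V])
    show "act N (a + b) x = act N a x + act N b x"
      by (simp add: hopf_actsD(4)[OF N _ x] a b vsp_add[OF is_vsp_H a b] vsp_scl[OF V] sum.distrib)
  next
    fix a :: "nat \<times> 'g \<Rightarrow> 'k" and r assume a: "a \<in> carrier H"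
    have "fscale r a \<in> carrier H" using vsp_scale[OF is_vsp_H a] by simp
    then show "act N (scl H r a) x = scl N r (act N a x)"
      by (simp add: hopf_actsD(4)[OF N _ x] a vsp_scl[OF V] vsp_scl_sum[OF V])
        (simp add: fscale_def)
  qed
  ultimately show ?thesis using is_vsp_H V by (simp add: lin_act_def)
qed

lemma hopf_acts_basis:
  assumes N: "hopf_acts N Y \<rho>" and "i < n" "h \<in> carrier G" "x \<in> carrier N"
  shows "act N (basis_vec (i, h)) x = (Y ^^ i) (\<rho> h x)"
  using vsp_sum_basis_vec[OF hopf_actsD(1)[OF N], of "{..<n} \<times> carrier G" "(i, h)"] assms finite_G
  by (simp add: hopf_actsD(4)[OF N] basis_vec_in_H)

text \<open>Iterating the relation \<open>y h = \<chi>(h) h y\<close> pulls \<open>h\<close> through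
  \<open>y\<^sup>i\<close>. The scalar is the one by which the group action on
  \<open>x\<^sup>i V\<close> is twisted, so \<open>x\<^sup>i v \<mapsto> y\<^sup>i \<psi>(v)\<close>
  respects the group.\<close>

lemma hopf_rep_grp_funpow:
  assumes N: "hopf_rep N Y \<rho>" and h: "h \<in> carrier G" and x: "x \<in> carrier N"
  shows "\<rho> h ((Y ^^ i) x) = scl N (inverse (\<chi> h) ^ i) ((Y ^^ i) (\<rho> h x))"
proof (induction i)
  case 0 then show ?case by (simp add: vsp_scl[OF hopf_actsD(1)[OF hopf_repD(1)[OF N]]])
next
  case (Suc i)
  note acts = hopf_actsD[OF hopf_repD(1)[OF N]]
  have Yi: "(Y ^^ i) z \<in> carrier N" if "z \<in> carrier N" for z
    using that linear_onD(1)[OF linear_on_funpow[OF acts(2)]] by blast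
  have "Y (\<rho> h ((Y ^^ i) x)) = scl N (\<chi> h) (\<rho> h ((Y ^^ Suc i) x))"
    using hopf_repD(4)[OF N h Yi[OF x]] by simp
  then have "scl N (inverse (\<chi> h)) (Y (\<rho> h ((Y ^^ i) x))) = \<rho> h ((Y ^^ Suc i) x)"
    using char_nonzero[OF h] by (simp add: vsp_scl[OF acts(1)])
  moreover have "Y (\<rho> h ((Y ^^ i) x)) = scl N (inverse (\<chi> h) ^ i) (Y ((Y ^^ i) (\<rho> h x)))"
    unfolding Suc using linear_onD(3)[OF acts(2)] Yi linear_onD(1)[OF acts(3)[OF h] x] by blast
  ultimately show ?case by (simp add: vsp_scl[OF acts(1)])
qed

lemma amul_linear: "a \<in> carrier H \<Longrightarrow> linear_on H H (amul H a)"
  using is_alg_hopf_alg_alg by (auto simp: is_alg_def linear_on_def)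

text \<open>Multiplicativity of the action for a generator on the left. This is the form needed for
  tensor products, because the comultiplication is built by repeated left multiplication by
  \<open>\<Delta>(y)\<close>, whose components are \<open>y\<close>, \<open>g\<close> and 1.\<close>

lemma
  assumes N: "hopf_rep N Y \<rho>" and b: "b \<in> carrier H" and x: "x \<in> carrier N"
  shows hopf_rep_y: "act N (amul H (hopf_y G) b) x = Y (act N b x)"
    and hopf_rep_grp: "h \<in> carrier G \<Longrightarrow> act N (amul H (hopf_grp h) b) x = \<rho> h (act N b x)"
proof -
  note acts = hopf_actsD[OF hopf_repD(1)[OF N]] and basis = hopf_acts_basis[OF hopf_repD(1)[OF N]]
  note V = acts(1)
  have lact: "linear_on H N (\<lambda>a. act N a z)" if "z \<in> carrier N" for z
    using hopf_acts_lin_act[OF hopf_repD(1)[OF N]] that by (simp add: lin_act_def)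
  have gn: "g [^] n \<in> carrier G" using g_in_G by simp
  show "act N (amul H (hopf_y G) b) x = Y (act N b x)"
  proof (rule H_ext[OF V _ _ _ b])
    show "linear_on H N (\<lambda>b. act N (amul H (hopf_y G) b) x)"
      by (rule linear_on_comp[OF amul_linear[OF hopf_gens_in_H(1)] lact[OF x]])
    show "linear_on H N (\<lambda>b. Y (act N b x))"
      by (rule linear_on_comp[OF lact[OF x] acts(2)])
    fix i h assume i: "i < n" and h: "h \<in> carrier G"
    have "amul H (hopf_y G) (basis_vec (i, h)) = ymono (Suc i) h"
      using i h n_ge_2 by (simp add: hopf_y_def hopf_mul_basis char_one fscale_def)
    moreover have "act N (ymono (Suc i) h) x = Y ((Y ^^ i) (\<rho> h x))"
    proof (cases "Suc i < n")
      case True then show ?thesis using h x by (simp add: hopf_monom_def basis)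
    next
      case False
      \<comment> \<open>The monomial wraps around: \<open>y y\<^sup>i h\<close> reduces to
        \<open>g\<^sup>n h - h\<close>, and the relation for the n-th power of \<open>Y\<close>,
        applied to \<open>\<rho> h x\<close>, gives the same.\<close>
      with i have n: "n = Suc i" by simp
      have "act N (basis_vec (0, g [^] n \<otimes> h) - basis_vec (0, h)) x = \<rho> (g [^] n \<otimes> h) x - \<rho> h x"
        using gn h x i linear_on_diff[OF is_vsp_H V lact[OF x], of "basis_vec (0, g [^] n \<otimes> h)" "basis_vec (0, h)"]
        by (simp add: basis basis_vec_in_H)
      also have "\<dots> = (Y ^^ n) (\<rho> h x)"
        using hopf_repD(5)[OF N gn h x] hopf_repD(3)[OF N linear_onD(1)[OF acts(3)[OF h] x]] by simp
      finally show ?thesis using False by (simp add: hopf_monom_def n)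
    qed
    ultimately show "act N (amul H (hopf_y G) (basis_vec (i, h))) x = Y (act N (basis_vec (i, h)) x)"
      using i h x by (simp add: basis)
  qed
  show "act N (amul H (hopf_grp k) b) x = \<rho> k (act N b x)" if k: "k \<in> carrier G" for k
  proof (rule H_ext[OF V _ _ _ b])
    show "linear_on H N (\<lambda>b. act N (amul H (hopf_grp k) b) x)"
      by (rule linear_on_comp[OF amul_linear[OF hopf_gens_in_H(2)[OF k]] lact[OF x]])
    show "linear_on H N (\<lambda>b. \<rho> k (act N b x))"
      by (rule linear_on_comp[OF lact[OF x] acts(3)[OF k]])
    fix i h assume i: "i < n" and h: "h \<in> carrier G"
    have kh: "k \<otimes> h \<in> carrier G" using k h by simp
    have "amul H (hopf_grp k) (basis_vec (i, h)) = fscale (inverse (\<chi> k) ^ i) (basis_vec (i, k \<otimes> h))"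
      using i h k by (simp add: hopf_grp_def hopf_mul_basis hopf_monom_def)
    then have "act N (amul H (hopf_grp k) (basis_vec (i, h))) x =
        scl N (inverse (\<chi> k) ^ i) ((Y ^^ i) (\<rho> (k \<otimes> h) x))"
      using linear_onD(3)[OF lact[OF x] basis_vec_in_H[OF i kh]] basis[OF i kh x] by simp
    also have "\<dots> = \<rho> k ((Y ^^ i) (\<rho> h x))"
      using hopf_rep_grp_funpow[OF N k linear_onD(1)[OF acts(3)[OF h] x]] hopf_repD(5)[OF N k h x] by simp
    finally show "act N (amul H (hopf_grp k) (basis_vec (i, h))) x = \<rho> k (act N (basis_vec (i, h)) x)"
      using i h x by (simp add: basis)
  qed
qed

abbreviation (input) "tensor_y M N Y Y' \<rho>' \<equiv> \<lambda>t. tmap M N Y (\<rho>' g) t + tmap M N (\<lambda>x. x) Y' t"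

text \<open>\<open>comult\<close> sends a monomial to powers of left multiplication by
  \<open>\<Delta>(y)\<close> applied to \<open>h \<otimes> h\<close>. So the action is known once
  this multiplication is seen to become \<open>tensor_y\<close> under \<open>tensor_act\<close>; the
  defining relations are then identities between operators.\<close>

lemma hopf_rep_tensor:
  assumes M: "hopf_rep M Y \<rho>" and N: "hopf_rep N Y' \<rho>'"
  shows "hopf_rep (tensor_module (hopf_alg G \<chi> g n) M N) (tensor_y M N Y Y' \<rho>') (\<lambda>h. tmap M N (\<rho> h) (\<rho>' h))"
proof -
  let ?T = "tensor_space M N" and ?HH = "tensor_space H H"
  let ?Y = "tensor_y M N Y Y' \<rho>'" and ?\<rho> = "\<lambda>h. tmap M N (\<rho> h) (\<rho>' h)"
  let ?\<Delta>y = "pure_tensor H H (hopf_y G) (hopf_grp g) + pure_tensor H H (aone H) (hopf_y G)"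
  note aM = hopf_actsD[OF hopf_repD(1)[OF M]] and aN = hopf_actsD[OF hopf_repD(1)[OF N]]
  note V = aM(1) and W = aN(1)
  note T = is_vsp_tensor_space[OF V W] and HH = is_vsp_tensor_space[OF is_vsp_H is_vsp_H]
  note laM = hopf_acts_lin_act[OF hopf_repD(1)[OF M]] and laN = hopf_acts_lin_act[OF hopf_repD(1)[OF N]]
  have actM: "linear_on M M (act M a)" and actN: "linear_on N N (act N a)" if "a \<in> carrier H" for a
    using laM laN that by (auto simp: lin_act_def)
  note in_H = hopf_gens_in_H(1) hopf_gens_in_H(2)[OF g_in_G] hopf_gens_in_H(3)
  note lt = linear_on_tmap[OF V W V W] and pt = tmap_pure[OF V W V W]
  have linA: "linear_on ?T ?T (tmap M N Y (\<rho>' g))" by (rule lt[OF aM(2) aN(3)[OF g_in_G]])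
  have linB: "linear_on ?T ?T (tmap M N (\<lambda>x. x) Y')" by (rule lt[OF linear_on_id aN(2)])
  have linY: "linear_on ?T ?T ?Y" by (rule linear_on_add[OF T linA linB])
  have lin\<rho>: "linear_on ?T ?T (?\<rho> h)" if "h \<in> carrier G" for h
    by (rule lt[OF aM(3)[OF that] aN(3)[OF that]])
  have unit: "amul H (aone H) b = b" if "b \<in> carrier H" for b
    using is_alg_hopf_alg_alg that by (simp add: is_alg_def)
  have amul_in: "amul H a b \<in> carrier H" if "a \<in> carrier H" "b \<in> carrier H" for a b
    using is_alg_hopf_alg_alg that by (simp add: is_alg_def)
  have \<Delta>y: "tensor_mul H ?\<Delta>y u = tmap H H (amul H (hopf_y G)) (amul H (hopf_grp g)) u +
      tmap H H (amul H (aone H)) (amul H (hopf_y G)) u" if u: "u \<in> carrier ?HH" for u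
    using linear_onD(2)[OF linear_on_tensor_mul[OF is_alg_hopf_alg_alg u]
        pure_tensor_in[OF is_vsp_H is_vsp_H in_H(1,2)] pure_tensor_in[OF is_vsp_H is_vsp_H in_H(3,1)]]
    by (simp add: tensor_mul_pure[OF is_alg_hopf_alg_alg u] in_H)
  have lin\<Delta>y: "linear_on ?HH ?HH (tensor_mul H ?\<Delta>y)"
    by (rule linear_on_cong[OF linear_on_add[OF HH linear_on_tmap linear_on_tmap] HH \<Delta>y[symmetric]])
      (intro is_vsp_H amul_linear in_H)+
  \<comment> \<open>Both sides are linear in \<open>u\<close>. On a pure tensor of \<open>b\<close>
    and \<open>b'\<close> the product is \<open>y b \<otimes> g b' + b \<otimes> y b'\<close>, and
    the generators move out of each factor separately.\<close>
  have act_\<Delta>y: "tensor_act M N t (tensor_mul H ?\<Delta>y u) = ?Y (tensor_act M N t u)"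
    if t: "t \<in> carrier ?T" and u: "u \<in> carrier ?HH" for t u
  proof (rule tensor_ext[OF is_vsp_H is_vsp_H T _ _ _ u])
    note lta = linear_on_tensor_act[OF laM laN t]
    show "linear_on ?HH ?T (\<lambda>u. tensor_act M N t (tensor_mul H ?\<Delta>y u))"
      by (rule linear_on_comp[OF lin\<Delta>y lta])
    show "linear_on ?HH ?T (\<lambda>u. ?Y (tensor_act M N t u))"
      by (rule linear_on_comp[OF lta linY])
    fix b b' assume b: "b \<in> carrier H" and b': "b' \<in> carrier H"
    note tp = tensor_act_pure[OF laM laN t]
    have "tensor_act M N t (tensor_mul H ?\<Delta>y (pure_tensor H H b b')) =
        tensor_act M N t (pure_tensor H H (amul H (hopf_y G) b) (amul H (hopf_grp g) b') +
          pure_tensor H H b (amul H (hopf_y G) b'))"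
      by (subst \<Delta>y[OF pure_tensor_in[OF is_vsp_H is_vsp_H b b']])
        (simp add: tmap_pure[OF is_vsp_H is_vsp_H is_vsp_H is_vsp_H amul_linear amul_linear] in_H b b' unit)
    moreover have "\<dots> = tmap M N (act M (amul H (hopf_y G) b)) (act N (amul H (hopf_grp g) b')) t +
        tmap M N (act M b) (act N (amul H (hopf_y G) b')) t"
      using linear_onD(2)[OF lta pure_tensor_in[OF is_vsp_H is_vsp_H amul_in[OF in_H(1) b] amul_in[OF in_H(2) b']]
          pure_tensor_in[OF is_vsp_H is_vsp_H b amul_in[OF in_H(1) b']]]
      by (simp add: tp amul_in in_H b b')
    moreover have "tmap M N (act M (amul H (hopf_y G) b)) (act N (amul H (hopf_grp g) b')) t =
        tmap M N (\<lambda>x. Y (act M b x)) (\<lambda>x. \<rho>' g (act N b' x)) t"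
      using b b' in_H by (intro tmap_cong[OF V W V W _ _ _ _ t] actM actN amul_in hopf_rep_y[OF M] hopf_rep_grp[OF N] g_in_G)
    moreover have "\<dots> = tmap M N Y (\<rho>' g) (tmap M N (act M b) (act N b') t)"
      by (rule tmap_comp[OF V W V W V W actM[OF b] actN[OF b'] aM(2) aN(3)[OF g_in_G] t, symmetric])
    moreover have "tmap M N (act M b) (act N (amul H (hopf_y G) b')) t =
        tmap M N (\<lambda>x. act M b x) (\<lambda>x. Y' (act N b' x)) t"
      using b b' in_H by (intro tmap_cong[OF V W V W _ _ _ _ t] actM actN amul_in hopf_rep_y[OF N] refl)
    moreover have "\<dots> = tmap M N (\<lambda>x. x) Y' (tmap M N (act M b) (act N b') t)"
      by (rule tmap_comp[OF V W V W V W actM[OF b] actN[OF b'] linear_on_id aN(2) t, symmetric])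
    ultimately show "tensor_act M N t (tensor_mul H ?\<Delta>y (pure_tensor H H b b')) =
        ?Y (tensor_act M N t (pure_tensor H H b b'))"
      by (simp only: tp[OF b b'])
  qed
  have pow: "tensor_act M N t ((tensor_mul H ?\<Delta>y ^^ i) u) = (?Y ^^ i) (tensor_act M N t u)"
    if t: "t \<in> carrier ?T" and u: "u \<in> carrier ?HH" for t u i
  proof (induction i)
    case (Suc i)
    have "(tensor_mul H ?\<Delta>y ^^ i) u \<in> carrier ?HH"
      using linear_onD(1)[OF linear_on_funpow[OF lin\<Delta>y] u] .
    from act_\<Delta>y[OF t this] show ?case by (simp only: funpow.simps comp_apply Suc)
  qed simp
  have grp: "tensor_act M N t (pure_tensor H H (hopf_grp h) (hopf_grp h)) = ?\<rho> h t"
    if t: "t \<in> carrier ?T" and h: "h \<in> carrier G" for t h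
  proof -
    have "0 < n" using n_ge_2 by simp
    then have "act M (hopf_grp h) x = \<rho> h x" if "x \<in> carrier M" for x
      using hopf_acts_basis[OF hopf_repD(1)[OF M] _ h that, of 0] by (simp add: hopf_grp_def)
    moreover have "act N (hopf_grp h) x = \<rho>' h x" if "x \<in> carrier N" for x
      using hopf_acts_basis[OF hopf_repD(1)[OF N] _ h that, of 0] \<open>0 < n\<close> by (simp add: hopf_grp_def)
    ultimately show ?thesis
      unfolding tensor_act_pure[OF laM laN t hopf_gens_in_H(2)[OF h] hopf_gens_in_H(2)[OF h]]
      by (intro tmap_cong[OF V W V W _ _ _ _ t] actM actN hopf_gens_in_H h)
  qed
  have pgrp: "pure_tensor H H (hopf_grp h) (hopf_grp h) \<in> carrier ?HH" if "h \<in> carrier G" for h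
    by (intro pure_tensor_in is_vsp_H hopf_gens_in_H that)
  have act: "tensor_act M N t (comult (hopf_alg G \<chi> g n) a) =
      (\<Sum>p\<in>{..<n} \<times> carrier G. fscale (a p) ((?Y ^^ fst p) (?\<rho> (snd p) t)))"
    if t: "t \<in> carrier ?T" for a t
  proof -
    have "tensor_act M N t (comult (hopf_alg G \<chi> g n) a) = (\<Sum>p\<in>{..<n} \<times> carrier G. fscale (a p)
        (tensor_act M N t ((tensor_mul H ?\<Delta>y ^^ fst p) (pure_tensor H H (hopf_grp (snd p)) (hopf_grp (snd p))))))"
      unfolding hopf_alg_simps
      using linear_on_sum[OF HH T linear_on_tensor_act[OF laM laN t], of "{..<n} \<times> carrier G"
          "\<lambda>p. (tensor_mul H ?\<Delta>y ^^ fst p) (pure_tensor H H (hopf_grp (snd p)) (hopf_grp (snd p)))" a]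
        finite_G linear_onD(1)[OF linear_on_funpow[OF lin\<Delta>y] pgrp]
      by auto
    also have "\<dots> = (\<Sum>p\<in>{..<n} \<times> carrier G. fscale (a p) ((?Y ^^ fst p) (?\<rho> (snd p) t)))"
      by (rule sum.cong) (auto simp: pow[OF t pgrp] grp[OF t])
    finally show ?thesis .
  qed
  have acts: "hopf_acts (tensor_module (hopf_alg G \<chi> g n) M N) ?Y ?\<rho>"
    unfolding hopf_acts_def linear_on_tensor_module
    using is_vsp_tensor_module[OF V W] linY lin\<rho> act by (auto simp del: hopf_alg_simps)
  have one: "?\<rho> \<one> t = t" if t: "t \<in> carrier ?T" for t
  proof -
    have "?\<rho> \<one> t = tmap M N (\<lambda>x. x) (\<lambda>x. x) t"
      by (rule tmap_cong[OF V W V W aM(3) aN(3) _ _ t]) (simp_all add: hopf_repD(2)[OF M] hopf_repD(2)[OF N])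
    then show ?thesis by (simp add: tmap_id[OF V W t])
  qed
  have mult: "?\<rho> (h \<otimes> h') t = ?\<rho> h (?\<rho> h' t)"
    if h: "h \<in> carrier G" "h' \<in> carrier G" and t: "t \<in> carrier ?T" for h h' t
  proof -
    have "?\<rho> (h \<otimes> h') t = tmap M N (\<lambda>x. \<rho> h (\<rho> h' x)) (\<lambda>x. \<rho>' h (\<rho>' h' x)) t"
      by (rule tmap_cong[OF V W V W aM(3) aN(3) _ _ t])
        (simp_all add: h hopf_repD(5)[OF M] hopf_repD(5)[OF N])
    then show ?thesis using h by (simp add: tmap_comp[OF V W V W V W aM(3) aN(3) aM(3) aN(3) t])
  qed
  have comm: "?Y (?\<rho> h t) = fscale (\<chi> h) (?\<rho> h (?Y t))"
    if h: "h \<in> carrier G" and t: "t \<in> carrier ?T" for h t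
  proof (rule tensor_ext[OF V W T linear_on_comp[OF lin\<rho>[OF h] linY]
        linear_on_scl[OF T linear_on_comp[OF linY lin\<rho>[OF h]], unfolded scl_tensor_space] _ t])
    fix v w assume v: "v \<in> carrier M" and w: "w \<in> carrier N"
    note [simp] = pt[OF aM(3)[OF h] aN(3)[OF h]] pt[OF aM(2) aN(3)[OF g_in_G]] pt[OF linear_on_id aN(2)]
      linear_onD(1)[OF aM(3)] linear_onD(1)[OF aN(3)] linear_onD(1)[OF aM(2)] linear_onD(1)[OF aN(2)]
    note in_T = pure_tensor_in[OF V W]
    \<comment> \<open>Centrality of \<open>g\<close> enters here: it lets the summand
      \<open>y \<otimes> g\<close> pass \<open>h \<otimes> h\<close> at the cost of \<chi>(h)
      alone.\<close>
    have gh: "\<rho>' g (\<rho>' h w) = \<rho>' h (\<rho>' g w)"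
      using hopf_repD(5)[OF N g_in_G h w] hopf_repD(5)[OF N h g_in_G w] g_central[OF h] by simp
    have add: "?\<rho> h (a + b) = ?\<rho> h a + ?\<rho> h b" if "a \<in> carrier ?T" "b \<in> carrier ?T" for a b
      by (rule linear_onD(2)[OF lin\<rho>[OF h] that])
    show "?Y (?\<rho> h (pure_tensor M N v w)) = fscale (\<chi> h) (?\<rho> h (?Y (pure_tensor M N v w)))"
      using v w h g_in_G
      by (simp add: hopf_repD(4)[OF M h v] hopf_repD(4)[OF N h w] gh in_T pure_tensor_bilinear[OF V W] add)
        (simp add: fscale_def fun_eq_iff distrib_left)
  qed
  have power: "(?Y ^^ n) t = ?\<rho> (g [^] n) t - t" if t: "t \<in> carrier ?T" for t
  proof -
    note fM = linear_on_funpow[OF aM(2)] and fN = linear_on_funpow[OF aN(2)] and f\<rho> = linear_on_funpow[OF aN(3)[OF g_in_G]]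
    have gn: "g [^] n \<in> carrier G" using g_in_G by simp
    \<comment> \<open>The summands \<open>A = y \<otimes> g\<close> and
      \<open>B = 1 \<otimes> y\<close> satisfy \<open>B A = q A B\<close>. The scalar comes from the
      second factor, where \<open>y g = \<chi>(g) g y\<close>.\<close>
    have q: "tmap M N (\<lambda>x. x) Y' (tmap M N Y (\<rho>' g) x) = scl ?T (\<chi> g) (tmap M N Y (\<rho>' g) (tmap M N (\<lambda>x. x) Y' x))"
      if x: "x \<in> carrier ?T" for x
    proof -
      have "tmap M N (\<lambda>x. x) Y' (tmap M N Y (\<rho>' g) x) = tmap M N Y (\<lambda>w. Y' (\<rho>' g w)) x"
        by (simp add: tmap_comp[OF V W V W V W aM(2) aN(3)[OF g_in_G] linear_on_id aN(2) x])
      also have "\<dots> = tmap M N Y (\<lambda>w. scl N (\<chi> g) (\<rho>' g (Y' w))) x"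
        by (rule tmap_cong[OF V W V W aM(2) linear_on_comp[OF aN(3)[OF g_in_G] aN(2)] _ _ x])
          (simp_all add: hopf_repD(4)[OF N g_in_G])
      also have "\<dots> = fscale (\<chi> g) (tmap M N Y (\<lambda>w. \<rho>' g (Y' w)) x)"
        by (rule tmap_scl_right[OF V W V W aM(2) linear_on_comp[OF aN(2) aN(3)[OF g_in_G]] x])
      also have "tmap M N Y (\<lambda>w. \<rho>' g (Y' w)) x = tmap M N Y (\<rho>' g) (tmap M N (\<lambda>x. x) Y' x)"
        by (simp add: tmap_comp[OF V W V W V W linear_on_id aN(2) aM(2) aN(3)[OF g_in_G] x])
      finally show ?thesis by simp
    qed
    have \<rho>'n: "(\<rho>' g ^^ i) w = \<rho>' (g [^] i) w" if "w \<in> carrier N" for w i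
    proof (induction i)
      case (Suc i)
      then show ?case
        using hopf_repD(5)[OF N g_in_G, of "g [^] i" w] g_in_G that g_pow_central[OF g_in_G, of i] by simp
    qed (use that hopf_repD(2)[OF N] in simp)
    have "(?Y ^^ n) t = (tmap M N Y (\<rho>' g) ^^ n) t + (tmap M N (\<lambda>x. x) Y' ^^ n) t"
      using n_ge_2 by (intro q_commuting_power_root_of_unity[OF T linA linB q t q_pow_n q_order]) auto
    also have "\<dots> = tmap M N (Y ^^ n) (\<rho>' g ^^ n) t + tmap M N ((\<lambda>x. x) ^^ n) (Y' ^^ n) t"
      by (simp add: tmap_funpow[OF V W aM(2) aN(3)[OF g_in_G] t] tmap_funpow[OF V W linear_on_id aN(2) t])
    \<comment> \<open>The sum telescopes: \<open>(g\<^sup>n - 1) \<otimes> g\<^sup>n + 1 \<otimes>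
      (g\<^sup>n - 1) = g\<^sup>n \<otimes> g\<^sup>n - 1 \<otimes> 1\<close>.\<close>
    also have "\<dots> = ?\<rho> (g [^] n) t - t"
    proof (rule tensor_ext[OF V W T _ _ _ t])
      show "linear_on ?T ?T (\<lambda>t. tmap M N (Y ^^ n) (\<rho>' g ^^ n) t + tmap M N ((\<lambda>x. x) ^^ n) (Y' ^^ n) t)"
        by (intro linear_on_add[OF T] lt fM fN f\<rho> linear_on_funpow linear_on_id)
      show "linear_on ?T ?T (\<lambda>t. ?\<rho> (g [^] n) t - t)"
        by (rule linear_on_sub[OF T lin\<rho>[OF gn] linear_on_id])
      fix v w assume v: "v \<in> carrier M" and w: "w \<in> carrier N"
      have idn: "((\<lambda>x. x) ^^ n) v = v" by (induction n) auto
      have sub_l: "pure_tensor M N (a - v) b = pure_tensor M N a b - pure_tensor M N v b"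
        if "a \<in> carrier M" "b \<in> carrier N" for a b
        using pure_tensor_add_left[OF V W vsp_diff[OF V that(1) v] v that(2)] by (simp add: eq_diff_eq)
      have sub_r: "pure_tensor M N v (b - w) = pure_tensor M N v b - pure_tensor M N v w"
        if "b \<in> carrier N" for b
        using pure_tensor_add_right[OF V W v vsp_diff[OF W that w] w] by (simp add: eq_diff_eq)
      have "\<rho> (g [^] n) v \<in> carrier M" "\<rho>' (g [^] n) w \<in> carrier N"
        using linear_onD(1)[OF aM(3)[OF gn] v] linear_onD(1)[OF aN(3)[OF gn] w] .
      then show "tmap M N (Y ^^ n) (\<rho>' g ^^ n) (pure_tensor M N v w) +
          tmap M N ((\<lambda>x. x) ^^ n) (Y' ^^ n) (pure_tensor M N v w) =
          ?\<rho> (g [^] n) (pure_tensor M N v w) - pure_tensor M N v w"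
        using v w by (simp add: pt[OF fM f\<rho>] pt[OF linear_on_funpow[OF linear_on_id] fN] pt[OF aM(3)[OF gn] aN(3)[OF gn]]
            idn hopf_repD(3)[OF M] hopf_repD(3)[OF N] \<rho>'n sub_l sub_r)
    qed
    finally show ?thesis .
  qed
  show ?thesis
    unfolding hopf_rep_def tensor_module_simps(1,2)
    using acts one power comm mult by blast
qed

end

section \<open>Direct sums and isomorphisms of modules\<close>

lemma pointwise_vector_space:
  assumes "\<And>s. vector_space (sc s)"
  shows "vector_space (\<lambda>r f s. sc s r (f s))"
proof -
  note ax = vector_space.vector_space_assms[OF assms]
  show ?thesis
    by unfold_locales (simp_all add: fun_eq_iff ax)
qed

text \<open>The scalar multiplication of the sum uses \<open>scl (M s)\<close> at every index, also
  from \<open>m\<close> on. Assuming all \<open>M s\<close> to be spaces makes it a vector space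
  structure on the whole function type.\<close>

lemma is_vsp_direct_sum:
  assumes "\<And>s. is_vsp (M s)"
  shows "is_vsp (direct_sum m M)"
proof (rule is_vspI)
  show "vector_space (scl (direct_sum m M))"
    unfolding direct_sum_def using pointwise_vector_space[of "\<lambda>s. scl (M s)"] assms
    by (simp add: is_vsp_def)
qed (auto simp: direct_sum_def vsp_closed[OF assms] vsp_scl[OF assms])

lemma direct_sum_simps:
  "f \<in> carrier (direct_sum m M) \<longleftrightarrow> (\<forall>s<m. f s \<in> carrier (M s)) \<and> (\<forall>s\<ge>m. f s = 0)"
  "scl (direct_sum m M) r f = (\<lambda>s. scl (M s) r (f s))"
  "act (direct_sum m M) a f = (\<lambda>s. if s < m then act (M s) a (f s) else 0)"
  by (simp_all add: direct_sum_def)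

text \<open>The inverse is taken relative to the carrier, so it recovers \<open>act M a x\<close>
  from its image only when this element lies in the carrier; hence the closure assumption.\<close>

lemma module_iso_sym:
  assumes M: "is_vsp M" and act: "\<And>a x. a \<in> carrier A \<Longrightarrow> x \<in> carrier M \<Longrightarrow> act M a x \<in> carrier M"
    and iso: "module_iso A M N"
  shows "module_iso A N M"
proof -
  obtain f where bij: "bij_betw f (carrier M) (carrier N)"
    and f: "\<And>x y. x \<in> carrier M \<Longrightarrow> y \<in> carrier M \<Longrightarrow> f (x + y) = f x + f y"
      "\<And>r x. x \<in> carrier M \<Longrightarrow> f (scl M r x) = scl N r (f x)"
      "\<And>a x. a \<in> carrier A \<Longrightarrow> x \<in> carrier M \<Longrightarrow> f (act M a x) = act N a (f x)"
    using iso unfolding module_iso_def by blast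
  let ?e = "inv_into (carrier M) f"
  have e: "?e x \<in> carrier M" "f (?e x) = x" if "x \<in> carrier N" for x
    using that bij by (auto simp: bij_betw_def inv_into_into f_inv_into_f)
  have inj: "inj_on f (carrier M)" using bij by (simp add: bij_betw_def)
  note eq = inv_into_f_eq[OF inj]
  show ?thesis
    unfolding module_iso_def
    by (rule exI[of _ ?e]) (auto intro!: bij_betw_inv_into[OF bij] eq simp: e f act vsp_closed[OF M])
qed

lemma module_iso_trans:
  assumes "module_iso A M N" "module_iso A N L"
  shows "module_iso A M L"
proof -
  obtain f where bij: "bij_betw f (carrier M) (carrier N)"
    and f: "\<And>x y. x \<in> carrier M \<Longrightarrow> y \<in> carrier M \<Longrightarrow> f (x + y) = f x + f y"
      "\<And>r x. x \<in> carrier M \<Longrightarrow> f (scl M r x) = scl N r (f x)"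
      "\<And>a x. a \<in> carrier A \<Longrightarrow> x \<in> carrier M \<Longrightarrow> f (act M a x) = act N a (f x)"
    using assms(1) unfolding module_iso_def by blast
  obtain e where bij': "bij_betw e (carrier N) (carrier L)"
    and e: "\<And>x y. x \<in> carrier N \<Longrightarrow> y \<in> carrier N \<Longrightarrow> e (x + y) = e x + e y"
      "\<And>r x. x \<in> carrier N \<Longrightarrow> e (scl N r x) = scl L r (e x)"
      "\<And>a x. a \<in> carrier A \<Longrightarrow> x \<in> carrier N \<Longrightarrow> e (act N a x) = act L a (e x)"
    using assms(2) unfolding module_iso_def by blast
  have in_N: "f x \<in> carrier N" if "x \<in> carrier M" for x
    using bij that by (auto simp: bij_betw_def)
  show ?thesis
    unfolding module_iso_def
    by (rule exI[of _ "e \<circ> f"]) (auto intro: bij_betw_trans[OF bij bij'] simp: f e in_N)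
qed

context group_datum
begin

lemma hopf_acts_iso:
  assumes N: "hopf_acts N Y \<rho>" and N': "hopf_acts N' Y' \<rho>'"
    and f: "linear_on N N' f" and bij: "bij_betw f (carrier N) (carrier N')"
    and fY: "\<And>x. x \<in> carrier N \<Longrightarrow> f (Y x) = Y' (f x)"
    and f\<rho>: "\<And>h x. h \<in> carrier G \<Longrightarrow> x \<in> carrier N \<Longrightarrow> f (\<rho> h x) = \<rho>' h (f x)"
  shows "module_iso (hopf_alg G \<chi> g n) N N'"
proof -
  note a = hopf_actsD[OF N] and a' = hopf_actsD[OF N']
  have pow: "f ((Y ^^ i) x) = (Y' ^^ i) (f x)" if "x \<in> carrier N" for i x
  proof (induction i)
    case (Suc i)
    have "(Y ^^ i) x \<in> carrier N" using linear_onD(1)[OF linear_on_funpow[OF a(2)] that] .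
    then show ?case using Suc fY by simp
  qed simp
  have "f (act N b x) = act N' b (f x)" if b: "b \<in> carrier H" and x: "x \<in> carrier N" for b x
  proof -
    have fin: "finite ({..<n} \<times> carrier G)" using finite_G by simp
    have in_N: "(Y ^^ i) (\<rho> h x) \<in> carrier N" if "h \<in> carrier G" for i h
      using linear_onD(1)[OF linear_on_funpow[OF a(2)] linear_onD(1)[OF a(3)[OF that] x]] .
    have "f (act N b x) = (\<Sum>p\<in>{..<n} \<times> carrier G. scl N' (b p) (f ((Y ^^ fst p) (\<rho> (snd p) x))))"
      unfolding a(4)[OF b x]
      using linear_on_sum[OF a(1) a'(1) f fin, of "\<lambda>p. (Y ^^ fst p) (\<rho> (snd p) x)" b] in_N by auto
    also have "\<dots> = act N' b (f x)"
      unfolding a'(4)[OF b linear_onD(1)[OF f x]]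
      using x linear_onD(1)[OF a(3)] by (intro sum.cong) (auto simp: pow f\<rho>)
    finally show ?thesis .
  qed
  then show ?thesis
    unfolding module_iso_def using bij linear_onD(2,3)[OF f] by auto
qed

lemma hopf_acts_closed:
  "hopf_acts N Y \<rho> \<Longrightarrow> a \<in> carrier (hopf_alg G \<chi> g n) \<Longrightarrow> x \<in> carrier N \<Longrightarrow> act N a x \<in> carrier N"
  using hopf_acts_lin_act[of N Y \<rho>] by (auto simp: lin_act_def linear_on_def)

lemma hopf_acts_direct_sum:
  assumes vsp: "\<And>s. is_vsp (M s)" and M: "\<And>s. s < m \<Longrightarrow> hopf_acts (M s) (Y s) (\<rho> s)"
  shows "hopf_acts (direct_sum m M) (\<lambda>f s. if s < m then Y s (f s) else 0)
    (\<lambda>h f s. if s < m then \<rho> s h (f s) else 0)"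
proof -
  let ?Y = "\<lambda>f s. if s < m then Y s (f s) else 0"
  let ?\<rho> = "\<lambda>h f s. if s < m then \<rho> s h (f s) else 0"
  have lin: "linear_on (direct_sum m M) (direct_sum m M) (\<lambda>f s. if s < m then F s (f s) else 0)"
    if "\<And>s. s < m \<Longrightarrow> linear_on (M s) (M s) (F s)" for F
    by (intro linear_onI) (simp_all add: direct_sum_simps fun_eq_iff vsp_scl(8)[OF vsp] linear_onD[OF that])
  \<comment> \<open>The condition on \<open>f\<close> serves \<open>i = 0\<close>, where the right
    side is \<open>f\<close> cut off at \<open>m\<close>.\<close>
  have pow: "(?Y ^^ i) f = (\<lambda>s. if s < m then (Y s ^^ i) (f s) else 0)" if "\<And>s. s \<ge> m \<Longrightarrow> f s = 0" for i f
  proof (induction i)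
    case 0 show ?case using that by (intro ext) simp
  next
    case (Suc i)
    show ?case unfolding funpow.simps comp_apply Suc by (intro ext) simp
  qed
  have "act (direct_sum m M) a x = (\<Sum>p\<in>{..<n} \<times> carrier G.
      scl (direct_sum m M) (a p) ((?Y ^^ fst p) (?\<rho> (snd p) x)))"
    if "a \<in> carrier H" "x \<in> carrier (direct_sum m M)" for a x
  proof
    fix s
    have pow': "(?Y ^^ i) (?\<rho> h x) = (\<lambda>s. if s < m then (Y s ^^ i) (\<rho> s h (x s)) else 0)" for i h
      by (subst pow) (auto simp: fun_eq_iff)
    show "act (direct_sum m M) a x s = (\<Sum>p\<in>{..<n} \<times> carrier G.
        scl (direct_sum m M) (a p) ((?Y ^^ fst p) (?\<rho> (snd p) x))) s"
    proof (cases "s < m")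
      case True
      then have "x s \<in> carrier (M s)" using that by (simp add: direct_sum_simps)
      from hopf_actsD(4)[OF M[OF True] that(1) this] show ?thesis
        unfolding sum_fun_apply direct_sum_simps pow' by (simp add: True)
    next
      case False
      then show ?thesis
        unfolding sum_fun_apply direct_sum_simps pow' by (simp add: vsp_scl(8)[OF vsp])
    qed
  qed
  then show ?thesis
    unfolding hopf_acts_def
    by (intro conjI ballI is_vsp_direct_sum[OF vsp] lin hopf_actsD(2,3)[OF M])
qed

section \<open>The modules built from the powers of x\<close>

lemma x_module_simps:
  "f \<in> carrier (x_module G \<chi> n V k c) \<longleftrightarrow> (\<forall>s<k. f s \<in> carrier V) \<and> (\<forall>s\<ge>k. f s = 0)"
  "scl (x_module G \<chi> n V k c) r f = (\<lambda>s. scl V r (f s))"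
  by (simp_all add: x_module_def)

lemma is_vsp_x_module:
  assumes V: "is_vsp V"
  shows "is_vsp (x_module G \<chi> n V k c)"
proof (rule is_vspI)
  show "vector_space (scl (x_module G \<chi> n V k c))"
    unfolding x_module_def using pointwise_vector_space[of "\<lambda>s. scl V"] V
    by (simp add: is_vsp_def)
qed (auto simp: x_module_simps vsp_closed[OF V] vsp_scl[OF V])

text \<open>Within \<open>i \<le> k\<close> steps exactly the last \<open>i\<close> entries have
  wrapped around, each of them once, which is why \<open>c\<close> occurs to the first power. At
  \<open>i = k\<close> the operator is multiplication by \<open>c\<close>.\<close>

lemma x_shift_funpow:
  assumes V: "is_vsp V" and f: "f \<in> carrier (x_module G \<chi> n V k c)" and i: "i \<le> k" and k: "0 < k"
  shows "(x_shift V k c ^^ i) f s = (if s < i then scl V c (f (k - i + s)) else if s < k then f (s - i) else 0)"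
  using i
proof (induction i arbitrary: s)
  case 0 then show ?case using f by (simp add: x_module_simps)
next
  case (Suc i)
  have IH: "(x_shift V k c ^^ i) f s =
      (if s < i then scl V c (f (k - i + s)) else if s < k then f (s - i) else 0)" for s
    using Suc by simp
  have "(x_shift V k c ^^ Suc i) f s = (if s = 0 then scl V c ((x_shift V k c ^^ i) f (k - 1))
      else if s < k then (x_shift V k c ^^ i) f (s - 1) else 0)"
    by (simp add: x_shift_def)
  also have "\<dots> = (if s < Suc i then scl V c (f (k - Suc i + s)) else if s < k then f (s - Suc i) else 0)"
  proof (cases "s = 0")
    case True
    moreover have "\<not> k - 1 < i" "k - 1 - i = k - Suc i" "k - 1 < k" using Suc.prems k by auto
    ultimately show ?thesis unfolding IH[of "k - 1"] by simp
  next
    case False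
    then have eq: "k - i + (s - 1) = k - Suc i + s" "s - 1 < i \<longleftrightarrow> s < Suc i" "s - 1 - i = s - Suc i"
      using Suc.prems by auto
    have "s < k" if "s < Suc i" using that Suc.prems by simp
    then show ?thesis
      using False Suc.prems unfolding IH[of "s - 1"] eq by auto
  qed
  finally show ?case .
qed

lemma hopf_acts_x_module:
  assumes V: "group_rep G V" and k: "0 < k"
  shows "hopf_acts (x_module G \<chi> n V k c) (x_shift V k c) (x_grp \<chi> V)"
proof -
  note S = group_repD(1)[OF V]
  have "linear_on (x_module G \<chi> n V k c) (x_module G \<chi> n V k c) (x_shift V k c)"
    using k by (intro linear_onI)
      (auto simp: x_module_simps x_shift_def fun_eq_iff vsp_closed[OF S] vsp_scl[OF S] mult.commute)
  moreover have "linear_on (x_module G \<chi> n V k c) (x_module G \<chi> n V k c) (x_grp \<chi> V h)" if h: "h \<in> carrier G" for h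
  proof -
    note l = linear_onD[OF group_repD(2)[OF V h]] and z = linear_on_0[OF S S group_repD(2)[OF V h]]
    have nz: "f s \<in> carrier V" if "f \<in> carrier (x_module G \<chi> n V k c)" for f s
      using that vsp_zero[OF S] by (cases "s < k") (auto simp: x_module_simps)
    show ?thesis
      by (intro linear_onI)
        (auto simp: fun_eq_iff x_grp_def l nz x_module_simps(2) vsp_scl[OF S] mult.commute,
          auto simp: x_module_simps l z vsp_scale[OF S] vsp_scl[OF S])
  qed
  moreover have "act (x_module G \<chi> n V k c) a f = (\<Sum>p\<in>{..<n} \<times> carrier G.
      scl (x_module G \<chi> n V k c) (a p) ((x_shift V k c ^^ fst p) (x_grp \<chi> V (snd p) f)))" for a f
    by (simp add: x_module_def case_prod_beta)
  ultimately show ?thesis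
    unfolding hopf_acts_def using is_vsp_x_module[OF S] by blast
qed

text \<open>The condition on \<open>c\<close> joins the two families. For \<open>P\<close> we have k
  = n and \<open>y\<^sup>n\<close> is the scalar l - 1; for \<open>M\<close> already
  \<open>y\<^sup>k\<close> is 0, and l = 1 makes \<open>g\<^sup>n - 1\<close> vanish as
  well.\<close>

lemma hopf_rep_x_module:
  assumes V: "group_rep G V"
    and gn: "\<And>v. v \<in> carrier V \<Longrightarrow> act V (basis_vec (g [^] n)) v = scl V l v"
    and k: "0 < k" "k \<le> n" and c: "k = n \<and> c = l - 1 \<or> c = 0 \<and> l = 1"
  shows "hopf_rep (x_module G \<chi> n V k c) (x_shift V k c) (x_grp \<chi> V)"
proof -
  let ?M = "x_module G \<chi> n V k c" and ?Y = "x_shift V k c"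
  note S = group_repD(1)[OF V]
  note acts = hopf_acts_x_module[OF V k(1), of c]
  note a = hopf_actsD[OF acts]
  have nz: "f s \<in> carrier V" if "f \<in> carrier ?M" for f s
    using that vsp_zero[OF S] by (cases "s < k") (auto simp: x_module_simps)
  have pow: "(?Y ^^ n) f = x_grp \<chi> V (g [^] n) f - f" if f: "f \<in> carrier ?M" for f
  proof
    fix s
    \<comment> \<open>The twist by powers of \<chi> is invisible at \<open>g\<^sup>n\<close>, since
      \<chi>(g^n) = q^n = 1. So \<open>g\<^sup>n\<close> acts in every degree by the same scalar
      \<open>l\<close>.\<close>
    have R: "(x_grp \<chi> V (g [^] n) f - f) s = scl V (l - 1) (f s)"
      using nz[OF f] by (simp add: x_grp_def gn char_g_pow q_pow_n vsp_scl[OF S])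
    show "(?Y ^^ n) f s = (x_grp \<chi> V (g [^] n) f - f) s"
    proof (cases "k = n \<and> c = l - 1")
      case True
      then show ?thesis unfolding R using x_shift_funpow[OF S f order.refl k(1), of s] f
        by (auto simp: x_module_simps vsp_scl[OF S])
    next
      case False
      then have c0: "c = 0" "l = 1" using c by auto
      have "(?Y ^^ k) f = 0"
        using x_shift_funpow[OF S f order.refl k(1)] by (auto simp: fun_eq_iff c0 vsp_scl[OF S])
      moreover have "(?Y ^^ i) 0 = 0" for i
        using linear_on_0[OF a(1) a(1) linear_on_funpow[OF a(2)]] .
      moreover have "(?Y ^^ n) f = (?Y ^^ (n - k)) ((?Y ^^ k) f)"
        using k(2) by (simp only: le_add_diff_inverse2 flip: funpow_add comp_apply[of "?Y ^^ (n - k)" "?Y ^^ k"])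
      ultimately show ?thesis unfolding R by (simp add: c0 vsp_scl[OF S])
    qed
  qed
  moreover have "?Y (x_grp \<chi> V h f) = scl ?M (\<chi> h) (x_grp \<chi> V h (?Y f))"
    if h: "h \<in> carrier G" and f: "f \<in> carrier ?M" for h f
  proof
    fix s
    note l = linear_onD[OF group_repD(2)[OF V h]] and z = linear_on_0[OF S S group_repD(2)[OF V h]]
    \<comment> \<open>Degree k - 1 is twisted by \<chi>(h)^(1-k), but after wrapping to degree 0
      only the factor \<chi>(h) of the relation remains. For k = n they agree by \<chi>^n = 1,
      otherwise c = 0.\<close>
    have wrap: "c * inverse (\<chi> h) ^ (k - Suc 0) = \<chi> h * c"
    proof (cases "c = 0")
      case False
      then have "k = n" using c by auto
      then have "inverse (\<chi> h) ^ (k - Suc 0) = \<chi> h"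
        using char_pow_n[OF h] char_nonzero[OF h] n_ge_2 power_minus_mult[of n "\<chi> h"]
        by (simp add: power_inverse inverse_eq_divide divide_simps mult.commute)
      then show ?thesis by simp
    qed simp
    have *: "inverse (\<chi> h) ^ (s - Suc 0) = \<chi> h * inverse (\<chi> h) ^ s" if "s > 0"
      using that char_nonzero[OF h] by (cases s) auto
    show "?Y (x_grp \<chi> V h f) s = scl ?M (\<chi> h) (x_grp \<chi> V h (?Y f)) s"
      using nz[OF f] by (simp add: x_module_simps x_shift_def x_grp_def l z vsp_scl[OF S] wrap *)
  qed
  moreover have "x_grp \<chi> V (h \<otimes> h') f = x_grp \<chi> V h (x_grp \<chi> V h' f)"
    if h: "h \<in> carrier G" "h' \<in> carrier G" and f: "f \<in> carrier ?M" for h h' f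
    using h
    by (simp add: x_grp_def fun_eq_iff nz[OF f] group_repD(4)[OF V h] linear_onD[OF group_repD(2)[OF V h(1)]]
        linear_onD[OF group_repD(2)[OF V h(2)]] char_mult power_mult_distrib vsp_scl[OF S] mult.commute)
  moreover have "x_grp \<chi> V \<one> f = f" if "f \<in> carrier ?M" for f
    by (simp add: x_grp_def fun_eq_iff nz[OF that] group_repD(3)[OF V] char_one vsp_scl[OF S])
  ultimately show ?thesis
    unfolding hopf_rep_def using acts by blast
qed

section \<open>A triangularity criterion\<close>

text \<open>
  Here \<open>t\<close> is the degree in \<open>x\<close> of the factor \<open>M(k,i)\<close> and \<open>s\<close> that of \<open>P\<^sub>j\<close>; \<open>\<pi> t s\<close> are the coordinates
  on the tensor product and \<open>\<iota> t\<close> is the inclusion of the summand with indices \<open>(t, 0)\<close>. Modulo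
  rows of larger index, \<open>y\<close> maps the entry \<open>(t, s - 1)\<close> to \<open>(t, s)\<close> by the automorphism \<open>L t\<close>. Hence
  \<open>(e\<^sub>t\<^sub>,\<^sub>s) \<mapsto> \<Sum> y\<^sup>s (\<iota> t e\<^sub>t\<^sub>,\<^sub>s)\<close> is block triangular in \<open>t\<close> with diagonal blocks \<open>(L t)\<^sup>s\<close>, so it is bijective.
\<close>

lemma triangular_iso:
  fixes N :: "('k, nat \<times> 'g \<Rightarrow> 'k, 'a::ab_group_add) lmod" and E :: "('k, 'e::ab_group_add, 'z) vsp_scheme"
    and W :: "nat \<Rightarrow> nat \<Rightarrow> ('k, 'g \<Rightarrow> 'k, 'v::ab_group_add) lmod"
    and \<pi> :: "nat \<Rightarrow> nat \<Rightarrow> 'a \<Rightarrow> 'e"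
  assumes N: "hopf_rep N Y \<rho>" and E: "is_vsp E"
    and W: "\<And>t r. group_rep G (W t r)"
    and Wl: "\<And>t r v. v \<in> carrier (W t r) \<Longrightarrow> act (W t r) (basis_vec (g [^] n)) v = scl (W t r) (l t r) v"
    and \<pi>: "\<And>t s. t < k \<Longrightarrow> s < n \<Longrightarrow> linear_on N E (\<pi> t s)"
    and \<iota>: "\<And>t. t < k \<Longrightarrow> linear_on E N (\<iota> t)"
    and \<pi>\<iota>: "\<And>t t' s e. t < k \<Longrightarrow> t' < k \<Longrightarrow> s < n \<Longrightarrow> e \<in> carrier E \<Longrightarrow>
      \<pi> t' s (\<iota> t e) = (if t' = t \<and> s = 0 then e else 0)"
    and \<pi>_inj: "\<And>x. x \<in> carrier N \<Longrightarrow> (\<And>t s. t < k \<Longrightarrow> s < n \<Longrightarrow> \<pi> t s x = 0) \<Longrightarrow> x = 0"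
    and \<pi>Y: "\<And>t s x. t < k \<Longrightarrow> s < n \<Longrightarrow> x \<in> carrier N \<Longrightarrow> (\<And>t' s. t' < t \<Longrightarrow> s < n \<Longrightarrow> \<pi> t' s x = 0) \<Longrightarrow>
      0 < s \<or> \<pi> t (n - 1) x = 0 \<Longrightarrow> \<pi> t s (Y x) = (if s = 0 then 0 else L t (\<pi> t (s - 1) x))"
    and L: "\<And>t. t < k \<Longrightarrow> linear_on E E (L t)" "\<And>t. t < k \<Longrightarrow> bij_betw (L t) (carrier E) (carrier E)"
    and \<psi>: "\<And>t. t < k \<Longrightarrow> linear_on (direct_sum m (W t)) E (\<psi> t)"
      "\<And>t. t < k \<Longrightarrow> bij_betw (\<psi> t) (carrier (direct_sum m (W t))) (carrier E)"
      "\<And>t h w. t < k \<Longrightarrow> h \<in> carrier G \<Longrightarrow> w \<in> carrier (direct_sum m (W t)) \<Longrightarrow>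
        \<rho> h (\<iota> t (\<psi> t w)) = \<iota> t (\<psi> t (act (direct_sum m (W t)) (basis_vec h) w))"
  shows "module_iso (hopf_alg G \<chi> g n)
    (direct_sum k (\<lambda>t. direct_sum m (\<lambda>r. x_module G \<chi> n (W t r) n (l t r - 1)))) N"
proof -
  define D where "D = direct_sum k (\<lambda>t. direct_sum m (\<lambda>r. x_module G \<chi> n (W t r) n (l t r - 1)))"
  define YD where "YD = (\<lambda>B t. if t < k then (\<lambda>r. if r < m then x_shift (W t r) n (l t r - 1) (B t r) else 0) else 0)"
  define \<rho>D where "\<rho>D = (\<lambda>h B t. if t < k then (\<lambda>r. if r < m then x_grp \<chi> (W t r) h (B t r) else 0) else 0)"
  define \<Phi> where "\<Phi> C = (\<Sum>t<k. \<Sum>s<n. (Y ^^ s) (\<iota> t (C t s)))" for C :: "nat \<Rightarrow> nat \<Rightarrow> 'e"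
  \<comment> \<open>In \<open>B t r s\<close> the indices are row, summand and degree. Fixing row
    and degree and collecting the summands gives an element of \<open>direct_sum m (W t)\<close>,
    the argument of \<open>\<psi> t\<close>.\<close>
  define col where "col B t s = (\<lambda>r. B t r s)" for B :: "nat \<Rightarrow> nat \<Rightarrow> nat \<Rightarrow> 'v" and t s
  have n: "0 < n" using n_ge_2 by simp
  note aN = hopf_actsD[OF hopf_repD(1)[OF N]] and S = group_repD(1)[OF W]
  note V = aN(1)
  have WD: "is_vsp (direct_sum m (W t))" for t by (rule is_vsp_direct_sum[OF S])
  have xm: "hopf_acts (x_module G \<chi> n (W t r) n (l t r - 1)) (x_shift (W t r) n (l t r - 1)) (x_grp \<chi> (W t r))"
    for t r by (rule hopf_acts_x_module[OF W n])
  note vx = hopf_actsD(1)[OF xm]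
  have D: "hopf_acts D YD \<rho>D"
    unfolding D_def YD_def \<rho>D_def
    by (intro hopf_acts_direct_sum is_vsp_direct_sum vx xm)
  have memD: "B \<in> carrier D \<longleftrightarrow> (\<forall>t r s. if t < k \<and> r < m \<and> s < n then B t r s \<in> carrier (W t r) else B t r s = 0)" for B
    unfolding D_def direct_sum_simps x_module_simps
    by (auto simp: fun_eq_iff not_less split: if_splits) (metis not_le)+
  have sclD: "scl D r B = (\<lambda>t r' s. scl (W t r') r (B t r' s))" for r B
    unfolding D_def direct_sum_simps x_module_simps ..
  have col: "col B t s \<in> carrier (direct_sum m (W t))" if "B \<in> carrier D" for B t s
    using that vsp_zero[OF S] unfolding memD direct_sum_simps col_def
    by (metis not_le)
  have YN: "(Y ^^ i) x \<in> carrier N" if "x \<in> carrier N" for i x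
    using linear_onD(1)[OF linear_on_funpow[OF aN(2)] that] .
  have \<iota>N: "\<iota> t e \<in> carrier N" if "t < k" "e \<in> carrier E" for t e
    using linear_onD(1)[OF \<iota>] that .
  have L0: "L t 0 = 0" if "t < k" for t using linear_on_0[OF E E L(1)[OF that]] .
  have Lpow0: "(L t ^^ i) e = 0 \<Longrightarrow> e = 0" if "t < k" "e \<in> carrier E" for t i e
  proof -
    assume "(L t ^^ i) e = 0"
    then have "(L t ^^ i) e = (L t ^^ i) 0"
      using linear_on_0[OF E E linear_on_funpow[OF L(1)[OF that(1)]]] by simp
    then show "e = 0"
      using bij_betw_funpow[OF L(2)[OF that(1)], of i] that(2) vsp_zero[OF E]
      by (auto simp: bij_betw_def inj_on_def)
  qed

  \<comment> \<open>Starting in column 0 of row t, i applications of \<open>y\<close> reach only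
    column i of that row, besides rows of larger index. As long as \<open>Suc i < n\<close>, column
    n - 1 of row t is still empty, so the side condition of \<open>\<pi>Y\<close> holds and nothing
    wraps around.\<close>
  have row: "(\<forall>t'<t. \<forall>s<n. \<pi> t' s ((Y ^^ i) (\<iota> t e)) = 0) \<and>
      (\<forall>s<n. \<pi> t s ((Y ^^ i) (\<iota> t e)) = (if s = i then (L t ^^ i) e else 0))"
    if t: "t < k" and e: "e \<in> carrier E" and "i < n" for t e i
    using \<open>i < n\<close>
  proof (induction i)
    case 0 then show ?case using \<pi>\<iota> t e by auto
  next
    case (Suc i)
    let ?z = "(Y ^^ i) (\<iota> t e)"
    have z: "?z \<in> carrier N" by (rule YN[OF \<iota>N[OF t e]])
    have low: "\<pi> t' s ?z = 0" if "t' < t" "s < n" for t' s using Suc that by simp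
    have cur: "\<pi> t s ?z = (if s = i then (L t ^^ i) e else 0)" if "s < n" for s using Suc that by simp
    have "\<pi> t' s (Y ?z) = 0" if "t' < t" "s < n" for t' s
    proof -
      have "t' < k" using that t by simp
      then show ?thesis using \<pi>Y[of t' s ?z] z low that n L0 by simp
    qed
    moreover have "\<pi> t s (Y ?z) = (if s = Suc i then (L t ^^ Suc i) e else 0)" if "s < n" for s
    proof -
      have "i \<noteq> n - 1" using Suc.prems by simp
      then have "\<pi> t (n - 1) ?z = 0" using cur[of "n - 1"] n by simp
      then have "\<pi> t s (Y ?z) = (if s = 0 then 0 else L t (\<pi> t (s - 1) ?z))"
        using \<pi>Y[OF t that z low] by simp
      then show ?thesis using cur[of "s - 1"] that L0[OF t] by (cases s) auto
    qed
    ultimately show ?case by simp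
  qed
  have \<Phi>N: "\<Phi> C \<in> carrier N" if "\<And>t s. t < k \<Longrightarrow> s < n \<Longrightarrow> C t s \<in> carrier E" for C
    unfolding \<Phi>_def using that by (intro vsp_sum[OF V] YN \<iota>N) auto
  have \<pi>\<Phi>: "\<pi> t' s' (\<Phi> C) = (\<Sum>t<k. \<Sum>s<n. \<pi> t' s' ((Y ^^ s) (\<iota> t (C t s))))"
    if C: "\<And>t s. t < k \<Longrightarrow> s < n \<Longrightarrow> C t s \<in> carrier E" and "t' < k" "s' < n" for C t' s'
  proof -
    have "\<pi> t' s' (\<Phi> C) = (\<Sum>t<k. \<pi> t' s' (\<Sum>s<n. (Y ^^ s) (\<iota> t (C t s))))"
      unfolding \<Phi>_def
      by (rule linear_on_setsum[OF V E \<pi>[OF that(2,3)]]) (intro vsp_sum[OF V] YN \<iota>N C; simp)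
    also have "\<dots> = (\<Sum>t<k. \<Sum>s<n. \<pi> t' s' ((Y ^^ s) (\<iota> t (C t s))))"
      by (intro sum.cong refl linear_on_setsum[OF V E \<pi>[OF that(2,3)]] YN \<iota>N C) auto
    finally show ?thesis .
  qed
  \<comment> \<open>The triangular shape: if the rows of \<open>C\<close> before t are zero, then
    row t of \<open>\<Phi> C\<close> depends on row t of \<open>C\<close> alone, and the earlier
    rows of \<open>\<Phi> C\<close> are zero.\<close>
  have \<Phi>_row: "\<pi> t' s' (\<Phi> C) = (if t' = t then (L t ^^ s') (C t s') else 0)"
    if C: "\<And>t s. t < k \<Longrightarrow> s < n \<Longrightarrow> C t s \<in> carrier E" and t: "t' \<le> t" "t < k" and s': "s' < n"
      and zero: "\<And>u s. u < t \<Longrightarrow> s < n \<Longrightarrow> C u s = 0" for C t t' s'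
  proof -
    have t': "t' < k" using t by simp
    have entry: "\<pi> t' s' ((Y ^^ s) (\<iota> u (C u s))) = (if u = t' \<and> s = s' \<and> t' = t then (L t ^^ s') (C t s') else 0)"
      if u: "u < k" and s: "s < n" for u s
    proof (cases "u < t")
      case True
      then have "(Y ^^ s) (\<iota> u (C u s)) = 0"
        using zero[OF True s] linear_on_0[OF E V \<iota>[OF u]] linear_on_0[OF V V linear_on_funpow[OF aN(2)]] by simp
      then show ?thesis using True linear_on_0[OF V E \<pi>[OF t' s']] by auto
    next
      case False
      note r = row[OF u C[OF u s] s]
      show ?thesis
      proof (cases "t' < u")
        case True then show ?thesis using r s' by auto
      next
        case False
        then have "t' = t" "u = t" using \<open>\<not> u < t\<close> t by auto
        then show ?thesis using r s' by auto
      qed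
    qed
    have "\<pi> t' s' (\<Phi> C) = (\<Sum>u<k. \<Sum>s<n. \<pi> t' s' ((Y ^^ s) (\<iota> u (C u s))))"
      by (rule \<pi>\<Phi>[OF _ t' s']) (rule C)
    also have "\<dots> = (\<Sum>u<k. \<Sum>s<n. if u = t' \<and> s = s' \<and> t' = t then (L t ^^ s') (C t s') else 0)"
      by (intro sum.cong refl) (simp add: entry)
    also have "\<dots> = (\<Sum>u<k. if u = t' then if t' = t then (L t ^^ s') (C t s') else 0 else 0)"
    proof (intro sum.cong refl)
      fix u
      show "(\<Sum>s<n. if u = t' \<and> s = s' \<and> t' = t then (L t ^^ s') (C t s') else 0) =
          (if u = t' then if t' = t then (L t ^^ s') (C t s') else 0 else 0)"
        using s' by (cases "u = t'"; cases "t' = t") simp_all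
    qed
    also have "\<dots> = (if t' = t then (L t ^^ s') (C t s') else 0)" using t' by simp
    finally show ?thesis .
  qed
  have \<Phi>_add: "\<Phi> (\<lambda>t s. C t s + C' t s) = \<Phi> C + \<Phi> C'"
    if "\<And>t s. t < k \<Longrightarrow> s < n \<Longrightarrow> C t s \<in> carrier E" "\<And>t s. t < k \<Longrightarrow> s < n \<Longrightarrow> C' t s \<in> carrier E" for C C'
    unfolding \<Phi>_def sum.distrib[symmetric]
    by (intro sum.cong refl)
      (simp add: linear_onD(2)[OF \<iota>] that linear_onD(2)[OF linear_on_funpow[OF aN(2)]] \<iota>N)
  have \<Phi>_scl: "\<Phi> (\<lambda>t s. scl E r (C t s)) = scl N r (\<Phi> C)"
    if "\<And>t s. t < k \<Longrightarrow> s < n \<Longrightarrow> C t s \<in> carrier E" for C r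
    unfolding \<Phi>_def vsp_scl_sum[OF V]
    by (intro sum.cong refl)
      (simp add: linear_onD(3)[OF \<iota>] that linear_onD(3)[OF linear_on_funpow[OF aN(2)]] \<iota>N)
  \<comment> \<open>The rows of \<open>C\<close> vanish one after the other: once those before t are
    known to be zero, row t of \<open>\<Phi> C\<close> is the image of row t of \<open>C\<close>
    under the injective powers of \<open>L t\<close>.\<close>
  have \<Phi>_inj: "C t s = 0"
    if C: "\<And>t s. t < k \<Longrightarrow> s < n \<Longrightarrow> C t s \<in> carrier E" and z: "\<Phi> C = 0" and "t < k" "s < n" for C t s
    using that(3,4)
  proof (induction t arbitrary: s rule: less_induct)
    case (less t)
    have "\<pi> t s (\<Phi> C) = (L t ^^ s) (C t s)"
      using \<Phi>_row[OF C order.refl less.prems] less.IH less.prems by simp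
    moreover have "\<pi> t s (\<Phi> C) = 0"
      using z linear_on_0[OF V E \<pi>[OF less.prems]] by simp
    ultimately show ?case using Lpow0[OF less.prems(1) C[OF less.prems]] by simp
  qed
  \<comment> \<open>Forward substitution: \<open>C\<close> is corrected row by row until all
    coordinates of \<open>\<Phi> C\<close> and \<open>x\<close> agree, and \<open>\<pi>_inj\<close>
    then gives equality.\<close>
  have \<Phi>_surj: "\<exists>C. (\<forall>t s. C t s \<in> carrier E) \<and> \<Phi> C = x" if x: "x \<in> carrier N" for x
  proof -
    have "\<exists>C. (\<forall>t s. C t s \<in> carrier E) \<and> (\<forall>t<j. \<forall>s<n. \<pi> t s (\<Phi> C) = \<pi> t s x)" if "j \<le> k" for j
      using that
    proof (induction j)
      case 0 then show ?case using vsp_zero[OF E] by (intro exI[of _ "\<lambda>_ _. 0"]) simp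
    next
      case (Suc j)
      then obtain C where *: "\<forall>t s. C t s \<in> carrier E" "\<forall>t<j. \<forall>s<n. \<pi> t s (\<Phi> C) = \<pi> t s x"
        by auto
      then have C: "\<And>t s. C t s \<in> carrier E" and eq: "\<And>t s. t < j \<Longrightarrow> s < n \<Longrightarrow> \<pi> t s (\<Phi> C) = \<pi> t s x"
        by auto
      have j: "j < k" using Suc.prems by simp
      let ?y = "x - \<Phi> C"
      have y: "?y \<in> carrier N" by (rule vsp_diff[OF V x \<Phi>N[OF C]])
      have "\<exists>e\<in>carrier E. (L j ^^ s) e = \<pi> j s ?y" if "s < n" for s
      proof -
        have "\<pi> j s ?y \<in> carrier E" using linear_onD(1)[OF \<pi>[OF j that] y] .
        then show ?thesis
          using bij_betw_imp_surj_on[OF bij_betw_funpow[OF L(2)[OF j], of s]] by (metis imageE)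
      qed
      then obtain c where c: "\<And>s. s < n \<Longrightarrow> c s \<in> carrier E \<and> (L j ^^ s) (c s) = \<pi> j s ?y" by metis
      \<comment> \<open>The correction lives in row j, so it does not disturb the rows of
        \<open>\<Phi> C\<close> that are already right; its entries are preimages of the remaining
        error under the powers of \<open>L j\<close>.\<close>
      define C' where "C' t s = (if t = j \<and> s < n then c s else 0)" for t s
      have C': "C' t s \<in> carrier E" for t s using c vsp_zero[OF E] by (simp add: C'_def)
      have sum: "\<Phi> (\<lambda>t s. C t s + C' t s) = \<Phi> C + \<Phi> C'" by (rule \<Phi>_add[OF C C'])
      have "\<pi> t s (\<Phi> C + \<Phi> C') = \<pi> t s x" if "t < Suc j" and s: "s < n" for t s
      proof -
        have t: "t \<le> j" "t < k" using that j by auto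
        have "\<pi> t s (\<Phi> C') = (if t = j then (L j ^^ s) (C' j s) else 0)"
          by (rule \<Phi>_row[OF C' t(1) j s]) (simp add: C'_def)
        also have "\<dots> = (if t = j then \<pi> j s x - \<pi> j s (\<Phi> C) else 0)"
          using c[OF s] s linear_on_diff[OF V E \<pi>[OF j s] x \<Phi>N[OF C]] by (simp add: C'_def)
        finally show ?thesis
          using linear_onD(2)[OF \<pi>[OF t(2) s] \<Phi>N[OF C] \<Phi>N[OF C']] eq[OF _ s, of t] t by auto
      qed
      then show ?case
        using C C' by (intro exI[of _ "\<lambda>t s. C t s + C' t s"]) (simp add: sum vsp_add[OF E])
    qed
    from this[of k] obtain C where *: "\<forall>t s. C t s \<in> carrier E" "\<forall>t<k. \<forall>s<n. \<pi> t s (\<Phi> C) = \<pi> t s x"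
      by auto
    then have C: "\<And>t s. C t s \<in> carrier E" and eq: "\<And>t s. t < k \<Longrightarrow> s < n \<Longrightarrow> \<pi> t s (\<Phi> C) = \<pi> t s x"
      by auto
    have "\<Phi> C - x = 0"
    proof (rule \<pi>_inj[OF vsp_diff[OF V \<Phi>N[OF C] x]])
      show "\<pi> t s (\<Phi> C - x) = 0" if "t < k" "s < n" for t s
        using linear_on_diff[OF V E \<pi>[OF that] \<Phi>N[OF C] x] eq[OF that] by simp
    qed
    then show ?thesis using C by auto
  qed

  define F where "F B = \<Phi> (\<lambda>t s. \<psi> t (col B t s))" for B
  have \<psi>E: "\<psi> t (col B t s) \<in> carrier E" if "B \<in> carrier D" "t < k" for B t s
    using linear_onD(1)[OF \<psi>(1)[OF that(2)] col[OF that(1)]] .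
  have \<Phi>_cong: "\<Phi> C = \<Phi> C'" if "\<And>t s. t < k \<Longrightarrow> s < n \<Longrightarrow> C t s = C' t s" for C C'
    unfolding \<Phi>_def using that by (intro sum.cong refl) simp
  have linF: "linear_on D N F"
  proof (rule linear_onI)
    fix B assume B: "B \<in> carrier D"
    show "F B \<in> carrier N" unfolding F_def by (rule \<Phi>N) (rule \<psi>E[OF B])
    fix r
    have "F (scl D r B) = \<Phi> (\<lambda>t s. scl E r (\<psi> t (col B t s)))"
      unfolding F_def
    proof (rule \<Phi>_cong)
      fix t s :: nat assume "t < k"
      have "col (scl D r B) t s = scl (direct_sum m (W t)) r (col B t s)"
        by (simp add: sclD col_def direct_sum_simps)
      then show "\<psi> t (col (scl D r B) t s) = scl E r (\<psi> t (col B t s))"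
        using linear_onD(3)[OF \<psi>(1)[OF \<open>t < k\<close>] col[OF B]] by simp
    qed
    then show "F (scl D r B) = scl N r (F B)"
      unfolding F_def by (subst \<Phi>_scl[symmetric]) (auto intro: \<psi>E[OF B])
  next
    fix B B' assume B: "B \<in> carrier D" and B': "B' \<in> carrier D"
    have "F (B + B') = \<Phi> (\<lambda>t s. \<psi> t (col B t s) + \<psi> t (col B' t s))"
      unfolding F_def
    proof (rule \<Phi>_cong)
      fix t s :: nat assume "t < k"
      have "col (B + B') t s = col B t s + col B' t s"
        by (simp add: col_def fun_eq_iff)
      then show "\<psi> t (col (B + B') t s) = \<psi> t (col B t s) + \<psi> t (col B' t s)"
        using linear_onD(2)[OF \<psi>(1)[OF \<open>t < k\<close>] col[OF B] col[OF B']] by simp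
    qed
    then show "F (B + B') = F B + F B'"
      unfolding F_def by (subst \<Phi>_add[symmetric]) (auto intro: \<psi>E[OF B] \<psi>E[OF B'])
  qed
  have "inj_on F (carrier D)"
  proof (rule linear_on_inj[OF hopf_actsD(1)[OF D] V linF])
    fix B assume B: "B \<in> carrier D" and z: "F B = 0"
    have "B t r s = 0" for t r s
    proof (cases "t < k \<and> s < n")
      case True
      then have "\<psi> t (col B t s) = 0"
        using \<Phi>_inj[OF \<psi>E[OF B] z[unfolded F_def]] by simp
      also have "\<dots> = \<psi> t 0"
        using linear_on_0[OF WD E \<psi>(1)] True by simp
      finally have "col B t s = 0"
        using \<psi>(2)[of t] True col[OF B] vsp_zero[OF WD] by (auto simp: bij_betw_def inj_on_def)
      then show ?thesis by (simp add: col_def fun_eq_iff)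
    next
      case False
      then show ?thesis using B unfolding memD by meson
    qed
    then show "B = 0" by (simp add: fun_eq_iff)
  qed
  moreover have "\<exists>B\<in>carrier D. F B = x" if x: "x \<in> carrier N" for x
  proof -
    obtain C where "\<forall>t s. C t s \<in> carrier E" and eq: "\<Phi> C = x" using \<Phi>_surj[OF x] by auto
    then have C: "\<And>t s. C t s \<in> carrier E" by blast
    have "\<exists>w. w \<in> carrier (direct_sum m (W t)) \<and> \<psi> t w = C t s" if "t < k" for t s
      using bij_betw_imp_surj_on[OF \<psi>(2)[OF that]] C[of t s] by (metis imageE)
    then obtain w where w: "\<And>t s. t < k \<Longrightarrow> w t s \<in> carrier (direct_sum m (W t)) \<and> \<psi> t (w t s) = C t s" by metis
    define B where "B t r s = (if t < k \<and> s < n then w t s r else 0)" for t r s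
    have "B \<in> carrier D" using w unfolding memD B_def direct_sum_simps by auto
    moreover have "F B = \<Phi> C"
      unfolding F_def
    proof (rule \<Phi>_cong)
      show "\<psi> t (col B t s) = C t s" if "t < k" "s < n" for t s
        using w[OF that(1)] that by (simp add: col_def B_def)
    qed
    ultimately show ?thesis using eq by auto
  qed
  ultimately have bij: "bij_betw F (carrier D) (carrier N)"
    using linear_onD(1)[OF linF] by (auto simp: bij_betw_def)
  \<comment> \<open>Moving \<open>h\<close> past \<open>y\<^sup>s\<close> in \<open>N\<close>
    produces \<chi>(h)^(-s), the factor that \<open>x_grp\<close> puts into degree s of the
    source.\<close>
  have F\<rho>: "F (\<rho>D h B) = \<rho> h (F B)" if h: "h \<in> carrier G" and B: "B \<in> carrier D" for h B
  proof -
    have "\<rho> h (F B) = (\<Sum>t<k. \<Sum>s<n. \<rho> h ((Y ^^ s) (\<iota> t (\<psi> t (col B t s)))))"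
    proof -
      have "\<rho> h (F B) = (\<Sum>t<k. \<rho> h (\<Sum>s<n. (Y ^^ s) (\<iota> t (\<psi> t (col B t s)))))"
        unfolding F_def \<Phi>_def
        by (rule linear_on_setsum[OF V V aN(3)[OF h]]) (intro vsp_sum[OF V] YN \<iota>N \<psi>E B; simp)
      also have "\<dots> = (\<Sum>t<k. \<Sum>s<n. \<rho> h ((Y ^^ s) (\<iota> t (\<psi> t (col B t s)))))"
        by (intro sum.cong refl linear_on_setsum[OF V V aN(3)[OF h]] YN \<iota>N \<psi>E B) auto
      finally show ?thesis .
    qed
    also have "\<dots> = F (\<rho>D h B)"
      unfolding F_def \<Phi>_def
    proof (intro sum.cong refl)
      fix t s assume "t \<in> {..<k}" "s \<in> {..<n}"
      then have t: "t < k" and s: "s < n" by auto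
      let ?w = "col B t s" and ?hw = "act (direct_sum m (W t)) (basis_vec h) (col B t s)"
      have hw: "?hw \<in> carrier (direct_sum m (W t))"
        using col[OF B, of t s] linear_onD(1)[OF group_repD(2)[OF W h]] by (simp add: direct_sum_simps)
      have "col (\<rho>D h B) t s = scl (direct_sum m (W t)) (inverse (\<chi> h) ^ s) ?hw"
        using t by (auto simp: col_def \<rho>D_def x_grp_def direct_sum_simps fun_eq_iff vsp_scl[OF S])
      then have "\<psi> t (col (\<rho>D h B) t s) = scl E (inverse (\<chi> h) ^ s) (\<psi> t ?hw)"
        using linear_onD(3)[OF \<psi>(1)[OF t] hw] by simp
      then have "(Y ^^ s) (\<iota> t (\<psi> t (col (\<rho>D h B) t s))) = scl N (inverse (\<chi> h) ^ s) ((Y ^^ s) (\<iota> t (\<psi> t ?hw)))"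
        using linear_onD(3)[OF \<iota>[OF t] linear_onD(1)[OF \<psi>(1)[OF t] hw]]
          linear_onD(3)[OF linear_on_funpow[OF aN(2)] \<iota>N[OF t linear_onD(1)[OF \<psi>(1)[OF t] hw]]] by simp
      also have "\<dots> = \<rho> h ((Y ^^ s) (\<iota> t (\<psi> t ?w)))"
        using hopf_rep_grp_funpow[OF N h \<iota>N[OF t \<psi>E[OF B t]]] \<psi>(3)[OF t h col[OF B]] by simp
      finally show "\<rho> h ((Y ^^ s) (\<iota> t (\<psi> t (col B t s)))) = (Y ^^ s) (\<iota> t (\<psi> t (col (\<rho>D h B) t s)))" ..
    qed
    finally show ?thesis ..
  qed
  \<comment> \<open>Below degree n - 1 both sides raise the degree by one. At the top,
    \<open>N\<close> gives \<open>g\<^sup>n - 1\<close> and the source gives the scalar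
    \<open>l t r - 1\<close>; these agree because \<open>g\<^sup>n\<close> acts on
    \<open>W t r\<close> by \<open>l t r\<close> and \<open>\<psi> t\<close> carries this action
    into \<open>N\<close>.\<close>
  have FY: "F (YD B) = Y (F B)" if B: "B \<in> carrier D" for B
  proof -
    obtain n' where n': "n = Suc n'" using n by (cases n) auto
    let ?z = "\<lambda>t s. \<iota> t (\<psi> t (col B t s))"
    have zN: "?z t s \<in> carrier N" if "t < k" for t s by (rule \<iota>N[OF that \<psi>E[OF B that]])
    have "Y (F B) = (\<Sum>t<k. \<Sum>s<n. (Y ^^ Suc s) (?z t s))"
    proof -
      have "Y (F B) = (\<Sum>t<k. Y (\<Sum>s<n. (Y ^^ s) (?z t s)))"
        unfolding F_def \<Phi>_def
        by (rule linear_on_setsum[OF V V aN(2)]) (intro vsp_sum[OF V] YN zN; simp)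
      also have "\<dots> = (\<Sum>t<k. \<Sum>s<n. Y ((Y ^^ s) (?z t s)))"
        by (intro sum.cong refl linear_on_setsum[OF V V aN(2)] YN zN) auto
      finally show ?thesis by simp
    qed
    also have "\<dots> = F (YD B)"
      unfolding F_def \<Phi>_def
    proof (rule sum.cong[OF refl])
      fix t assume "t \<in> {..<k}"
      then have t: "t < k" by simp
      let ?w = "col B t n'" and ?W = "direct_sum m (W t)"
      have gn: "g [^] n \<in> carrier G" using g_in_G by simp
      have Bz: "B t r s = 0" if "\<not> r < m" for r s using B that unfolding memD by meson
      have shift: "col (YD B) t (Suc s) = col B t s" if "Suc s < n" for s
        using t that Bz by (auto simp: col_def YD_def x_shift_def fun_eq_iff)
      have "act ?W (basis_vec (g [^] n)) ?w = (\<lambda>r. scl (W t r) (l t r) (B t r n'))"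
        using col[OF B, of t n'] Bz by (auto simp: direct_sum_simps col_def fun_eq_iff Wl vsp_scl[OF S])
      then have wrap: "col (YD B) t 0 = act ?W (basis_vec (g [^] n)) ?w - ?w"
        using t Bz by (auto simp: col_def YD_def x_shift_def fun_eq_iff n' vsp_scl[OF S])
      have aw: "act ?W (basis_vec (g [^] n)) ?w \<in> carrier ?W"
        using col[OF B, of t n'] linear_onD(1)[OF group_repD(2)[OF W gn]] by (simp add: direct_sum_simps)
      note \<iota>\<psi> = linear_on_comp[OF \<psi>(1)[OF t] \<iota>[OF t]]
      have "\<iota> t (\<psi> t (col (YD B) t 0)) = \<rho> (g [^] n) (?z t n') - ?z t n'"
        unfolding wrap linear_on_diff[OF WD V \<iota>\<psi> aw col[OF B]] \<psi>(3)[OF t gn col[OF B]] ..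
      also have "\<dots> = (Y ^^ Suc n') (?z t n')" using hopf_repD(3)[OF N zN[OF t]] by (simp add: n')
      finally have w: "(Y ^^ Suc n') (?z t n') = \<iota> t (\<psi> t (col (YD B) t 0))" ..
      have e1: "(\<Sum>s<n. (Y ^^ Suc s) (?z t s)) = (\<Sum>s<n'. (Y ^^ Suc s) (?z t s)) + \<iota> t (\<psi> t (col (YD B) t 0))"
        unfolding n' sum.lessThan_Suc w ..
      have e2: "(\<Sum>s<n'. (Y ^^ Suc s) (?z t s)) = (\<Sum>s<n'. (Y ^^ Suc s) (\<iota> t (\<psi> t (col (YD B) t (Suc s)))))"
        by (intro sum.cong refl) (simp add: shift n')
      have e3: "\<dots> + \<iota> t (\<psi> t (col (YD B) t 0)) = (\<Sum>s<n. (Y ^^ s) (\<iota> t (\<psi> t (col (YD B) t s))))"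
        unfolding n' sum.lessThan_Suc_shift by (simp add: add.commute)
      show "(\<Sum>s<n. (Y ^^ Suc s) (?z t s)) = (\<Sum>s<n. (Y ^^ s) (\<iota> t (\<psi> t (col (YD B) t s))))"
        unfolding e1 e2 e3 ..
    qed
    finally show ?thesis ..
  qed
  show ?thesis
    unfolding D_def[symmetric]
    by (rule hopf_acts_iso[OF D hopf_repD(1)[OF N] linF bij]) (simp_all add: FY F\<rho>)
qed

end

section \<open>Isomorphisms up to a character\<close>

lemma group_rep_closed:
  assumes "is_vsp (group_alg_alg G :: ('k, 'g \<Rightarrow> 'k) alg)" "group_rep G M" "a \<in> carrier (group_alg G)" "x \<in> carrier M"
  shows "act M a x \<in> carrier (M :: ('k::field, 'g \<Rightarrow> 'k, 'm::ab_group_add) lmod)"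
  using group_rep_lin_act[OF assms(1,2)] assms(3,4) by (simp add: lin_act_def linear_on_def)

lemma module_iso_groupE:
  assumes "module_iso (group_alg G) M N"
  obtains f where "linear_on M N f" "bij_betw f (carrier M) (carrier N)"
    "\<And>h x. h \<in> carrier G \<Longrightarrow> x \<in> carrier M \<Longrightarrow> f (act M (basis_vec h) x) = act N (basis_vec h) (f x)"
proof -
  obtain f where bij: "bij_betw f (carrier M) (carrier N)"
    and f: "\<And>x y. x \<in> carrier M \<Longrightarrow> y \<in> carrier M \<Longrightarrow> f (x + y) = f x + f y"
      "\<And>r x. x \<in> carrier M \<Longrightarrow> f (scl M r x) = scl N r (f x)"
      "\<And>a x. a \<in> carrier (group_alg G) \<Longrightarrow> x \<in> carrier M \<Longrightarrow> f (act M a x) = act N a (f x)"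
    using assms unfolding module_iso_def by blast
  show ?thesis
    by (rule that[OF _ bij]) (use bij f in \<open>auto simp: linear_on_def bij_betw_def\<close>)
qed

lemma module_iso_groupI:
  fixes M :: "('k::field, 'g \<Rightarrow> 'k, 'm::ab_group_add) lmod"
  assumes M: "group_rep G M" and N: "group_rep G N" and f: "linear_on M N f"
    and bij: "bij_betw f (carrier M) (carrier N)"
    and eq: "\<And>h x. h \<in> carrier G \<Longrightarrow> x \<in> carrier M \<Longrightarrow> f (act M (basis_vec h) x) = act N (basis_vec h) (f x)"
  shows "module_iso (group_alg G) M N"
proof -
  note S = group_repD(1)[OF M] and T = group_repD(1)[OF N]
  have "f (act M a x) = act N a (f x)" if a: "a \<in> carrier (group_alg G)" and x: "x \<in> carrier M" for a x
  proof -
    have in_M: "act M (basis_vec h) x \<in> carrier M" if "h \<in> carrier G" for h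
      using linear_onD(1)[OF group_repD(2)[OF M that] x] .
    have "f (act M a x) = (\<Sum>h\<in>carrier G. f (scl M (a h) (act M (basis_vec h) x)))"
      unfolding group_repD(5)[OF M a x]
      by (rule linear_on_setsum[OF S T f]) (intro vsp_scale[OF S] in_M)
    also have "\<dots> = (\<Sum>h\<in>carrier G. scl N (a h) (act N (basis_vec h) (f x)))"
      by (intro sum.cong refl) (simp add: linear_onD(3)[OF f in_M] eq x)
    also have "\<dots> = act N a (f x)"
      by (rule group_repD(5)[OF N a linear_onD(1)[OF f x], symmetric])
    finally show ?thesis .
  qed
  then show ?thesis
    unfolding module_iso_def using bij linear_onD(2,3)[OF f] by auto
qed

lemma bij_betw_inverse_pair:
  assumes "\<And>x. x \<in> A \<Longrightarrow> f x \<in> B" "\<And>y. y \<in> B \<Longrightarrow> e y \<in> A"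
    "\<And>x. x \<in> A \<Longrightarrow> e (f x) = x" "\<And>y. y \<in> B \<Longrightarrow> f (e y) = y"
  shows "bij_betw f A B"
  by (rule bij_betw_byWitness[of _ e]) (use assms in auto)

text \<open>The flip commutes with every \<open>h \<otimes> h\<close>. It turns a decomposition of
  \<open>V\<^sub>i \<otimes> V\<^sub>j\<close> into one of
  \<open>V\<^sub>j \<otimes> V\<^sub>i\<close> with the same summands, as the second order of the
  factors requires.\<close>

lemma (in group) module_iso_tensor_flip:
  assumes fin: "finite (carrier G)" and M: "group_rep G M" and N: "group_rep G N"
  shows "module_iso (group_alg G) (tensor_module (group_alg G) M N) (tensor_module (group_alg G) N M)"
proof -
  note V = group_repD(1)[OF M] and W = group_repD(1)[OF N]
  note VW = is_vsp_tensor_space[OF V W] and WV = is_vsp_tensor_space[OF W V]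
  define F where "F = tensor_lift fscale (\<lambda>v w. pure_tensor N M w v)"
  define E where "E = tensor_lift fscale (\<lambda>w v. pure_tensor M N v w)"
  have "bilinear_on M N (tensor_space N M) (\<lambda>v w. pure_tensor N M w v)"
    by (simp add: bilinear_on_def pure_tensor_in[OF W V] pure_tensor_bilinear[OF W V])
  note univ = tensor_universal(3,4)[OF V W WV this, unfolded scl_tensor_space, folded F_def]
  have "bilinear_on N M (tensor_space M N) (\<lambda>w v. pure_tensor M N v w)"
    by (simp add: bilinear_on_def pure_tensor_in[OF V W] pure_tensor_bilinear[OF V W])
  note univ' = tensor_universal(3,4)[OF W V VW this, unfolded scl_tensor_space, folded E_def]
  have EF: "E (F t) = t" if "t \<in> carrier (tensor_space M N)" for t
    by (rule tensor_ext[OF V W VW linear_on_comp[OF univ(1) univ'(1)] linear_on_id _ that])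
      (simp add: univ univ')
  have FE: "F (E t) = t" if "t \<in> carrier (tensor_space N M)" for t
    by (rule tensor_ext[OF W V WV linear_on_comp[OF univ'(1) univ(1)] linear_on_id _ that])
      (simp add: univ univ')
  show ?thesis
  proof (rule module_iso_groupI[OF group_rep_tensor[OF fin M N] group_rep_tensor[OF fin N M]])
    show "linear_on (tensor_module (group_alg G) M N) (tensor_module (group_alg G) N M) F"
      unfolding linear_on_tensor_module by (rule univ)
    show "bij_betw F (carrier (tensor_module (group_alg G) M N)) (carrier (tensor_module (group_alg G) N M))"
      unfolding tensor_module_simps
      by (rule bij_betw_inverse_pair[where e = E])
        (auto intro: linear_onD(1)[OF univ(1)] linear_onD(1)[OF univ'(1)] EF FE)
    fix h t assume h: "h \<in> carrier G" and "t \<in> carrier (tensor_module (group_alg G) M N)"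
    then have t: "t \<in> carrier (tensor_space M N)" by simp
    note lM = group_repD(2)[OF M h] and lN = group_repD(2)[OF N h]
    have "F (tmap M N (act M (basis_vec h)) (act N (basis_vec h)) t) =
        tmap N M (act N (basis_vec h)) (act M (basis_vec h)) (F t)"
      by (rule tensor_ext[OF V W WV linear_on_comp[OF linear_on_tmap[OF V W V W lM lN] univ(1)]
            linear_on_comp[OF univ(1) linear_on_tmap[OF W V W V lN lM]] _ t])
        (simp add: univ tmap_pure[OF V W V W lM lN] tmap_pure[OF W V W V lN lM] linear_onD(1)[OF lM] linear_onD(1)[OF lN])
    then show "F (act (tensor_module (group_alg G) M N) (basis_vec h) t) =
        act (tensor_module (group_alg G) N M) (basis_vec h) (F t)"
      by (simp add: group_tensor_act[OF fin M N h t] group_tensor_act[OF fin N M h linear_onD(1)[OF univ(1) t]])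
  qed
qed

lemma group_rep_direct_sum:
  fixes M :: "nat \<Rightarrow> ('k::field, 'g \<Rightarrow> 'k, 'm::ab_group_add) lmod"
  assumes M: "\<And>s. group_rep G (M s)"
  shows "group_rep G (direct_sum m M)"
proof -
  note V = group_repD(1)[OF M]
  have lin: "linear_on (direct_sum m M) (direct_sum m M) (act (direct_sum m M) (basis_vec h))" if "h \<in> carrier G" for h
    by (intro linear_onI)
      (simp_all add: direct_sum_simps fun_eq_iff vsp_scl(8)[OF V] linear_onD[OF group_repD(2)[OF M that]])
  have "act (direct_sum m M) a x = (\<Sum>h\<in>carrier G. scl (direct_sum m M) (a h) (act (direct_sum m M) (basis_vec h) x))"
    if a: "a \<in> carrier (group_alg G)" and x: "x \<in> carrier (direct_sum m M)" for a x
  proof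
    fix s
    show "act (direct_sum m M) a x s =
        (\<Sum>h\<in>carrier G. scl (direct_sum m M) (a h) (act (direct_sum m M) (basis_vec h) x)) s"
    proof (cases "s < m")
      case True
      then have "x s \<in> carrier (M s)" using x by (simp add: direct_sum_simps)
      from group_repD(5)[OF M a this] show ?thesis
        using True unfolding sum_fun_apply direct_sum_simps by simp
    next
      case False
      then show ?thesis unfolding sum_fun_apply direct_sum_simps by (simp add: vsp_scl(8)[OF V])
    qed
  qed
  moreover have "act (direct_sum m M) (basis_vec \<one>\<^bsub>G\<^esub>) x = x" if "x \<in> carrier (direct_sum m M)" for x
    using that by (auto simp: direct_sum_simps fun_eq_iff group_repD(3)[OF M])
  moreover have "act (direct_sum m M) (basis_vec (h \<otimes>\<^bsub>G\<^esub> h')) x =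
      act (direct_sum m M) (basis_vec h) (act (direct_sum m M) (basis_vec h') x)"
    if "h \<in> carrier G" "h' \<in> carrier G" "x \<in> carrier (direct_sum m M)" for h h' x
    using that by (auto simp: direct_sum_simps fun_eq_iff group_repD(4)[OF M])
  ultimately show ?thesis
    unfolding group_rep_def by (intro conjI ballI is_vsp_direct_sum[OF V] lin)
qed

definition twisted_iso ::
    "('g, 'b) monoid_scheme \<Rightarrow> ('g \<Rightarrow> 'k) \<Rightarrow> ('k::field, 'g \<Rightarrow> 'k, 'm::ab_group_add) lmod \<Rightarrow>
     ('k, 'g \<Rightarrow> 'k, 'n::ab_group_add) lmod \<Rightarrow> ('m \<Rightarrow> 'n) \<Rightarrow> bool" where
  "twisted_iso G \<omega> M N f \<longleftrightarrow> linear_on M N f \<and> bij_betw f (carrier M) (carrier N) \<and>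
     (\<forall>h\<in>carrier G. \<forall>x\<in>carrier M.
        f (act M (basis_vec h) x) = scl N (\<omega> h) (act N (basis_vec h) (f x)))"

lemma twisted_isoD:
  assumes "twisted_iso G \<omega> M N f"
  shows "linear_on M N f" "bij_betw f (carrier M) (carrier N)"
    "h \<in> carrier G \<Longrightarrow> x \<in> carrier M \<Longrightarrow> f (act M (basis_vec h) x) = scl N (\<omega> h) (act N (basis_vec h) (f x))"
  using assms by (auto simp: twisted_iso_def)

lemma twisted_iso_comp:
  assumes N: "group_rep G N" and L: "group_rep G L"
    and f: "twisted_iso G \<omega> M N f" and e: "twisted_iso G \<omega>' N L e"
  shows "twisted_iso G (\<lambda>h. \<omega> h * \<omega>' h) M L (\<lambda>x. e (f x))"
proof -
  note lf = twisted_isoD(1)[OF f] and le = twisted_isoD(1)[OF e]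
  have "e (f (act M (basis_vec h) x)) = scl L (\<omega> h * \<omega>' h) (act L (basis_vec h) (e (f x)))"
    if h: "h \<in> carrier G" and x: "x \<in> carrier M" for h x
  proof -
    have fx: "f x \<in> carrier N" "act N (basis_vec h) (f x) \<in> carrier N"
      using linear_onD(1)[OF lf x] linear_onD(1)[OF group_repD(2)[OF N h]] by auto
    show ?thesis
      by (simp add: twisted_isoD(3)[OF f h x] linear_onD(3)[OF le fx(2)] twisted_isoD(3)[OF e h fx(1)]
          vsp_scl[OF group_repD(1)[OF L]])
  qed
  then show ?thesis
    using linear_on_comp[OF lf le] bij_betw_trans[OF twisted_isoD(2)[OF f] twisted_isoD(2)[OF e]]
    by (simp add: twisted_iso_def comp_def)
qed

lemma twisted_iso_direct_sum:
  assumes M: "\<And>s. group_rep G (M s)" and N: "\<And>s. group_rep G (N s)"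
    and f: "\<And>s. twisted_iso G \<omega> (M s) (N s) (f s)"
  shows "twisted_iso G \<omega> (direct_sum m M) (direct_sum m N) (\<lambda>x s. f s (x s))"
proof -
  note V = group_repD(1)[OF M] and W = group_repD(1)[OF N]
  note lf = twisted_isoD(1)[OF f]
  have f0: "f s 0 = 0" for s by (rule linear_on_0[OF V W lf])
  have lin: "linear_on (direct_sum m M) (direct_sum m N) (\<lambda>x s. f s (x s))"
  proof (rule linear_onI)
    fix x y assume x: "x \<in> carrier (direct_sum m M)" and y: "y \<in> carrier (direct_sum m M)"
    have in_M: "z s \<in> carrier (M s)" if "z \<in> carrier (direct_sum m M)" for z s
      using that vsp_zero[OF V] by (cases "s < m") (auto simp: direct_sum_simps)
    show "(\<lambda>s. f s (x s)) \<in> carrier (direct_sum m N)"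
      using x linear_onD(1)[OF lf] by (simp add: direct_sum_simps f0)
    show "(\<lambda>s. f s ((x + y) s)) = (\<lambda>s. f s (x s)) + (\<lambda>s. f s (y s))"
      by (simp add: fun_eq_iff linear_onD(2)[OF lf] in_M x y)
    show "(\<lambda>s. f s (scl (direct_sum m M) r x s)) = scl (direct_sum m N) r (\<lambda>s. f s (x s))" for r
      by (simp add: fun_eq_iff direct_sum_simps(2) linear_onD(3)[OF lf] in_M x)
  qed
  let ?e = "\<lambda>y s. if s < m then inv_into (carrier (M s)) (f s) (y s) else 0"
  have inv: "inv_into (carrier (M s)) (f s) (f s v) = v" if "v \<in> carrier (M s)" for s v
    by (rule bij_betw_inv_into_left[OF twisted_isoD(2)[OF f] that])
  have inv': "inv_into (carrier (M s)) (f s) w \<in> carrier (M s)" "f s (inv_into (carrier (M s)) (f s) w) = w"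
    if "w \<in> carrier (N s)" for s w
    using twisted_isoD(2)[OF f, of s] that by (auto simp: bij_betw_def inv_into_into f_inv_into_f)
  have "bij_betw (\<lambda>x s. f s (x s)) (carrier (direct_sum m M)) (carrier (direct_sum m N))"
  proof (rule bij_betw_inverse_pair[where e = ?e])
    show "(\<lambda>s. f s (x s)) \<in> carrier (direct_sum m N)" if "x \<in> carrier (direct_sum m M)" for x
      using linear_onD(1)[OF lin that] .
    show "?e y \<in> carrier (direct_sum m M)" if "y \<in> carrier (direct_sum m N)" for y
      using that by (simp add: direct_sum_simps inv')
    show "?e (\<lambda>s. f s (x s)) = x" if "x \<in> carrier (direct_sum m M)" for x
      using that by (auto simp: direct_sum_simps fun_eq_iff inv)
    show "(\<lambda>s. f s (?e y s)) = y" if "y \<in> carrier (direct_sum m N)" for y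
      using that by (auto simp: direct_sum_simps fun_eq_iff inv' f0)
  qed
  moreover have "(\<lambda>s. f s (act (direct_sum m M) (basis_vec h) x s)) =
      scl (direct_sum m N) (\<omega> h) (act (direct_sum m N) (basis_vec h) (\<lambda>s. f s (x s)))"
    if "h \<in> carrier G" "x \<in> carrier (direct_sum m M)" for h x
    using that by (auto simp: direct_sum_simps fun_eq_iff twisted_isoD(3)[OF f] f0 vsp_scl(8)[OF W])
  ultimately show ?thesis
    unfolding twisted_iso_def by (intro conjI ballI lin)
qed

context group_datum
begin

lemma is_vsp_group_alg_k: "is_vsp (group_alg_alg G :: ('k, 'g \<Rightarrow> 'k) alg)"
  by (rule is_vsp_group_alg[OF finite_G])

text \<open>The direction is reversed because the decompositions start at the tensor product, while
  the triangularity criterion asks for maps from the direct sum into it.\<close>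

lemma module_iso_twisted_iso:
  assumes N: "group_rep G N" and M: "group_rep G M" and iso: "module_iso (group_alg G) N M"
  shows "\<exists>f. twisted_iso G (\<lambda>h. 1 :: 'k) M N f"
proof -
  have "module_iso (group_alg G) M N"
    by (rule module_iso_sym[OF group_repD(1)[OF N] _ iso])
      (rule group_rep_closed[OF is_vsp_group_alg_k N], simp_all)
  then obtain f where "linear_on M N f" "bij_betw f (carrier M) (carrier N)"
    "\<And>h x. h \<in> carrier G \<Longrightarrow> x \<in> carrier M \<Longrightarrow> f (act M (basis_vec h) x) = act N (basis_vec h) (f x)"
    by (rule module_iso_groupE) blast
  then show ?thesis
    unfolding twisted_iso_def by (auto simp: vsp_scl[OF group_repD(1)[OF N]])
qed

lemma char_inv_module_act:
  assumes "h \<in> carrier G"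
  shows "act (char_inv_module G \<chi>) (basis_vec h) c = inverse (\<chi> h) * c"
proof -
  have "(\<Sum>x\<in>carrier G. basis_vec h x * inverse (\<chi> x) * c) = (\<Sum>x\<in>carrier G. if x = h then inverse (\<chi> x) * c else 0)"
    by (rule sum.cong) (auto simp: basis_vec_def)
  then show ?thesis using assms finite_G by (simp add: char_inv_module_def)
qed

lemma group_rep_char_inv_module: "group_rep G (char_inv_module G \<chi>)"
proof -
  have V: "is_vsp (char_inv_module G \<chi>)"
    unfolding char_inv_module_def
    by (rule is_vspI) (auto simp: vector_space_def algebra_simps)
  have [simp]: "scl (char_inv_module G \<chi>) = (*)" "carrier (char_inv_module G \<chi>) = UNIV"
    by (simp_all add: char_inv_module_def)
  show ?thesis
    unfolding group_rep_def
    using V by (auto simp: linear_on_def char_inv_module_act char_mult char_one algebra_simps)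
      (auto simp: char_inv_module_def algebra_simps intro!: sum.cong)
qed

text \<open>The map is \<open>c \<otimes> v \<mapsto> c v\<close>, with inverse
  \<open>v \<mapsto> 1 \<otimes> v\<close>; the first factor contributes the scalar
  \<chi>(h)^(-1).\<close>

lemma char_inv_tensor_twisted_iso:
  assumes N: "group_rep G N"
  shows "\<exists>f. twisted_iso G (\<lambda>h. inverse (\<chi> h)) (tensor_module (group_alg G) (char_inv_module G \<chi>) N) N f"
proof -
  let ?X = "char_inv_module G \<chi>"
  note V = group_repD(1)[OF N] and X = group_repD(1)[OF group_rep_char_inv_module]
  note T = is_vsp_tensor_space[OF X V]
  have sX [simp]: "scl ?X = (*)" "carrier ?X = UNIV" by (simp_all add: char_inv_module_def)
  define F where "F = tensor_lift (scl N) (scl N)"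
  have "bilinear_on ?X N N (scl N)"
    by (simp add: bilinear_on_def vsp_scale[OF V] vsp_scl[OF V] mult.commute)
  note univ = tensor_universal(3,4)[OF X V V this, folded F_def]
  have Fp: "F (pure_tensor ?X N c v) = scl N c v" if "v \<in> carrier N" for c v
    using univ(2) that by simp
  have pure1: "pure_tensor ?X N c v = pure_tensor ?X N 1 (scl N c v)" if "v \<in> carrier N" for c v
    using pure_tensor_scl_left[OF X V, of 1 v c] pure_tensor_scl_right[OF X V, of 1 v c] that by simp
  have lin1: "linear_on N (tensor_space ?X N) (pure_tensor ?X N 1)"
    by (intro linear_onI) (simp_all add: pure_tensor_in[OF X V] pure_tensor_bilinear[OF X V])
  have "bij_betw F (carrier (tensor_space ?X N)) (carrier N)"
  proof (rule bij_betw_inverse_pair[where e = "pure_tensor ?X N 1"])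
    show "pure_tensor ?X N 1 (F t) = t" if "t \<in> carrier (tensor_space ?X N)" for t
      by (rule tensor_ext[OF X V T linear_on_comp[OF univ(1) lin1] linear_on_id _ that])
        (simp add: Fp pure1[symmetric])
  qed (auto simp: Fp vsp_scl[OF V] intro: linear_onD(1)[OF univ(1)] linear_onD(1)[OF lin1])
  moreover have "F (act (tensor_module (group_alg G) ?X N) (basis_vec h) t) =
      scl N (inverse (\<chi> h)) (act N (basis_vec h) (F t))"
    if h: "h \<in> carrier G" and t: "t \<in> carrier (tensor_space ?X N)" for h t
  proof -
    note lX = group_repD(2)[OF group_rep_char_inv_module h] and lN = group_repD(2)[OF N h]
    have "F (tmap ?X N (act ?X (basis_vec h)) (act N (basis_vec h)) t) =
        scl N (inverse (\<chi> h)) (act N (basis_vec h) (F t))"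
      by (rule tensor_ext[OF X V V linear_on_comp[OF linear_on_tmap[OF X V X V lX lN] univ(1)]
            linear_on_scl[OF V linear_on_comp[OF univ(1) lN]] _ t])
        (simp add: tmap_pure[OF X V X V lX lN] Fp char_inv_module_act h linear_onD[OF lN] vsp_scl[OF V])
    then show ?thesis
      by (simp add: group_tensor_act[OF finite_G group_rep_char_inv_module N h t])
  qed
  ultimately show ?thesis
    unfolding twisted_iso_def linear_on_tensor_module tensor_module_simps(1)
    using univ(1) by blast
qed

text \<open>Each application of \<tau> contributes one factor \<chi>^(-1), so \<tau>^t accounts for
  the twist of the layer \<open>x\<^sup>t V\<^sub>i\<close>.\<close>

lemma tau_power_twisted_iso:
  assumes V: "\<And>s. group_rep G (V s)"
    and tau: "\<And>s. module_iso (group_alg G) (tensor_module (group_alg G) (char_inv_module G \<chi>) (V s)) (V (\<tau> s))"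
  shows "\<exists>f. twisted_iso G (\<lambda>h. inverse (\<chi> h) ^ t) (V ((\<tau> ^^ t) s)) (V s) f"
proof (induction t)
  case 0
  show ?case
    by (intro exI[of _ "\<lambda>x. x"]) (simp add: twisted_iso_def linear_on_id bij_betw_def vsp_scl[OF group_repD(1)[OF V]])
next
  case (Suc t)
  let ?s = "(\<tau> ^^ t) s"
  let ?T = "tensor_module (group_alg G) (char_inv_module G \<chi>) (V ?s)"
  obtain f where f: "twisted_iso G (\<lambda>h. inverse (\<chi> h) ^ t) (V ?s) (V s) f" using Suc by blast
  have T: "group_rep G ?T" by (rule group_rep_tensor[OF finite_G group_rep_char_inv_module V])
  obtain e where e: "twisted_iso G (\<lambda>h. 1) (V (\<tau> ?s)) ?T e"
    using module_iso_twisted_iso[OF T V tau] by blast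
  obtain d where d: "twisted_iso G (\<lambda>h. inverse (\<chi> h)) ?T (V ?s) d"
    using char_inv_tensor_twisted_iso[OF V] by blast
  show ?case
    using twisted_iso_comp[OF V V twisted_iso_comp[OF T V e d] f] by auto
qed

section \<open>Coordinates on tensor products of modules of the form \<open>V \<oplus> xV \<oplus> \<dots>\<close>\<close>

text \<open>The element \<open>x\<^sup>t v\<close>.\<close>

definition x_at :: "nat \<Rightarrow> 'v::zero \<Rightarrow> nat \<Rightarrow> 'v" where
  "x_at t v = (\<lambda>s. if s = t then v else 0)"

lemma x_at_simps: "x_at t v t = v" "s \<noteq> t \<Longrightarrow> x_at t v s = 0"
  by (simp_all add: x_at_def)

lemma linear_on_x_at:
  "is_vsp V \<Longrightarrow> t < k \<Longrightarrow> linear_on V (x_module G \<chi> n V k c) (x_at t)"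
  by (rule linear_onI) (auto simp: x_module_simps x_at_def fun_eq_iff vsp_closed vsp_scl)

lemma linear_on_x_eval:
  assumes "is_vsp V"
  shows "linear_on (x_module G \<chi> n V k c) V (\<lambda>f. f t)"
proof (rule linear_onI)
  show "f t \<in> carrier V" if "f \<in> carrier (x_module G \<chi> n V k c)" for f
    using that vsp_zero[OF assms] by (cases "t < k") (auto simp: x_module_simps)
qed (simp_all add: x_module_simps)

lemma x_expand:
  assumes "f \<in> carrier (x_module G \<chi> n V k c)"
  shows "f = (\<Sum>t<k. x_at t (f t))"
proof
  fix s
  have "(\<Sum>t<k. x_at t (f t) s) = (\<Sum>t<k. if t = s then f s else 0)"
    by (rule sum.cong) (auto simp: x_at_def)
  then show "f s = (\<Sum>t<k. x_at t (f t)) s"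
    using assms by (auto simp: sum_fun_apply x_module_simps)
qed

text \<open>The component in \<open>x\<^sup>t V \<otimes> x\<^sup>s W\<close>, read as an element of
  \<open>V \<otimes> W\<close>.\<close>

abbreviation (input) "coord V W t s \<equiv> tmap V W (\<lambda>f. f t) (\<lambda>f. f s)"

context
  fixes V :: "('k, 'g \<Rightarrow> 'k, 'v::ab_group_add) lmod" and W :: "('k, 'g \<Rightarrow> 'k, 'w::ab_group_add) lmod"
    and k l :: nat and c d :: 'k and M N
  defines "M \<equiv> x_module G \<chi> n V k c" and "N \<equiv> x_module G \<chi> n W l d"
  assumes V: "group_rep G V" and W: "group_rep G W" and k: "0 < k" and l: "0 < l"
begin

lemma vspV: "is_vsp V" and vspW: "is_vsp W" and vspM: "is_vsp M" and vspN: "is_vsp N"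
  using V W is_vsp_x_module by (auto simp: M_def N_def dest: group_repD(1))

lemma evV: "linear_on M V (\<lambda>f. f t)" and evW: "linear_on N W (\<lambda>f. f t)"
  and atV: "t < k \<Longrightarrow> linear_on V M (x_at t)" and atW: "t < l \<Longrightarrow> linear_on W N (x_at t)"
  unfolding M_def N_def by (intro linear_on_x_eval linear_on_x_at vspV vspW; assumption?)+

lemma linear_on_coord: "linear_on (tensor_space M N) (tensor_space V W) (coord V W t s)"
  by (rule linear_on_tmap[OF vspM vspN vspV vspW evV evW])

text \<open>The identity of each factor is the sum over the degrees of evaluation followed by
  \<open>x_at\<close>. Expanding both factors writes \<open>x\<close> as a sum of images of its
  coordinates.\<close>

lemma coord_inj:
  assumes x: "x \<in> carrier (tensor_space M N)" and z: "\<And>t s. t < k \<Longrightarrow> s < l \<Longrightarrow> coord V W t s x = 0"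
  shows "x = 0"
proof -
  have atev: "linear_on M M (\<lambda>f. x_at t (f t))" if "t < k" for t
    by (rule linear_on_comp[OF evV atV[OF that]])
  have atev': "linear_on N N (\<lambda>f. x_at t (f t))" if "t < l" for t
    by (rule linear_on_comp[OF evW atW[OF that]])
  have "x = tmap M N (\<lambda>f. f) (\<lambda>f. f) x" by (rule tmap_id[OF vspM vspN x, symmetric])
  also have "\<dots> = tmap M N (\<lambda>f. \<Sum>t<k. x_at t (f t)) (\<lambda>f. \<Sum>s<l. x_at s (f s)) x"
    by (rule tmap_cong[OF vspM vspN vspM vspN linear_on_id linear_on_id _ _ x])
      (auto simp: M_def N_def intro: x_expand)
  also have "\<dots> = (\<Sum>t<k. tmap M N (\<lambda>f. x_at t (f t)) (\<lambda>f. \<Sum>s<l. x_at s (f s)) x)"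
    by (rule tmap_sum_left[OF vspM vspN vspM vspN _ _ x]) (auto intro: atev atev' linear_on_sum_fun vspN)
  also have "\<dots> = (\<Sum>t<k. \<Sum>s<l. tmap M N (\<lambda>f. x_at t (f t)) (\<lambda>f. x_at s (f s)) x)"
    by (rule sum.cong[OF refl], rule tmap_sum_right[OF vspM vspN vspM vspN _ _ x]) (auto intro: atev atev')
  also have "\<dots> = (\<Sum>t<k. \<Sum>s<l. tmap M N (x_at t) (x_at s) (coord V W t s x))"
    by (intro sum.cong refl) (simp add: tmap_comp[OF vspM vspN vspV vspW vspM vspN evV evW atV atW x])
  also have "\<dots> = (\<Sum>t<k. \<Sum>s<l. tmap M N (x_at t) (x_at s) 0)"
    by (intro sum.cong refl) (simp add: z)
  also have "\<dots> = 0"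
    using linear_on_0[OF is_vsp_tensor_space[OF vspV vspW] is_vsp_tensor_space[OF vspM vspN]
        linear_on_tmap[OF vspV vspW vspM vspN atV atW]] by simp
  finally show ?thesis .
qed

lemma coord_x_at:
  assumes "t' < k" "s' < l" and e: "e \<in> carrier (tensor_space V W)"
  shows "coord V W t s (tmap M N (x_at t') (x_at s') e) = (if t = t' \<and> s = s' then e else 0)"
proof -
  have "coord V W t s (tmap M N (x_at t') (x_at s') e) = tmap V W (\<lambda>v. x_at t' v t) (\<lambda>w. x_at s' w s) e"
    by (rule tmap_comp[OF vspV vspW vspM vspN vspV vspW atV[OF assms(1)] atW[OF assms(2)] evV evW e])
  then show ?thesis
    using tmap_id[OF vspV vspW e] tmap_zero_left[OF vspV vspW vspV vspW linear_on_id _ e, of "\<lambda>w. x_at s' w s"]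
      tmap_zero_right[OF vspV vspW vspV vspW _ linear_on_id e, of "\<lambda>w. x_at t' w t"]
      linear_on_comp[OF atV[OF assms(1)] evV] linear_on_comp[OF atW[OF assms(2)] evW]
      linear_on_zero[OF vspV, of V] linear_on_zero[OF vspW, of W] linear_on_id[of V] linear_on_id[of W]
    by (cases "t = t'"; cases "s = s'") (simp_all add: x_at_simps)
qed

lemma x_at_grp:
  assumes t: "t < k" "s < l" and e: "e \<in> carrier (tensor_space V W)" and h: "h \<in> carrier G"
  shows "tmap M N (x_grp \<chi> V h) (x_grp \<chi> W h) (tmap M N (x_at t) (x_at s) e) =
    tmap M N (x_at t) (x_at s) (fscale (inverse (\<chi> h) ^ (t + s)) (tmap V W (act V (basis_vec h)) (act W (basis_vec h)) e))"
proof -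
  note hV = group_repD(2)[OF V h] and hW = group_repD(2)[OF W h]
  note gM = hopf_actsD(3)[OF hopf_acts_x_module[OF V k, of c] h, folded M_def]
  note gN = hopf_actsD(3)[OF hopf_acts_x_module[OF W l, of d] h, folded N_def]
  note a = atV[OF t(1)] and b = atW[OF t(2)]
  have h0: "act V (basis_vec h) 0 = 0" "act W (basis_vec h) 0 = 0"
    using linear_on_0[OF vspV vspV hV] linear_on_0[OF vspW vspW hW] by auto
  let ?e = "tmap V W (act V (basis_vec h)) (act W (basis_vec h)) e"
  have e': "?e \<in> carrier (tensor_space V W)" by (rule tmap_in[OF vspV vspW vspV vspW hV hW e])
  have eqV: "x_grp \<chi> V h (x_at t v) = scl M (inverse (\<chi> h) ^ t) (x_at t (act V (basis_vec h) v))" for v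
    by (auto simp: x_grp_def x_at_def fun_eq_iff h0 vsp_scl[OF vspV] M_def x_module_simps)
  have eqW: "x_grp \<chi> W h (x_at s v) = scl N (inverse (\<chi> h) ^ s) (x_at s (act W (basis_vec h) v))" for v
    by (auto simp: x_grp_def x_at_def fun_eq_iff h0 vsp_scl[OF vspW] N_def x_module_simps)
  note aV = linear_on_comp[OF hV a] and bW = linear_on_comp[OF hW b]
  have "tmap M N (x_grp \<chi> V h) (x_grp \<chi> W h) (tmap M N (x_at t) (x_at s) e) =
      tmap M N (\<lambda>v. x_grp \<chi> V h (x_at t v)) (\<lambda>v. x_grp \<chi> W h (x_at s v)) e"
    by (rule tmap_comp[OF vspV vspW vspM vspN vspM vspN a b gM gN e])
  also have "\<dots> = fscale (inverse (\<chi> h) ^ t) (fscale (inverse (\<chi> h) ^ s)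
      (tmap M N (\<lambda>v. x_at t (act V (basis_vec h) v)) (\<lambda>v. x_at s (act W (basis_vec h) v)) e))"
    unfolding eqV eqW
    by (simp only: tmap_scl_left[OF vspV vspW vspM vspN aV linear_on_scl[OF vspN bW] e]
        tmap_scl_right[OF vspV vspW vspM vspN aV bW e])
  also have "tmap M N (\<lambda>v. x_at t (act V (basis_vec h) v)) (\<lambda>v. x_at s (act W (basis_vec h) v)) e =
      tmap M N (x_at t) (x_at s) ?e"
    by (rule tmap_comp[OF vspV vspW vspV vspW vspM vspN hV hW a b e, symmetric])
  also have "fscale (inverse (\<chi> h) ^ t) (fscale (inverse (\<chi> h) ^ s) (tmap M N (x_at t) (x_at s) ?e)) =
      fscale (inverse (\<chi> h) ^ (t + s)) (tmap M N (x_at t) (x_at s) ?e)"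
    by (simp add: fscale_def fun_eq_iff power_add)
  also have "\<dots> = tmap M N (x_at t) (x_at s) (fscale (inverse (\<chi> h) ^ (t + s)) ?e)"
    using linear_onD(3)[OF linear_on_tmap[OF vspV vspW vspM vspN a b] e'] by simp
  finally show ?thesis .
qed

text \<open>The first summand is \<open>y \<otimes> g\<close>: it shifts the first index, and
  \<open>g\<close> acts on \<open>x\<^sup>s W\<close> with the twist \<chi>(g)^(-s). The second is
  \<open>1 \<otimes> y\<close> and shifts the second index. With \<open>k\<close>, \<open>l\<close>,
  \<open>c\<close>, \<open>d\<close> left free the formula serves both orders of the
  factors.\<close>

lemma coord_y:
  assumes t: "t < k" and s: "s < l" and x: "x \<in> carrier (tensor_space M N)"
  shows "coord V W t s (tensor_y M N (x_shift V k c) (x_shift W l d) (x_grp \<chi> W) x) =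
    fscale (inverse (\<chi> g) ^ s) (tmap V W (\<lambda>v. v) (act W (basis_vec g))
      (if t = 0 then fscale c (coord V W (k - 1) s x) else coord V W (t - 1) s x)) +
    (if s = 0 then fscale d (coord V W t (l - 1) x) else coord V W t (s - 1) x)"
proof -
  note hW = group_repD(2)[OF W g_in_G]
  note yM = hopf_actsD(2)[OF hopf_acts_x_module[OF V k, of c], folded M_def]
  note yN = hopf_actsD(2)[OF hopf_acts_x_module[OF W l, of d], folded N_def]
  note gN = hopf_actsD(3)[OF hopf_acts_x_module[OF W l, of d] g_in_G, folded N_def]
  note VW = is_vsp_tensor_space[OF vspV vspW]
  note c4 = vspM vspN vspV vspW
  have shift: "linear_on M V (\<lambda>f. if t = 0 then scl V c (f (k - 1)) else f (t - 1))"
    by (cases "t = 0") (simp_all add: evV linear_on_scl[OF vspV evV])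
  define u where "u = (if t = 0 then fscale c (coord V W (k - 1) s x) else coord V W (t - 1) s x)"
  have u: "u \<in> carrier (tensor_space V W)"
    using linear_onD(1)[OF linear_on_coord x] vsp_scale[OF VW] by (simp add: u_def)
  have "coord V W t s (tmap M N (x_shift V k c) (x_grp \<chi> W g) x) =
      tmap V W (\<lambda>f. x_shift V k c f t) (\<lambda>f. x_grp \<chi> W g f s) x"
    by (rule tmap_comp[OF vspM vspN vspM vspN vspV vspW yM gN evV evW x])
  also have "\<dots> = tmap V W (\<lambda>f. if t = 0 then scl V c (f (k - 1)) else f (t - 1))
      (\<lambda>f. scl W (inverse (\<chi> g) ^ s) (act W (basis_vec g) (f s))) x"
    using t by (simp add: x_shift_def x_grp_def cong: if_cong)
  also have "\<dots> = fscale (inverse (\<chi> g) ^ s) (tmap V W (\<lambda>f. if t = 0 then scl V c (f (k - 1)) else f (t - 1))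
      (\<lambda>f. act W (basis_vec g) (f s)) x)"
    by (rule tmap_scl_right[OF c4 shift linear_on_comp[OF evW hW] x])
  also have "tmap V W (\<lambda>f. if t = 0 then scl V c (f (k - 1)) else f (t - 1))
      (\<lambda>f. act W (basis_vec g) (f s)) x =
      tmap V W (\<lambda>v. v) (act W (basis_vec g)) (tmap V W (\<lambda>f. if t = 0 then scl V c (f (k - 1)) else f (t - 1)) (\<lambda>f. f s) x)"
    by (rule tmap_comp[OF c4 vspV vspW shift evW linear_on_id hW x, symmetric])
  also have "tmap V W (\<lambda>f. if t = 0 then scl V c (f (k - 1)) else f (t - 1)) (\<lambda>f. f s) x = u"
    by (simp add: u_def tmap_scl_left[OF c4 evV evW x])
  finally have 1: "coord V W t s (tmap M N (x_shift V k c) (x_grp \<chi> W g) x) =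
      fscale (inverse (\<chi> g) ^ s) (tmap V W (\<lambda>v. v) (act W (basis_vec g)) u)" .
  have "coord V W t s (tmap M N (\<lambda>f. f) (x_shift W l d) x) =
      tmap V W (\<lambda>f. f t) (\<lambda>f. x_shift W l d f s) x"
    by (rule tmap_comp[OF vspM vspN vspM vspN vspV vspW linear_on_id yN evV evW x])
  also have "\<dots> = (if s = 0 then fscale d (coord V W t (l - 1) x) else coord V W t (s - 1) x)"
    using s by (simp add: x_shift_def tmap_scl_right[OF c4 evV evW x])
  finally have 2: "coord V W t s (tmap M N (\<lambda>f. f) (x_shift W l d) x) =
      (if s = 0 then fscale d (coord V W t (l - 1) x) else coord V W t (s - 1) x)" .
  have "tmap M N (x_shift V k c) (x_grp \<chi> W g) x \<in> carrier (tensor_space M N)"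
    "tmap M N (\<lambda>f. f) (x_shift W l d) x \<in> carrier (tensor_space M N)"
    using tmap_in[OF vspM vspN vspM vspN yM gN x] tmap_in[OF vspM vspN vspM vspN linear_on_id yN x] .
  then show ?thesis
    using linear_onD(2)[OF linear_on_coord] by (simp only: 1 2 u_def)
qed

end

section \<open>The tensor products of \<open>M(k,i)\<close> and \<open>P\<^sub>j\<close>\<close>

context
  fixes U :: "('k, 'g \<Rightarrow> 'k, 'u::ab_group_add) lmod" and W :: "('k, 'g \<Rightarrow> 'k, 'w::ab_group_add) lmod"
    and X :: "nat \<Rightarrow> nat \<Rightarrow> ('k, 'g \<Rightarrow> 'k, 'v::ab_group_add) lmod"
    and k m :: nat and \<mu> :: 'k and l :: "nat \<Rightarrow> nat \<Rightarrow> 'k"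
  assumes U: "group_rep G U" and W: "group_rep G W" and X: "\<And>t r. group_rep G (X t r)"
    and gU: "\<And>v. v \<in> carrier U \<Longrightarrow> act U (basis_vec (g [^] n)) v = scl U 1 v"
    and gW: "\<And>v. v \<in> carrier W \<Longrightarrow> act W (basis_vec (g [^] n)) v = scl W \<mu> v"
    and gX: "\<And>t r v. v \<in> carrier (X t r) \<Longrightarrow> act (X t r) (basis_vec (g [^] n)) v = scl (X t r) (l t r) v"
    and k: "0 < k" "k \<le> n"
begin

text \<open>Here \<open>y \<otimes> g\<close> raises the degree in \<open>M\<close>, hence the row,
  and \<open>1 \<otimes> y\<close> stays in the row as a shift of the degree in \<open>P\<close>.
  The diagonal operators \<open>L t\<close> are therefore the identity.\<close>

lemma tensor_M_P_iso:
  assumes \<psi>: "\<And>t. t < k \<Longrightarrow> twisted_iso G (\<lambda>h. inverse (\<chi> h) ^ t) (direct_sum m (X t))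
      (tensor_module (group_alg G) U W) (\<psi> t)"
  shows "module_iso (hopf_alg G \<chi> g n)
    (direct_sum k (\<lambda>t. direct_sum m (\<lambda>r. x_module G \<chi> n (X t r) n (l t r - 1))))
    (tensor_module (hopf_alg G \<chi> g n) (x_module G \<chi> n U k 0) (x_module G \<chi> n W n (\<mu> - 1)))"
proof -
  let ?M = "x_module G \<chi> n U k 0" and ?P = "x_module G \<chi> n W n (\<mu> - 1)"
  let ?T = "tensor_module (hopf_alg G \<chi> g n) ?M ?P" and ?E = "tensor_module (group_alg G) U W"
  have n: "0 < n" using n_ge_2 by simp
  note vU = group_repD(1)[OF U] and vW = group_repD(1)[OF W]
  note vM = is_vsp_x_module[OF vU, of k 0] and vP = is_vsp_x_module[OF vW, of n "\<mu> - 1"]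
  note E = is_vsp_tensor_space[OF vU vW]
  note M = hopf_rep_x_module[OF U gU k, of 0] and P = hopf_rep_x_module[OF W gW n order.refl, of "\<mu> - 1"]
  note T = hopf_rep_tensor[OF M P]
  note coord = linear_on_coord[OF U W k(1) n]
  let ?\<iota> = "\<lambda>t. tmap ?M ?P (x_at t) (x_at 0)"
  show ?thesis
  proof (rule triangular_iso[where N = ?T and E = ?E and W = X and l = l and \<psi> = \<psi> and L = "\<lambda>_ e. e"
        and \<pi> = "\<lambda>t s. coord U W t s" and \<iota> = ?\<iota>, OF T is_vsp_tensor_module[OF vU vW] X gX,
        unfolded linear_on_tensor_module tensor_module_simps(1)])
    show "linear_on (tensor_space ?M ?P) (tensor_space U W) (coord U W t s)" for t s by (rule coord)
    show "linear_on (tensor_space U W) (tensor_space ?M ?P) (?\<iota> t)" if "t < k" for t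
      by (rule linear_on_tmap[OF vU vW vM vP linear_on_x_at[OF vU that] linear_on_x_at[OF vW n]])
    show "coord U W t' s (?\<iota> t e) = (if t' = t \<and> s = 0 then e else 0)"
      if "t < k" "e \<in> carrier (tensor_space U W)" for t t' s e
      by (rule coord_x_at[OF U W k(1) n that(1) n that(2)])
    show "x = 0" if "x \<in> carrier (tensor_space ?M ?P)" "\<And>t s. t < k \<Longrightarrow> s < n \<Longrightarrow> coord U W t s x = 0" for x
      by (rule coord_inj[OF U W k(1) n that])
    show "coord U W t s (tensor_y ?M ?P (x_shift U k 0) (x_shift W n (\<mu> - 1)) (x_grp \<chi> W) x) =
        (if s = 0 then 0 else coord U W t (s - 1) x)"
      if "t < k" "s < n" and x: "x \<in> carrier (tensor_space ?M ?P)"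
        and low: "\<And>t' s. t' < t \<Longrightarrow> s < n \<Longrightarrow> coord U W t' s x = 0" and z: "0 < s \<or> coord U W t (n - 1) x = 0"
      for t s x
    proof -
      \<comment> \<open>Row t receives \<open>y \<otimes> g\<close> from row t - 1, which is zero by
        assumption; for t = 0 it would come from the last row, with the wrap-around constant 0 of
        \<open>M\<close>.\<close>
      have 1: "(if t = 0 then fscale 0 (coord U W (k - 1) s x) else coord U W (t - 1) s x) = 0"
        using low[of "t - 1" s] that(2) by (simp add: fscale_def fun_eq_iff)
      have 2: "tmap U W (\<lambda>v. v) (act W (basis_vec g)) 0 = 0"
        by (rule linear_on_0[OF E E linear_on_tmap[OF vU vW vU vW linear_on_id group_repD(2)[OF W g_in_G]]])
      have 3: "fscale a (0 :: 'u \<times> 'w \<Rightarrow> 'k) = 0" for a by (simp add: fscale_def fun_eq_iff)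
      show ?thesis
        using z unfolding coord_y[OF U W k(1) n that(1-3)] 1 2 3 by (auto simp: 3)
    qed
    show "linear_on (tensor_space U W) (tensor_space U W) (\<lambda>e. e)" by (rule linear_on_id)
    show "bij_betw (\<lambda>e. e) (carrier (tensor_space U W)) (carrier (tensor_space U W))" by (simp add: bij_betw_def)
    show "linear_on (direct_sum m (X t)) (tensor_space U W) (\<psi> t)"
      "bij_betw (\<psi> t) (carrier (direct_sum m (X t))) (carrier (tensor_space U W))" if "t < k" for t
      using twisted_isoD(1,2)[OF \<psi>[OF that]] by (simp_all add: linear_on_tensor_module)
    show "tmap ?M ?P (x_grp \<chi> U h) (x_grp \<chi> W h) (?\<iota> t (\<psi> t w)) = ?\<iota> t (\<psi> t (act (direct_sum m (X t)) (basis_vec h) w))"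
      if "t < k" and h: "h \<in> carrier G" and w: "w \<in> carrier (direct_sum m (X t))" for t h w
    proof -
      have e: "\<psi> t w \<in> carrier (tensor_space U W)"
        using linear_onD(1)[OF twisted_isoD(1)[OF \<psi>[OF that(1)]] w] by simp
      show ?thesis
        using twisted_isoD(3)[OF \<psi>[OF that(1)] h w]
        by (simp add: x_at_grp[OF U W k(1) n that(1) n e h] group_tensor_act[OF finite_G U W h e])
    qed
  qed simp_all
qed

text \<open>The roles of the two summands of \<open>\<Delta>(y)\<close> are exchanged:
  \<open>1 \<otimes> y\<close> raises the row and \<open>y \<otimes> g\<close> stays in it. The
  latter applies \<open>g\<close> to \<open>x\<^sup>t U\<close>, so \<open>L t\<close> is
  \<chi>(g)^(-t) times \<open>1 \<otimes> g\<close>, invertible with inverse \<chi>(g)^t times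
  \<open>1 \<otimes> g\<^sup>-\<^sup>1\<close>.\<close>

lemma tensor_P_M_iso:
  assumes \<psi>: "\<And>t. t < k \<Longrightarrow> twisted_iso G (\<lambda>h. inverse (\<chi> h) ^ t) (direct_sum m (X t))
      (tensor_module (group_alg G) W U) (\<psi> t)"
  shows "module_iso (hopf_alg G \<chi> g n)
    (direct_sum k (\<lambda>t. direct_sum m (\<lambda>r. x_module G \<chi> n (X t r) n (l t r - 1))))
    (tensor_module (hopf_alg G \<chi> g n) (x_module G \<chi> n W n (\<mu> - 1)) (x_module G \<chi> n U k 0))"
proof -
  let ?M = "x_module G \<chi> n U k 0" and ?P = "x_module G \<chi> n W n (\<mu> - 1)"
  let ?T = "tensor_module (hopf_alg G \<chi> g n) ?P ?M" and ?E = "tensor_module (group_alg G) W U"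
  have n: "0 < n" using n_ge_2 by simp
  note vU = group_repD(1)[OF U] and vW = group_repD(1)[OF W]
  note vM = is_vsp_x_module[OF vU, of k 0] and vP = is_vsp_x_module[OF vW, of n "\<mu> - 1"]
  note E = is_vsp_tensor_space[OF vW vU]
  note M = hopf_rep_x_module[OF U gU k, of 0] and P = hopf_rep_x_module[OF W gW n order.refl, of "\<mu> - 1"]
  note T = hopf_rep_tensor[OF P M]
  note coord = linear_on_coord[OF W U n k(1)]
  let ?\<iota> = "\<lambda>t. tmap ?P ?M (x_at 0) (x_at t)"
  let ?L = "\<lambda>t e. fscale (inverse (\<chi> g) ^ t) (tmap W U (\<lambda>v. v) (act U (basis_vec g)) e)"
  have lin: "linear_on (tensor_space W U) (tensor_space W U) (tmap W U (\<lambda>v. v) (act U (basis_vec h)))"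
    if "h \<in> carrier G" for h
    by (rule linear_on_tmap[OF vW vU vW vU linear_on_id group_repD(2)[OF U that]])
  have linL: "linear_on (tensor_space W U) (tensor_space W U) (?L t)" for t
    using linear_on_scl[OF E lin[OF g_in_G]] by simp
  show ?thesis
  \<comment> \<open>Rows are still indexed by the degree in \<open>M\<close>, which is now the
    second factor, so the coordinates enter transposed.\<close>
  proof (rule triangular_iso[where N = ?T and E = ?E and W = X and l = l and \<psi> = \<psi> and L = ?L
        and \<pi> = "\<lambda>t s. coord W U s t" and \<iota> = ?\<iota>, OF T is_vsp_tensor_module[OF vW vU] X gX,
        unfolded linear_on_tensor_module tensor_module_simps(1)])
    show "linear_on (tensor_space ?P ?M) (tensor_space W U) (coord W U s t)" for t s by (rule coord)
    show "linear_on (tensor_space W U) (tensor_space ?P ?M) (?\<iota> t)" if "t < k" for t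
      by (rule linear_on_tmap[OF vW vU vP vM linear_on_x_at[OF vW n] linear_on_x_at[OF vU that]])
    show "coord W U s t' (?\<iota> t e) = (if t' = t \<and> s = 0 then e else 0)"
      if "t < k" "e \<in> carrier (tensor_space W U)" for t t' s e
      using coord_x_at[OF W U n k(1) n that] by auto
    show "x = 0" if "x \<in> carrier (tensor_space ?P ?M)" "\<And>t s. t < k \<Longrightarrow> s < n \<Longrightarrow> coord W U s t x = 0" for x
      by (rule coord_inj[OF W U n k(1) that(1)]) (rule that(2))
    show "coord W U s t (tensor_y ?P ?M (x_shift W n (\<mu> - 1)) (x_shift U k 0) (x_grp \<chi> U) x) =
        (if s = 0 then 0 else ?L t (coord W U (s - 1) t x))"
      if "t < k" "s < n" and x: "x \<in> carrier (tensor_space ?P ?M)"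
        and low: "\<And>t' s. t' < t \<Longrightarrow> s < n \<Longrightarrow> coord W U s t' x = 0" and z: "0 < s \<or> coord W U (n - 1) t x = 0"
      for t s x
    proof -
      have "(if t = 0 then fscale 0 (coord W U s (k - 1) x) else coord W U s (t - 1) x) = 0"
        using low[of "t - 1" s] that(2) by (simp add: fscale_def fun_eq_iff)
      moreover have "?L t 0 = 0" by (rule linear_on_0[OF E E linL])
      moreover have "fscale (\<mu> - 1) (0 :: 'w \<times> 'u \<Rightarrow> 'k) = 0" by (simp add: fscale_def fun_eq_iff)
      ultimately show ?thesis
        using z unfolding coord_y[OF W U n k(1) that(2,1) x] by (cases "s = 0") simp_all
    qed
    show "linear_on (tensor_space W U) (tensor_space W U) (?L t)" for t by (rule linL)
    show "bij_betw (?L t) (carrier (tensor_space W U)) (carrier (tensor_space W U))" for t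
    proof -
      let ?F = "\<lambda>h. tmap W U (\<lambda>v. v) (act U (basis_vec h))"
      have c: "\<chi> g \<noteq> 0" by (rule char_nonzero[OF g_in_G])
      have inv: "?F h (?F h' e) = e" if h: "h \<in> carrier G" "h' \<in> carrier G" "h \<otimes> h' = \<one>"
        and e: "e \<in> carrier (tensor_space W U)" for h h' e
      proof -
        have "?F h (?F h' e) = tmap W U (\<lambda>v. v) (\<lambda>v. act U (basis_vec h) (act U (basis_vec h') v)) e"
          by (rule tmap_comp[OF vW vU vW vU vW vU linear_on_id group_repD(2)[OF U h(2)] linear_on_id group_repD(2)[OF U h(1)] e])
        also have "\<dots> = tmap W U (\<lambda>v. v) (\<lambda>v. v) e"
          by (rule tmap_cong[OF vW vU vW vU linear_on_id linear_on_comp[OF group_repD(2)[OF U h(2)] group_repD(2)[OF U h(1)]] _ _ e])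
            (use h in \<open>simp_all add: group_repD(3)[OF U] flip: group_repD(4)[OF U]\<close>)
        finally show ?thesis by (simp add: tmap_id[OF vW vU e])
      qed
      have ig: "inv g \<in> carrier G" using g_in_G by simp
      note Fin = linear_onD(1)[OF lin] and Fs = linear_onD(3)[OF lin, unfolded scl_tensor_space]
        and sc = vsp_scale[OF E, unfolded scl_tensor_space]
      have ff: "fscale a (fscale b u) = fscale (a * b) u" "fscale 1 u = u" for a b :: 'k and u :: "'w \<times> 'u \<Rightarrow> 'k"
        by (simp_all add: fscale_def fun_eq_iff)
      have cc: "\<chi> g ^ t * inverse (\<chi> g) ^ t = 1" "inverse (\<chi> g) ^ t * \<chi> g ^ t = 1"
        using c by (simp_all flip: power_mult_distrib)
      show ?thesis
        by (rule bij_betw_inverse_pair[where e = "\<lambda>e. fscale (\<chi> g ^ t) (?F (inv g) e)"])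
          (simp_all add: Fin Fs sc ig g_in_G ff cc inv)
    qed
    show "linear_on (direct_sum m (X t)) (tensor_space W U) (\<psi> t)"
      "bij_betw (\<psi> t) (carrier (direct_sum m (X t))) (carrier (tensor_space W U))" if "t < k" for t
      using twisted_isoD(1,2)[OF \<psi>[OF that]] by (simp_all add: linear_on_tensor_module)
    show "tmap ?P ?M (x_grp \<chi> W h) (x_grp \<chi> U h) (?\<iota> t (\<psi> t w)) = ?\<iota> t (\<psi> t (act (direct_sum m (X t)) (basis_vec h) w))"
      if "t < k" and h: "h \<in> carrier G" and w: "w \<in> carrier (direct_sum m (X t))" for t h w
    proof -
      have e: "\<psi> t w \<in> carrier (tensor_space W U)"
        using linear_onD(1)[OF twisted_isoD(1)[OF \<psi>[OF that(1)]] w] by simp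
      show ?thesis
        using twisted_isoD(3)[OF \<psi>[OF that(1)] h w]
        by (simp add: x_at_grp[OF W U n k(1) n that(1) e h] group_tensor_act[OF finite_G W U h e])
    qed
  qed simp_all
qed

end

text \<open>One decomposition of \<open>E\<close> serves all rows: replacing each summand by its
  image under \<tau>^t twists the whole sum by \<chi>^(-t).\<close>

lemma tensor_twisted_iso:
  assumes V: "\<And>s. group_rep G (V s)" and E: "group_rep G E"
    and tau: "\<And>s. module_iso (group_alg G) (tensor_module (group_alg G) (char_inv_module G \<chi>) (V s)) (V (\<tau> s))"
    and iso: "module_iso (group_alg G) E (direct_sum m (\<lambda>r. V (f r)))"
  shows "\<exists>\<psi>. \<forall>t. twisted_iso G (\<lambda>h. inverse (\<chi> h) ^ t) (direct_sum m (\<lambda>r. V ((\<tau> ^^ t) (f r)))) E (\<psi> t)"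
proof -
  have D: "group_rep G (direct_sum m (\<lambda>r. V (f r)))" by (rule group_rep_direct_sum[OF V])
  obtain e where e: "twisted_iso G (\<lambda>h. 1) (direct_sum m (\<lambda>r. V (f r))) E e"
    using module_iso_twisted_iso[OF E D iso] by blast
  have "\<exists>\<psi>. twisted_iso G (\<lambda>h. inverse (\<chi> h) ^ t) (direct_sum m (\<lambda>r. V ((\<tau> ^^ t) (f r)))) E \<psi>" for t
  proof -
    have "\<forall>r. \<exists>\<phi>. twisted_iso G (\<lambda>h. inverse (\<chi> h) ^ t) (V ((\<tau> ^^ t) (f r))) (V (f r)) \<phi>"
      using tau_power_twisted_iso[where V = V, OF V tau] by blast
    then obtain \<phi> where \<phi>: "\<And>r. twisted_iso G (\<lambda>h. inverse (\<chi> h) ^ t) (V ((\<tau> ^^ t) (f r))) (V (f r)) (\<phi> r)"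
      by metis
    show ?thesis
      using twisted_iso_comp[OF D E twisted_iso_direct_sum[OF V V \<phi>] e] by auto
  qed
  then show ?thesis by metis
qed

text \<open>Both tensor products are matched with the same sum of modules \<open>P\<close>, and the
  isomorphism between them is obtained by passing through it.\<close>

lemma tensor_isos:
  assumes V: "\<And>s. group_rep G (V s)"
    and lam: "\<And>s v. v \<in> carrier (V s) \<Longrightarrow> act (V s) (basis_vec (g [^] n)) v = scl (V s) (lam s) v"
    and tau: "\<And>s. module_iso (group_alg G) (tensor_module (group_alg G) (char_inv_module G \<chi>) (V s)) (V (\<tau> s))"
    and i: "lam i = 1"
    and iso: "module_iso (group_alg G) (tensor_module (group_alg G) (V i) (V j)) (direct_sum m (\<lambda>r. V (f r)))"
    and k: "1 \<le> k" "k \<le> n"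
  defines "M \<equiv> M_module G \<chi> n (V i) k" and "P \<equiv> \<lambda>s. P_module G \<chi> n (V s) (lam s)"
  shows "module_iso (hopf_alg G \<chi> g n) (tensor_module (hopf_alg G \<chi> g n) M (P j)) (tensor_module (hopf_alg G \<chi> g n) (P j) M)"
    and "module_iso (hopf_alg G \<chi> g n) (tensor_module (hopf_alg G \<chi> g n) (P j) M)
      (direct_sum k (\<lambda>t. direct_sum m (\<lambda>r. P ((\<tau> ^^ t) (f r)))))"
proof -
  let ?H = "hopf_alg G \<chi> g n"
  let ?X = "\<lambda>t r. V ((\<tau> ^^ t) (f r))" and ?l = "\<lambda>t r. lam ((\<tau> ^^ t) (f r))"
  let ?D = "direct_sum k (\<lambda>t. direct_sum m (\<lambda>r. x_module G \<chi> n (?X t r) n (?l t r - 1)))"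
  have n: "0 < n" using n_ge_2 by simp
  have k0: "0 < k" using k by simp
  have li: "act (V i) (basis_vec (g [^] n)) v = scl (V i) 1 v" if "v \<in> carrier (V i)" for v
    using lam[OF that] i by simp
  note VW = group_rep_tensor[OF finite_G V V]
  obtain \<psi> where \<psi>: "\<And>t. twisted_iso G (\<lambda>h. inverse (\<chi> h) ^ t) (direct_sum m (?X t)) (tensor_module (group_alg G) (V i) (V j)) (\<psi> t)"
    using tensor_twisted_iso[where V = V, OF V VW tau iso] by blast
  have "module_iso (group_alg G) (tensor_module (group_alg G) (V j) (V i)) (direct_sum m (\<lambda>r. V (f r)))"
    by (rule module_iso_trans[OF module_iso_tensor_flip[OF finite_G V V] iso])
  then obtain \<psi>' where \<psi>': "\<And>t. twisted_iso G (\<lambda>h. inverse (\<chi> h) ^ t) (direct_sum m (?X t)) (tensor_module (group_alg G) (V j) (V i)) (\<psi>' t)"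
    using tensor_twisted_iso[where V = V, OF V VW tau] by blast
  have MP: "module_iso ?H ?D (tensor_module ?H M (P j))"
    unfolding M_def P_def M_module_def P_module_def
    by (rule tensor_M_P_iso[OF V V V li lam lam k0 k(2) \<psi>])
  have PM: "module_iso ?H ?D (tensor_module ?H (P j) M)"
    unfolding M_def P_def M_module_def P_module_def
    by (rule tensor_P_M_iso[OF V V V li lam lam k0 k(2) \<psi>'])
  have xm: "hopf_acts (x_module G \<chi> n (?X t r) n (?l t r - 1)) (x_shift (?X t r) n (?l t r - 1)) (x_grp \<chi> (?X t r))"
    for t r by (rule hopf_acts_x_module[OF V n])
  \<comment> \<open>Both isomorphisms start at \<open>?D\<close>; reversing them requires that
    \<open>?D\<close> is closed under the action, which \<open>hopf_acts\<close> provides.\<close>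
  have "\<exists>Y \<rho>. hopf_acts ?D Y \<rho>"
    by (intro exI) (rule hopf_acts_direct_sum[OF is_vsp_direct_sum[OF hopf_actsD(1)[OF xm]]
        hopf_acts_direct_sum[OF hopf_actsD(1)[OF xm] xm]])
  then obtain Y \<rho> where D: "hopf_acts ?D Y \<rho>" by blast
  note sym = module_iso_sym[OF hopf_actsD(1)[OF D] hopf_acts_closed[OF D]]
  show "module_iso ?H (tensor_module ?H M (P j)) (tensor_module ?H (P j) M)"
    by (rule module_iso_trans[OF sym[OF _ _ MP] PM])
  show "module_iso ?H (tensor_module ?H (P j) M) (direct_sum k (\<lambda>t. direct_sum m (\<lambda>r. P ((\<tau> ^^ t) (f r)))))"
    using sym[OF _ _ PM] by (simp add: P_def P_module_def)
qed

end

section \<open>Complete reducibility\<close>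

text \<open>A basis of \<open>A\<close> stays independent when \<open>b\<close> is added to it. The
  finite \<open>T\<close> keeps all bases finite, so that \<open>card\<close> measures them; the
  result makes the induction on \<open>dim\<close> below work.\<close>

lemma (in vector_space) dim_less_finite_span:
  assumes T: "finite T" "B \<subseteq> span T" and A: "subspace A" "A \<subseteq> B" and b: "b \<in> B" "b \<notin> A"
  shows "dim A < dim B"
proof -
  obtain a where a: "a \<subseteq> A" "independent a" "A \<subseteq> span a" "card a = dim A" using basis_exists[of A] by blast
  obtain c where c: "c \<subseteq> B" "independent c" "B \<subseteq> span c" "card c = dim B" using basis_exists[of B] by blast
  have fin: "finite c" "finite a"
    using independent_span_bound[OF T(1) c(2)] independent_span_bound[OF T(1) a(2)] a(1) c(1) A(2) T(2) by blast+
  have "span a \<subseteq> A" using a(1) A(1) by (rule span_minimal)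
  then have "b \<notin> span a" using b(2) by blast
  then have "independent (insert b a)" using a(2) by (rule independent_insertI)
  moreover have "insert b a \<subseteq> span c" using b(1) a(1) A(2) c(3) by blast
  ultimately have "card (insert b a) \<le> card c" using independent_span_bound[OF fin(1)] by blast
  moreover have "b \<notin> a" using b(2) a(1) by blast
  ultimately show ?thesis using fin a(4) c(4) by simp
qed

text \<open>Each axiom of \<open>W\<close> is checked after applying the injective \<open>e\<close>,
  where it becomes an axiom of \<open>Z\<close>, and submodules of \<open>W\<close> are judged by
  their images. It serves to move a simple module to another ambient type.\<close>

lemma simple_module_transport:
  assumes A: "is_alg A" and Z: "simple_module A Z" and W: "is_vsp W" "fin_dim W"
    and e: "linear_on W Z e" "bij_betw e (carrier W) (carrier Z)"
    and act: "\<And>a w. a \<in> carrier A \<Longrightarrow> w \<in> carrier W \<Longrightarrow> act W a w \<in> carrier W \<and> e (act W a w) = act Z a (e w)"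
  shows "simple_module A W"
proof -
  have lZ: "left_module A Z" using Z by (simp add: simple_module_def)
  have vZ: "is_vsp Z" using lZ by (simp add: left_module_def)
  note lin = linear_onD[OF e(1)] and W' = vsp_closed[OF W(1)]
  have inj: "x = y" if "e x = e y" "x \<in> carrier W" "y \<in> carrier W" for x y
    using e(2) that by (auto simp: bij_betw_def inj_on_def)
  have A': "aone A \<in> carrier A" "\<And>a b. a \<in> carrier A \<Longrightarrow> b \<in> carrier A \<Longrightarrow> amul A a b \<in> carrier A"
    "\<And>a b. a \<in> carrier A \<Longrightarrow> b \<in> carrier A \<Longrightarrow> a + b \<in> carrier A"
    "\<And>a r. a \<in> carrier A \<Longrightarrow> scl A r a \<in> carrier A"
    using A by (auto simp: is_alg_def intro: vsp_add vsp_scale)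
  have Z1: "act Z (aone A) z = z" if "z \<in> carrier Z" for z
    using lZ that by (simp add: left_module_def)
  have Z2: "act Z (amul A a b) z = act Z a (act Z b z)" "act Z (a + b) z = act Z a z + act Z b z"
    if "a \<in> carrier A" "b \<in> carrier A" "z \<in> carrier Z" for a b z
    using lZ that by (auto simp: left_module_def)
  have Z3: "act Z a (z + z') = act Z a z + act Z a z'"
    if "a \<in> carrier A" "z \<in> carrier Z" "z' \<in> carrier Z" for a z z'
    using lZ that by (auto simp: left_module_def)
  have Z4: "act Z (scl A r a) z = scl Z r (act Z a z)" "act Z a (scl Z r z) = scl Z r (act Z a z)"
    if "a \<in> carrier A" "z \<in> carrier Z" for r a z
    using lZ that by (auto simp: left_module_def)
  have "left_module A W"
    unfolding left_module_def
  proof (intro conjI ballI allI)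
    fix x assume x: "x \<in> carrier W"
    show "act W (aone A) x = x" by (rule inj) (simp_all add: act A' x lin Z1)
  next
    fix a b x assume ab: "a \<in> carrier A" "b \<in> carrier A" and x: "x \<in> carrier W"
    show "act W (amul A a b) x = act W a (act W b x)" "act W (a + b) x = act W a x + act W b x"
      by (rule inj; simp add: act A' ab x lin Z2 W')+
  next
    fix a x y assume "a \<in> carrier A" "x \<in> carrier W" "y \<in> carrier W"
    then show "act W a (x + y) = act W a x + act W a y"
      by (intro inj) (simp_all add: act lin Z3 W')
  next
    fix r a x assume "a \<in> carrier A" "x \<in> carrier W"
    then show "act W (scl A r a) x = scl W r (act W a x)" "act W a (scl W r x) = scl W r (act W a x)"
      by (intro inj; simp add: act A' lin Z4 W')+
  qed (use W act in auto)
  moreover have "carrier W \<noteq> {0}"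
  proof
    assume "carrier W = {0}"
    then have "carrier Z = {0}" using e(2) linear_on_0[OF W(1) vZ e(1)] by (auto simp: bij_betw_def)
    then show False using Z by (simp add: simple_module_def)
  qed
  moreover have "U = {0} \<or> U = carrier W"
    if U: "module.subspace (scl W) U" "U \<subseteq> carrier W" "\<forall>a\<in>carrier A. \<forall>u\<in>U. act W a u \<in> U" for U
  proof -
    interpret w: vector_space "scl W" using W(1) by (simp add: is_vsp_def)
    interpret z: vector_space "scl Z" using vZ by (simp add: is_vsp_def)
    have UW: "u \<in> carrier W" if "u \<in> U" for u using that U(2) by blast
    have "z.subspace (e ` U)"
      unfolding z.subspace_def
    proof (intro conjI ballI allI)
      show "0 \<in> e ` U"
        using w.subspace_0[OF U(1)] linear_on_0[OF W(1) vZ e(1)] by (metis imageI)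
    next
      fix x y assume "x \<in> e ` U" "y \<in> e ` U"
      then obtain u v where "u \<in> U" "v \<in> U" "x = e u" "y = e v" by blast
      then have "x + y = e (u + v)" "u + v \<in> U"
        using lin(2) UW w.subspace_add[OF U(1)] by auto
      then show "x + y \<in> e ` U" by blast
    next
      fix r x assume "x \<in> e ` U"
      then obtain u where "u \<in> U" "x = e u" by blast
      then have "scl Z r x = e (scl W r u)" "scl W r u \<in> U"
        using lin(3) UW w.subspace_scale[OF U(1)] by auto
      then show "scl Z r x \<in> e ` U" by blast
    qed
    moreover have "e ` U \<subseteq> carrier Z" using UW lin(1) by blast
    moreover have "act Z a x \<in> e ` U" if "a \<in> carrier A" "x \<in> e ` U" for a x
    proof -
      obtain u where u: "u \<in> U" "x = e u" using \<open>x \<in> e ` U\<close> by blast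
      then have "act Z a x = e (act W a u)" using act[OF that(1) UW[OF u(1)]] by simp
      then show ?thesis using U(3) that(1) u(1) by blast
    qed
    ultimately have "e ` U = {0} \<or> e ` U = carrier Z"
      using Z unfolding simple_module_def by blast
    then show ?thesis
    proof
      assume "e ` U = {0}"
      then have "u = 0" if "u \<in> U" for u
        using inj[of u 0] UW[OF that] that linear_on_0[OF W(1) vZ e(1)] vsp_zero[OF W(1)] by auto
      then show ?thesis using w.subspace_0[OF U(1)] by blast
    next
      assume "e ` U = carrier Z"
      then have "w \<in> U" if "w \<in> carrier W" for w
        using inj[OF _ that] lin(1)[OF that] UW by (metis imageE)
      then show ?thesis using U(2) by blast
    qed
  qed
  ultimately show ?thesis unfolding simple_module_def by blast
qed

text \<open>Completeness is stated only for modules on subspaces of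
  \<open>nat \<Rightarrow> 'k\<close>. A simple module is finite-dimensional, so coordinates with
  respect to a finite basis give it a copy there.\<close>

lemma complete_simples_iso:
  fixes Z :: "('k::field, 'g \<Rightarrow> 'k, 'a::ab_group_add) lmod"
    and V :: "'i \<Rightarrow> ('k, 'g \<Rightarrow> 'k, 'v::ab_group_add) lmod"
  assumes A: "is_alg (group_alg G :: ('k, 'g \<Rightarrow> 'k) coalg)" and V: "complete_simples G V"
    and Z: "simple_module (group_alg G) Z"
  shows "\<exists>s. module_iso (group_alg G) (V s) Z"
proof -
  have lZ: "left_module (group_alg G) Z" using Z by (simp add: simple_module_def)
  then have vZ: "is_vsp Z" "fin_dim Z" by (simp_all add: left_module_def)
  interpret z: vector_space "scl Z" using vZ by (simp add: is_vsp_def)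
  have sub: "z.subspace (carrier Z)" using vZ by (simp add: is_vsp_def)
  obtain T where T: "finite T" "z.span T = carrier Z" using vZ(2) by (auto simp: fin_dim_def)
  obtain B where B: "B \<subseteq> carrier Z" "z.independent B" "carrier Z \<subseteq> z.span B"
    using z.maximal_independent_subset[of "carrier Z"] by blast
  have fB: "finite B" using z.independent_span_bound[OF T(1) B(2)] B(1) T(2) by blast
  define d where "d = card B"
  obtain b where b: "bij_betw b {..<d} B"
    using ex_bij_betw_nat_finite[OF fB] by (auto simp: d_def atLeast0LessThan)
  define e where "e w = (\<Sum>i<d. scl Z (w i) (b i))" for w :: "nat \<Rightarrow> 'k"
  define f where "f x = (\<lambda>i. if i < d then z.representation B x (b i) else 0)" for x
  \<comment> \<open>Coordinate vectors of length \<open>d\<close>, padded with zeros. The action is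
    carried over from \<open>Z\<close>: \<open>e\<close> passes from coordinates to vectors and
    \<open>f\<close> back.\<close>
  define W :: "('k, 'g \<Rightarrow> 'k, nat \<Rightarrow> 'k) lmod"
    where "W = \<lparr>carrier = {w. \<forall>i\<ge>d. w i = 0}, scl = fscale, act = \<lambda>a w. f (act Z a (e w))\<rparr>"
  have W [simp]: "carrier W = {w. \<forall>i\<ge>d. w i = 0}" "scl W = fscale" "act W a w = f (act Z a (e w))" for a w
    by (simp_all add: W_def)
  have bB: "b i \<in> B" if "i < d" for i using b that by (auto simp: bij_betw_def)
  interpret w: vector_space "fscale :: 'k \<Rightarrow> (nat \<Rightarrow> 'k) \<Rightarrow> nat \<Rightarrow> 'k" by (rule fscale_vector_space)
  have subW: "w.subspace (carrier W)" by (auto simp: w.subspace_def fscale_def)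
  have vW: "is_vsp W"
    unfolding is_vsp_def using subW w.vector_space_axioms by simp
  have "w.span (basis_vec ` {..<d}) = carrier W"
  proof
    have "basis_vec ` {..<d} \<subseteq> carrier W" by (auto simp: basis_vec_def)
    then show "w.span (basis_vec ` {..<d}) \<subseteq> carrier W" using subW by (rule w.span_minimal)
    show "carrier W \<subseteq> w.span (basis_vec ` {..<d})"
    proof
      fix x :: "nat \<Rightarrow> 'k" assume "x \<in> carrier W"
      then have "x = (\<Sum>p<d. fscale (x p) (basis_vec p))" by (intro finite_support_expand) auto
      also have "\<dots> \<in> w.span (basis_vec ` {..<d})"
        by (intro w.span_sum w.span_scale w.span_base) auto
      finally show "x \<in> w.span (basis_vec ` {..<d})" .
    qed
  qed
  moreover have "basis_vec ` {..<d} \<subseteq> carrier W" by (auto simp: basis_vec_def)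
  ultimately have fdW: "fin_dim W"
    unfolding fin_dim_def W(2) by (intro exI[of _ "basis_vec ` {..<d}"]) auto
  have lin: "linear_on W Z e"
    using B(1) bB
    by (intro linear_onI) (auto simp: e_def fscale_def z.scale_left_distrib sum.distrib z.scale_sum_right
        intro!: z.subspace_sum[OF sub] z.subspace_scale[OF sub])
  have fW: "f x \<in> carrier W" for x by (auto simp: f_def)
  have ef: "e (f x) = x" if x: "x \<in> carrier Z" for x
  proof -
    have "e (f x) = (\<Sum>i<d. scl Z (z.representation B x (b i)) (b i))"
      by (simp add: e_def f_def)
    also have "\<dots> = (\<Sum>v\<in>B. scl Z (z.representation B x v) v)"
      by (rule sum.reindex_bij_betw[OF b])
    also have "\<dots> = x"
      using z.sum_representation_eq[OF B(2) _ fB subset_refl] x B(3) by blast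
    finally show ?thesis .
  qed
  have fe: "f (e w) = w" if w: "w \<in> carrier W" for w
  proof
    fix j
    show "f (e w) j = w j"
    proof (cases "j < d")
      case False
      then show ?thesis using w by (simp add: f_def)
    next
      case True
      have rb: "z.representation B (b i) (b j) = (if i = j then 1 else 0)" if "i < d" for i
        using z.representation_basis[OF B(2) bB[OF that]] b that True
        by (auto simp: bij_betw_def inj_on_def)
      have sp: "b i \<in> z.span B" if "i < d" for i using bB[OF that] by (rule z.span_base)
      have "z.representation B (e w) (b j) = (\<Sum>i<d. z.representation B (scl Z (w i) (b i)) (b j))"
        unfolding e_def using z.representation_sum[OF B(2), of "{..<d}" "\<lambda>i. scl Z (w i) (b i)"] sp
        by (simp add: z.span_scale)
      also have "\<dots> = (\<Sum>i<d. w i * (if i = j then 1 else 0))"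
        by (intro sum.cong refl) (simp add: z.representation_scale[OF B(2) sp] rb)
      also have "\<dots> = (\<Sum>i<d. if i = j then w j else 0)" by (intro sum.cong) auto
      also have "\<dots> = w j" using True by simp
      finally show ?thesis using True by (simp add: f_def)
    qed
  qed
  have bij: "bij_betw e (carrier W) (carrier Z)"
    by (rule bij_betw_inverse_pair[where e = f]) (use linear_onD(1)[OF lin] fW ef fe in blast)+
  have actW: "act W a w \<in> carrier W \<and> e (act W a w) = act Z a (e w)"
    if "a \<in> carrier (group_alg G)" "w \<in> carrier W" for a w
  proof -
    have "act Z a (e w) \<in> carrier Z"
      using lZ that linear_onD(1)[OF lin] by (simp add: left_module_def)
    then show ?thesis using fW ef by simp
  qed
  have sW: "simple_module (group_alg G) W"
    by (rule simple_module_transport[OF A Z vW fdW lin bij actW])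
  then obtain s where s: "module_iso (group_alg G) W (V s)"
    using V unfolding complete_simples_def by blast
  have "module_iso (group_alg G) W Z"
    unfolding module_iso_def using bij linear_onD(2,3)[OF lin] actW by blast
  moreover have "act W a x \<in> carrier W" if "a \<in> carrier (group_alg G)" "x \<in> carrier W" for a x
    using actW[OF that] by blast
  then have "module_iso (group_alg G) (V s) W"
    using module_iso_sym[OF vW _ s] by blast
  ultimately show ?thesis using module_iso_trans by blast
qed

context group
begin

lemma is_alg_group_alg:
  "finite (carrier G) \<Longrightarrow> is_alg (group_alg G :: ('k::field, 'a \<Rightarrow> 'k) coalg)"
  using is_alg_group_alg_alg by (simp add: is_alg_def is_vsp_def)

lemma group_rep_left_module:
  fixes N :: "('k::field, 'a \<Rightarrow> 'k, 'm::ab_group_add) lmod"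
  assumes fin: "finite (carrier G)" and N: "group_rep G N" and fd: "fin_dim N"
  shows "left_module (group_alg G) N"
proof -
  note V = group_repD(1)[OF N]
  have A: "is_vsp (group_alg_alg G :: ('k, 'a \<Rightarrow> 'k) alg)" by (rule is_vsp_group_alg[OF fin])
  have la: "linear_on N N (act N a)" if "a \<in> carrier (group_alg_alg G)" for a
    using group_rep_lin_act[OF A N] that by (simp add: lin_act_def)
  have lx: "linear_on (group_alg_alg G) N (\<lambda>a. act N a x)" if "x \<in> carrier N" for x
    using group_rep_lin_act[OF A N] that by (simp add: lin_act_def)
  have "act N (amul (group_alg_alg G) a b) x = act N a (act N b x)"
    if a: "a \<in> carrier (group_alg_alg G)" and b: "b \<in> carrier (group_alg_alg G)" and x: "x \<in> carrier N" for a b x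
  proof -
    have in_N: "act N (basis_vec h) y \<in> carrier N" if "h \<in> carrier G" "y \<in> carrier N" for h y
      using linear_onD(1)[OF group_repD(2)[OF N that(1)] that(2)] .
    have "act N (amul (group_alg_alg G) a b) x =
        act N (\<Sum>p\<in>carrier G \<times> carrier G. fscale (a (fst p) * b (snd p)) (basis_vec (fst p \<otimes> snd p))) x"
      by (simp add: group_alg_alg_def sum.cartesian_product case_prod_beta)
    also have "\<dots> = (\<Sum>p\<in>carrier G \<times> carrier G. scl N (a (fst p) * b (snd p)) (act N (basis_vec (fst p \<otimes> snd p)) x))"
      using linear_on_sum[OF A V lx[OF x], of "carrier G \<times> carrier G" "\<lambda>p. basis_vec (fst p \<otimes> snd p)"
          "\<lambda>p. a (fst p) * b (snd p)"] fin by auto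
    also have "\<dots> = (\<Sum>h\<in>carrier G. \<Sum>h'\<in>carrier G. scl N (a h * b h') (act N (basis_vec (h \<otimes> h')) x))"
      by (simp add: sum.cartesian_product case_prod_beta)
    also have "\<dots> = (\<Sum>h\<in>carrier G. scl N (a h) (act N (basis_vec h) (act N b x)))"
    proof (rule sum.cong[OF refl])
      fix h assume h: "h \<in> carrier G"
      have "act N (basis_vec h) (act N b x) = (\<Sum>h'\<in>carrier G. act N (basis_vec h) (scl N (b h') (act N (basis_vec h') x)))"
        unfolding group_repD(5)[OF N b[folded group_alg_simps(1)] x]
        by (rule linear_on_setsum[OF V V group_repD(2)[OF N h]]) (intro vsp_scale[OF V] in_N x)
      also have "\<dots> = (\<Sum>h'\<in>carrier G. scl N (b h') (act N (basis_vec (h \<otimes> h')) x))"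
        by (intro sum.cong refl)
          (simp add: linear_onD(3)[OF group_repD(2)[OF N h]] in_N x group_repD(4)[OF N h])
      finally show "(\<Sum>h'\<in>carrier G. scl N (a h * b h') (act N (basis_vec (h \<otimes> h')) x)) =
          scl N (a h) (act N (basis_vec h) (act N b x))"
        by (simp add: vsp_scl_sum[OF V] vsp_scl[OF V])
    qed
    also have "\<dots> = act N a (act N b x)"
      by (rule group_repD(5)[OF N a[folded group_alg_simps(1)] linear_onD(1)[OF la[OF b] x], symmetric])
    finally show ?thesis .
  qed
  moreover have "act N (aone (group_alg_alg G)) x = x" if "x \<in> carrier N" for x
    using group_repD(3)[OF N that] by (simp add: group_alg_alg_def)
  ultimately show ?thesis
    unfolding left_module_def group_alg_simps
    using V fd linear_onD[OF la] linear_onD[OF lx, unfolded group_alg_simps] by (intro conjI ballI allI) simp_all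
qed

text \<open>Averaging over the group makes any linear projection onto \<open>S\<close> equivariant.
  It still fixes \<open>S\<close> after division by the order of the group, which is nonzero in
  characteristic zero.\<close>

lemma maschke_projection:
  fixes N :: "('k::field_char_0, 'a \<Rightarrow> 'k, 'm::ab_group_add) lmod"
  assumes fin: "finite (carrier G)" and N: "group_rep G N"
    and S: "module.subspace (scl N) S" "S \<subseteq> carrier N"
      "\<And>h u. h \<in> carrier G \<Longrightarrow> u \<in> S \<Longrightarrow> act N (basis_vec h) u \<in> S"
  shows "\<exists>P. linear_on N N P \<and> (\<forall>x\<in>carrier N. P x \<in> S) \<and> (\<forall>x\<in>S. P x = x) \<and>
    (\<forall>h\<in>carrier G. \<forall>x\<in>carrier N. P (act N (basis_vec h) x) = act N (basis_vec h) (P x))"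
proof -
  note V = group_repD(1)[OF N]
  interpret vector_space "scl N" using V by (simp add: is_vsp_def)
  interpret p: vector_space_pair "scl N" "scl N" ..
  have "Vector_Spaces.linear (scl N) (scl N) (\<lambda>x. x)"
    by (rule linear_ident)
  \<comment> \<open>A left inverse, on \<open>S\<close>, of the identity with range in
    \<open>S\<close> is a linear projection of the whole ambient type onto \<open>S\<close>.\<close>
  from p.linear_exists_left_inverse_on[OF this S(1)]
  obtain p where p: "range p \<subseteq> S" "Vector_Spaces.linear (scl N) (scl N) p" "\<And>v. v \<in> S \<Longrightarrow> p v = v"
    by (auto simp: inj_on_def)
  let ?\<rho> = "\<lambda>h. act N (basis_vec h)"
  define c where "c = (of_nat (card (carrier G)) :: 'k)"
  have c: "c \<noteq> 0" using fin one_closed by (auto simp: c_def card_eq_0_iff simp del: one_closed)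
  define P where "P x = scl N (inverse c) (\<Sum>h\<in>carrier G. ?\<rho> h (p (?\<rho> (inv h) x)))" for x
  have pN: "p x \<in> S" "p x \<in> carrier N" for x using p(1) S(2) by auto
  have linp: "linear_on N N p"
    using pN by (intro linear_onI) (simp_all add: p.linear_add[OF p(2)] p.linear_scale[OF p(2)])
  have lin: "linear_on N N P"
    unfolding P_def
    by (intro linear_on_scl linear_on_sum_fun V)
      (rule linear_on_comp[OF linear_on_comp[OF group_repD(2)[OF N] linp] group_repD(2)[OF N]]; simp)
  have PS: "P x \<in> S" for x
    unfolding P_def by (intro subspace_scale[OF S(1)] subspace_sum[OF S(1)] S(3) pN)
  have PP: "P x = x" if x: "x \<in> S" for x
  proof -
    have xN: "x \<in> carrier N" using x S(2) by blast
    have "?\<rho> h (p (?\<rho> (inv h) x)) = x" if h: "h \<in> carrier G" for h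
      using h x xN group_repD(4)[OF N h _ xN, of "inv h"] by (simp add: p(3) S(3) group_repD(3)[OF N])
    then have "P x = scl N (inverse c) (\<Sum>h\<in>carrier G. x)" by (simp add: P_def)
    also have "(\<Sum>h\<in>carrier G. x) = scl N c x"
    proof -
      have "(\<Sum>h\<in>carrier G. x) = (\<Sum>h\<in>carrier G. scl N 1 x)" by (simp add: vsp_scl[OF V])
      also have "\<dots> = scl N (\<Sum>h\<in>carrier G. 1) x" by (rule vsp_scl_sum(2)[OF V, symmetric])
      finally show ?thesis by (simp add: c_def)
    qed
    finally show ?thesis using c by (simp add: vsp_scl[OF V])
  qed
  have "P (?\<rho> k x) = ?\<rho> k (P x)" if k: "k \<in> carrier G" and x: "x \<in> carrier N" for k x
  proof -
    note lk = group_repD(2)[OF N k]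
    have in_N: "?\<rho> h y \<in> carrier N" if "h \<in> carrier G" "y \<in> carrier N" for h y
      using linear_onD(1)[OF group_repD(2)[OF N that(1)] that(2)] .
    have "?\<rho> k (P x) = scl N (inverse c) (\<Sum>h\<in>carrier G. ?\<rho> k (?\<rho> h (p (?\<rho> (inv h) x))))"
    proof -
      have "?\<rho> k (P x) = scl N (inverse c) (?\<rho> k (\<Sum>h\<in>carrier G. ?\<rho> h (p (?\<rho> (inv h) x))))"
        unfolding P_def by (rule linear_onD(3)[OF lk]) (intro vsp_sum[OF V] in_N pN)
      also have "?\<rho> k (\<Sum>h\<in>carrier G. ?\<rho> h (p (?\<rho> (inv h) x))) = (\<Sum>h\<in>carrier G. ?\<rho> k (?\<rho> h (p (?\<rho> (inv h) x))))"
        by (rule linear_on_setsum[OF V V lk]) (intro in_N pN)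
      finally show ?thesis .
    qed
    also have "(\<Sum>h\<in>carrier G. ?\<rho> k (?\<rho> h (p (?\<rho> (inv h) x)))) =
        (\<Sum>h\<in>carrier G. ?\<rho> (k \<otimes> h) (p (?\<rho> (inv (k \<otimes> h)) (?\<rho> k x))))"
    proof (rule sum.cong[OF refl])
      fix h assume h: "h \<in> carrier G"
      have "inv (k \<otimes> h) \<otimes> k = inv h" using h k by (simp add: inv_mult_group m_assoc)
      then have "?\<rho> (inv (k \<otimes> h)) (?\<rho> k x) = ?\<rho> (inv h) x"
        using group_repD(4)[OF N _ k x, of "inv (k \<otimes> h)"] h k by simp
      then show "?\<rho> k (?\<rho> h (p (?\<rho> (inv h) x))) = ?\<rho> (k \<otimes> h) (p (?\<rho> (inv (k \<otimes> h)) (?\<rho> k x)))"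
        by (simp add: group_repD(4)[OF N k h pN(2)])
    qed
    also have "\<dots> = (\<Sum>h\<in>carrier G. ?\<rho> h (p (?\<rho> (inv h) (?\<rho> k x))))"
    proof (rule sum.reindex_bij_betw[where h = "\<lambda>h. k \<otimes> h"])
      show "bij_betw (\<lambda>h. k \<otimes> h) (carrier G) (carrier G)"
        by (rule bij_betw_byWitness[where f' = "\<lambda>h. inv k \<otimes> h"]) (use k in \<open>auto simp flip: m_assoc\<close>)
    qed
    finally show ?thesis by (simp add: P_def)
  qed
  then show ?thesis using lin PS PP by blast
qed

end

text \<open>Induction on the dimension of a subrepresentation \<open>U\<close>: a nonzero
  subrepresentation \<open>S\<close> of \<open>U\<close> of least dimension is simple, and the
  kernel in \<open>U\<close> of an equivariant projection onto \<open>S\<close> is a smaller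
  complement.\<close>

lemma (in group) complete_simples_decomposition:
  fixes N :: "('k::field_char_0, 'a \<Rightarrow> 'k, 'm::ab_group_add) lmod"
    and V :: "'i \<Rightarrow> ('k, 'a \<Rightarrow> 'k, 'v::ab_group_add) lmod"
  assumes fin: "finite (carrier G)" and V: "complete_simples G V"
    and N: "group_rep G N" and fd: "fin_dim N"
  shows "\<exists>m (f :: nat \<Rightarrow> 'i). module_iso (group_alg G) N (direct_sum m (\<lambda>r. V (f r)))"
proof -
  note vN = group_repD(1)[OF N]
  interpret vector_space "scl N" using vN by (simp add: is_vsp_def)
  have lN: "left_module (group_alg G) N" by (rule group_rep_left_module[OF fin N fd])
  have VG: "group_rep G (V s)" for s
    by (rule left_module_group_rep[OF fin]) (use V in \<open>simp add: complete_simples_def simple_module_def\<close>)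
  note vV = group_repD(1)[OF VG]
  let ?\<rho> = "\<lambda>h. act N (basis_vec h)" and ?D = "\<lambda>m f. direct_sum m (\<lambda>r. V (f r))"
  obtain T where T: "finite T" "span T = carrier N" using fd by (auto simp: fin_dim_def)
  define subrep where "subrep U \<longleftrightarrow> subspace U \<and> U \<subseteq> carrier N \<and> (\<forall>h\<in>carrier G. \<forall>u\<in>U. ?\<rho> h u \<in> U)" for U
  \<comment> \<open>A decomposition of \<open>U\<close> is recorded by equivariant maps from the
    \<open>V (f r)\<close> into the fixed module \<open>N\<close>, and \<open>total\<close> adds
    them up. All subrepresentations met in the induction thus live in one type.\<close>
  define homs where "homs m f \<phi> \<longleftrightarrow> (\<forall>r<m. linear_on (V (f r)) N (\<phi> r) \<and>
      (\<forall>h\<in>carrier G. \<forall>v\<in>carrier (V (f r)). \<phi> r (act (V (f r)) (basis_vec h) v) = ?\<rho> h (\<phi> r v)))"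
    for m :: nat and f \<phi>
  define total where "total m \<phi> F = (\<Sum>r<m. \<phi> r (F r))" for m :: nat and \<phi> :: "nat \<Rightarrow> 'v \<Rightarrow> 'm" and F
  have vD: "is_vsp (?D m f)" for m f by (rule is_vsp_direct_sum[OF vV])
  have total_lin: "linear_on (?D m f) N (total m \<phi>)" if "homs m f \<phi>" for m f \<phi>
    unfolding total_def
  proof (intro linear_on_sum_fun[OF vN])
    fix r assume "r \<in> {..<m}"
    then have r: "r < m" by simp
    have "linear_on (?D m f) (V (f r)) (\<lambda>F. F r)"
      using r by (intro linear_onI) (simp_all add: direct_sum_simps)
    then show "linear_on (?D m f) N (\<lambda>F. \<phi> r (F r))"
      by (rule linear_on_comp) (use that r in \<open>simp add: homs_def\<close>)
  qed
  have sub_iso: "\<exists>s \<phi>. linear_on (V s) N \<phi> \<and> bij_betw \<phi> (carrier (V s)) S \<and>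
      (\<forall>h\<in>carrier G. \<forall>v\<in>carrier (V s). \<phi> (act (V s) (basis_vec h) v) = ?\<rho> h (\<phi> v))"
    if S: "subrep S" "S \<noteq> {0}" and min: "\<forall>S'. subrep S' \<longrightarrow> S' \<subseteq> S \<longrightarrow> S' = {0} \<or> S' = S" for S
  proof -
    have sS: "subspace S" "S \<subseteq> carrier N" and hS: "\<And>h u. h \<in> carrier G \<Longrightarrow> u \<in> S \<Longrightarrow> ?\<rho> h u \<in> S"
      using S(1) by (auto simp: subrep_def)
    let ?S = "N\<lparr>carrier := S\<rparr>"
    have "is_vsp ?S" using vN sS(1) by (simp add: is_vsp_def)
    moreover have "fin_dim ?S"
    proof -
      obtain B where B: "B \<subseteq> S" "independent B" "S \<subseteq> span B" using maximal_independent_subset[of S] by blast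
      have "finite B" using independent_span_bound[OF T(1) B(2)] B(1) sS(2) T(2) by blast
      moreover have "span B = S" using B span_minimal[OF B(1) sS(1)] by blast
      ultimately show ?thesis using B(1) by (auto simp: fin_dim_def)
    qed
    moreover have "act N a x \<in> S" if a: "a \<in> carrier (group_alg G)" and x: "x \<in> S" for a x
      unfolding group_repD(5)[OF N a subsetD[OF sS(2) x]]
      by (intro subspace_sum[OF sS(1)] subspace_scale[OF sS(1)] hS x)
    ultimately have "left_module (group_alg G) ?S"
      using lN subsetD[OF sS(2)] unfolding left_module_def by simp
    moreover have "U = {0} \<or> U = S"
      if U: "subspace U" "U \<subseteq> S" "\<forall>a\<in>carrier (group_alg G). \<forall>u\<in>U. act N a u \<in> U" for U
      by (rule min[rule_format, OF _ U(2)]) (use U sS(2) in \<open>auto simp: subrep_def\<close>)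
    ultimately have "simple_module (group_alg G) ?S"
      using S(2) by (simp add: simple_module_def)
    then obtain s where "module_iso (group_alg G) (V s) ?S"
      using complete_simples_iso[OF is_alg_group_alg[OF fin] V] by blast
    then obtain \<phi> where "linear_on (V s) ?S \<phi>" "bij_betw \<phi> (carrier (V s)) (carrier ?S)"
      "\<And>h x. h \<in> carrier G \<Longrightarrow> x \<in> carrier (V s) \<Longrightarrow> \<phi> (act (V s) (basis_vec h) x) = act ?S (basis_vec h) (\<phi> x)"
      by (rule module_iso_groupE) blast
    then show ?thesis
      using sS(2) by (intro exI[of _ s] exI[of _ \<phi>]) (auto simp: linear_on_def)
  qed
  have dec: "\<exists>m f \<phi>. homs m f \<phi> \<and> bij_betw (total m \<phi>) (carrier (?D m f)) U" if "subrep U" for U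
    using that
  proof (induction "dim U" arbitrary: U rule: less_induct)
    case less
    show ?case
    proof (cases "U = {0}")
      case True
      have "carrier (?D 0 f) = {0}" for f by (auto simp: direct_sum_simps fun_eq_iff)
      then show ?thesis
        using True by (intro exI[of _ 0] exI) (simp add: homs_def total_def bij_betw_def)
    next
      case False
      let ?Q = "\<lambda>S. subrep S \<and> S \<noteq> {0} \<and> S \<subseteq> U"
      have "?Q U" using less.prems False by simp
      then obtain S where S: "?Q S" and least: "\<And>S'. ?Q S' \<Longrightarrow> dim S \<le> dim S'"
        using ex_has_least_nat[of ?Q U dim] by blast
      have sS: "subspace S" "S \<subseteq> carrier N" "\<And>h u. h \<in> carrier G \<Longrightarrow> u \<in> S \<Longrightarrow> ?\<rho> h u \<in> S"
        and sU: "subspace U" "U \<subseteq> carrier N" "\<And>h u. h \<in> carrier G \<Longrightarrow> u \<in> U \<Longrightarrow> ?\<rho> h u \<in> U"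
        using S less.prems by (auto simp: subrep_def)
      \<comment> \<open>Otherwise \<open>S'\<close> would itself be a candidate for
        \<open>?Q\<close>, of strictly smaller dimension than \<open>S\<close>.\<close>
      have min: "S' = {0} \<or> S' = S" if S': "subrep S'" "S' \<subseteq> S" for S'
      proof (rule ccontr)
        assume *: "\<not> (S' = {0} \<or> S' = S)"
        then obtain b where "b \<in> S" "b \<notin> S'" using S'(2) by blast
        then have "dim S' < dim S"
          using dim_less_finite_span[OF T(1) _ _ S'(2)] S' sS(2) T(2) by (simp add: subrep_def)
        moreover have "dim S \<le> dim S'" using * S' S by (intro least) auto
        ultimately show False by simp
      qed
      obtain s \<phi>' where \<phi>': "linear_on (V s) N \<phi>'" "bij_betw \<phi>' (carrier (V s)) S"
        "\<And>h v. h \<in> carrier G \<Longrightarrow> v \<in> carrier (V s) \<Longrightarrow> \<phi>' (act (V s) (basis_vec h) v) = ?\<rho> h (\<phi>' v)"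
        using sub_iso[of S] S min by metis
      obtain P where P: "linear_on N N P" "\<And>x. x \<in> carrier N \<Longrightarrow> P x \<in> S" "\<And>x. x \<in> S \<Longrightarrow> P x = x"
        "\<And>h x. h \<in> carrier G \<Longrightarrow> x \<in> carrier N \<Longrightarrow> P (?\<rho> h x) = ?\<rho> h (P x)"
        using maschke_projection[OF fin N sS] by blast
      \<comment> \<open>The complement of \<open>S\<close> in \<open>U\<close>. The projection was
        built on all of \<open>N\<close>; since \<open>S\<close> lies in \<open>U\<close>, it maps
        \<open>U\<close> into itself.\<close>
      define K where "K = {x \<in> U. P x = 0}"
      have KU: "K \<subseteq> U" by (auto simp: K_def)
      have UN: "x \<in> carrier N" if "x \<in> U" for x using that sU(2) by blast
      have sK: "subspace K"
        unfolding subspace_def K_def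
        using linear_on_0[OF vN vN P(1)] linear_onD(2,3)[OF P(1)] UN
        by (auto simp: subspace_0[OF sU(1)] subspace_add[OF sU(1)] subspace_scale[OF sU(1)])
      have "?\<rho> h u \<in> K" if "h \<in> carrier G" "u \<in> K" for h u
        using that sU(3) P(4) UN linear_on_0[OF vN vN group_repD(2)[OF N that(1)]] by (simp add: K_def)
      then have repK: "subrep K" using sK KU sU(2) by (auto simp: subrep_def)
      \<comment> \<open>\<open>P\<close> fixes this nonzero vector, so it lies in \<open>U\<close>
        but not in \<open>K\<close>, and the dimension drops.\<close>
      obtain b where b: "b \<in> S" "b \<noteq> 0" using S subspace_0[OF sS(1)] by blast
      then have "b \<in> U" "b \<notin> K" using S P(3)[OF b(1)] by (auto simp: K_def)
      then have "dim K < dim U"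
        using dim_less_finite_span[OF T(1) _ sK KU] sU(2) T(2) by simp
      from less.hyps[OF this repK] obtain m f \<phi> where
        \<phi>: "homs m f \<phi>" "bij_betw (total m \<phi>) (carrier (?D m f)) K" by blast
      let ?f = "f(m := s)" and ?\<phi> = "\<phi>(m := \<phi>')"
      have homs: "homs (Suc m) ?f ?\<phi>"
        using \<phi>(1) \<phi>'(1,3) by (simp add: homs_def less_Suc_eq)
      \<comment> \<open>The new summand is appended at index \<open>m\<close>; \<open>cut\<close>
        forgets it and returns to the sum belonging to \<open>K\<close>.\<close>
      define cut where "cut F = (\<lambda>r. if r < m then F r else 0)" for F :: "nat \<Rightarrow> 'v"
      have cut: "cut F \<in> carrier (?D m f)" "F m \<in> carrier (V s)" if "F \<in> carrier (?D (Suc m) ?f)" for F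
        using that by (auto simp: direct_sum_simps cut_def less_Suc_eq)
      have total: "total (Suc m) ?\<phi> F = total m \<phi> (cut F) + \<phi>' (F m)" for F
        by (simp add: total_def cut_def)
      have in_K: "total m \<phi> F \<in> K" if "F \<in> carrier (?D m f)" for F
        using \<phi>(2) that by (auto simp: bij_betw_def)
      have in_S: "\<phi>' v \<in> S" if "v \<in> carrier (V s)" for v
        using \<phi>'(2) that by (auto simp: bij_betw_def)
      \<comment> \<open>\<open>P\<close> reads off the \<open>S\<close>-component of a sum.
        Injectivity of the extended \<open>total\<close> follows by treating the two components
        separately.\<close>
      have P_sum: "P (x + y) = y" if "x \<in> K" "y \<in> S" for x y
        using that linear_onD(2)[OF P(1), of x y] UN sS(2) P(3) by (auto simp: K_def)
      have "inj_on (total (Suc m) ?\<phi>) (carrier (?D (Suc m) ?f))"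
      proof (rule linear_on_inj[OF vD vN total_lin[OF homs]])
        fix F assume F: "F \<in> carrier (?D (Suc m) ?f)" and z: "total (Suc m) ?\<phi> F = 0"
        note c = cut[OF F]
        have "\<phi>' (F m) = 0"
          using P_sum[OF in_K[OF c(1)] in_S[OF c(2)]] z linear_on_0[OF vN vN P(1)] by (simp add: total)
        moreover from this have "total m \<phi> (cut F) = 0" using z by (simp add: total)
        ultimately have "F m = 0" "cut F = 0"
          using \<phi>'(2) \<phi>(2) c vsp_zero[OF vV] vsp_zero[OF vD] linear_on_0[OF vV vN \<phi>'(1)]
            linear_on_0[OF vD vN total_lin[OF \<phi>(1)]]
          by (auto simp: bij_betw_def inj_on_def)
        then have "F r = 0" if "r < Suc m" for r
          using that by (auto simp: less_Suc_eq cut_def fun_eq_iff split: if_splits)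
        then show "F = 0"
          using F by (auto simp: direct_sum_simps fun_eq_iff) (metis not_less_eq_eq not_le)
      qed
      moreover have "total (Suc m) ?\<phi> F \<in> U" if "F \<in> carrier (?D (Suc m) ?f)" for F
        using in_K[OF cut(1)[OF that]] in_S[OF cut(2)[OF that]] KU S
        unfolding total by (intro subspace_add[OF sU(1)]) auto
      moreover have "\<exists>F\<in>carrier (?D (Suc m) ?f). total (Suc m) ?\<phi> F = u" if u: "u \<in> U" for u
      proof -
        have Pu: "P u \<in> S" using P(2) UN u by blast
        then have PuN: "P u \<in> carrier N" using sS(2) by blast
        have "P (u - P u) = 0"
          using linear_on_diff[OF vN vN P(1) UN[OF u] PuN] P(3)[OF Pu] by simp
        moreover have "u - P u \<in> U" using subspace_diff[OF sU(1) u] Pu S by blast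
        ultimately have "u - P u \<in> K" by (simp add: K_def)
        then have "u - P u \<in> total m \<phi> ` carrier (?D m f)" by (simp only: bij_betw_imp_surj_on[OF \<phi>(2)])
        then obtain F where F: "F \<in> carrier (?D m f)" "total m \<phi> F = u - P u" by (elim imageE) simp
        from Pu have "P u \<in> \<phi>' ` carrier (V s)" by (simp only: bij_betw_imp_surj_on[OF \<phi>'(2)])
        then obtain v where v: "v \<in> carrier (V s)" "\<phi>' v = P u" by (elim imageE) simp
        have "cut (F(m := v)) = F" using F(1) by (auto simp: cut_def direct_sum_simps fun_eq_iff)
        then have "total (Suc m) ?\<phi> (F(m := v)) = u" by (simp add: total F v)
        moreover have "F(m := v) \<in> carrier (?D (Suc m) ?f)"
          using F(1) v(1) by (auto simp: direct_sum_simps less_Suc_eq)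
        ultimately show ?thesis by blast
      qed
      ultimately have "bij_betw (total (Suc m) ?\<phi>) (carrier (?D (Suc m) ?f)) U"
        by (auto simp: bij_betw_def)
      then show ?thesis using homs by blast
    qed
  qed
  have "subrep (carrier N)"
    using vN linear_onD(1)[OF group_repD(2)[OF N]] by (auto simp: subrep_def is_vsp_def)
  from dec[OF this] obtain m f \<phi> where
    homs: "homs m f \<phi>" and bij: "bij_betw (total m \<phi>) (carrier (?D m f)) (carrier N)" by blast
  have D: "group_rep G (?D m f)" by (rule group_rep_direct_sum[OF VG])
  have "module_iso (group_alg G) (?D m f) N"
  proof (rule module_iso_groupI[OF D N total_lin[OF homs] bij])
    fix h F assume h: "h \<in> carrier G" and F: "F \<in> carrier (?D m f)"
    have "?\<rho> h (total m \<phi> F) = (\<Sum>r<m. ?\<rho> h (\<phi> r (F r)))"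
      unfolding total_def
      by (rule linear_on_setsum[OF vN vN group_repD(2)[OF N h]])
        (use homs F in \<open>auto simp: homs_def direct_sum_simps linear_on_def\<close>)
    then show "total m \<phi> (act (?D m f) (basis_vec h) F) = ?\<rho> h (total m \<phi> F)"
      using homs h F by (simp add: homs_def direct_sum_simps total_def)
  qed
  then have "module_iso (group_alg G) N (?D m f)"
    by (rule module_iso_sym[OF vD, rotated])
      (rule group_rep_closed[OF is_vsp_group_alg[OF fin] D])
  then show ?thesis by blast
qed

lemma finite_some_basis:
  assumes V: "is_vsp V" and fd: "fin_dim V"
  shows "finite (some_basis V)"
proof -
  interpret vector_space "scl V" using V by (simp add: is_vsp_def)
  obtain T where "finite T" "span T = carrier V" using fd by (auto simp: fin_dim_def)
  then show ?thesis
    using independent_span_bound[of T "some_basis V"] some_basis(1,2)[OF V] by simp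
qed

lemma fin_dim_tensor_module:
  fixes V :: "('k::field, 'a::ab_group_add, 'v::ab_group_add) lmod"
    and W :: "('k, 'a, 'w::ab_group_add) lmod"
  assumes V: "is_vsp V" "fin_dim V" and W: "is_vsp W" "fin_dim W"
  shows "fin_dim (tensor_module C V W)"
proof -
  interpret t: vector_space "fscale :: 'k \<Rightarrow> ('v \<times> 'w \<Rightarrow> 'k) \<Rightarrow> 'v \<times> 'w \<Rightarrow> 'k" by (rule fscale_vector_space)
  let ?B = "some_basis V \<times> some_basis W"
  have fin: "finite ?B" using finite_some_basis[OF V] finite_some_basis[OF W] by simp
  have carr: "carrier (tensor_space V W) = {t. {p. t p \<noteq> 0} \<subseteq> ?B}"
    using finite_subset[OF _ fin] by (auto simp: tensor_space_def)
  have sub: "t.subspace (carrier (tensor_space V W))"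
    using is_vsp_tensor_space[OF V(1) W(1)] by (simp add: is_vsp_def)
  have bv: "basis_vec ` ?B \<subseteq> carrier (tensor_space V W)"
    unfolding carr by (auto simp: basis_vec_def split: if_splits)
  have "carrier (tensor_space V W) \<subseteq> t.span (basis_vec ` ?B)"
  proof
    fix t assume "t \<in> carrier (tensor_space V W)"
    then have "t = (\<Sum>p\<in>?B. fscale (t p) (basis_vec p))"
      unfolding carr by (intro finite_support_expand fin) auto
    also have "\<dots> \<in> t.span (basis_vec ` ?B)"
      by (intro t.span_sum t.span_scale t.span_base) auto
    finally show "t \<in> t.span (basis_vec ` ?B)" .
  qed
  then show ?thesis
    unfolding fin_dim_def tensor_module_simps
    using bv fin t.span_minimal[OF bv sub] by (intro exI[of _ "basis_vec ` ?B"]) auto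
qed

text \<open>\<open>\<Omega>\<^sub>0\<close> and \<open>\<Omega>\<^sub>1\<close> are expressed by
  \<open>lam\<close> being 1 or not, and multiplicities by repeated values of \<open>f\<close>. The
  second conjunct ranges over every decomposition into indices of \<open>\<Omega>\<^sub>1\<close>,
  so it is not tied to the family that the first one provides.\<close>

theorem proposition3p4:
  fixes G :: "('g, 'b) monoid_scheme"
    and \<chi> :: "'g \<Rightarrow> 'k :: {alg_closed_field, field_char_0}"
    and g :: 'g and n :: nat
    and V :: "'i \<Rightarrow> ('k, 'g \<Rightarrow> 'k, 'v :: ab_group_add) lmod"
    and lam :: "'i \<Rightarrow> 'k" and \<tau> :: "'i \<Rightarrow> 'i" and i j :: 'i
  assumes datum: "group_datum G \<chi> g n"
    and simples: "complete_simples G V"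
    and lam: "\<And>s v. v \<in> carrier (V s) \<Longrightarrow>
                act (V s) (basis_vec (g [^]\<^bsub>G\<^esub> n)) v = scl (V s) (lam s) v"
    and tau_bij: "bij \<tau>"
    and tau: "\<And>s. module_iso (group_alg G)
                (tensor_module (group_alg G) (char_inv_module G \<chi>) (V s)) (V (\<tau> s))"
    and i: "lam i = 1" and j: "lam j \<noteq> 1"
  shows "(\<exists>m (f :: nat \<Rightarrow> 'i). (\<forall>r<m. lam (f r) \<noteq> 1) \<and>
            module_iso (group_alg G) (tensor_module (group_alg G) (V i) (V j))
              (direct_sum m (\<lambda>r. V (f r)))) \<and>
         (\<forall>m (f :: nat \<Rightarrow> 'i).
            (\<forall>r<m. lam (f r) \<noteq> 1) \<and>
            module_iso (group_alg G) (tensor_module (group_alg G) (V i) (V j))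
              (direct_sum m (\<lambda>r. V (f r))) \<longrightarrow>
            (\<forall>k. 1 \<le> k \<and> k \<le> n \<longrightarrow>
              (let H = hopf_alg G \<chi> g n;
                   M = M_module G \<chi> n (V i) k;
                   P = (\<lambda>s. P_module G \<chi> n (V s) (lam s))
               in module_iso H (tensor_module H M (P j)) (tensor_module H (P j) M) \<and>
                  module_iso H (tensor_module H (P j) M)
                    (direct_sum k (\<lambda>t. direct_sum m (\<lambda>r. P ((\<tau> ^^ t) (f r))))))))"
proof -
  interpret group_datum G \<chi> g n by (rule datum)
  have lV: "left_module (group_alg G) (V s)" for s
    using simples by (simp add: complete_simples_def simple_module_def)
  have VG: "group_rep G (V s)" for s by (rule left_module_group_rep[OF finite_G lV])
  note vV = group_repD(1)[OF VG]
  have fdV: "fin_dim (V s)" for s using lV by (simp add: left_module_def)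
  let ?E = "tensor_module (group_alg G) (V i) (V j)"
  have E: "group_rep G ?E" by (rule group_rep_tensor[OF finite_G VG VG])
  obtain m f where iso: "module_iso (group_alg G) ?E (direct_sum m (\<lambda>r. V (f r)))"
    using complete_simples_decomposition[OF finite_G simples E fin_dim_tensor_module[OF vV fdV vV fdV]] by blast
  have "lam (f r) \<noteq> 1" if r: "r < m" for r
  proof -
    have gn: "g [^]\<^bsub>G\<^esub> n \<in> carrier G" using g_in_G by simp
    obtain e where e: "linear_on ?E (direct_sum m (\<lambda>r. V (f r))) e"
      "bij_betw e (carrier ?E) (carrier (direct_sum m (\<lambda>r. V (f r))))"
      "\<And>h x. h \<in> carrier G \<Longrightarrow> x \<in> carrier ?E \<Longrightarrow>
        e (act ?E (basis_vec h) x) = act (direct_sum m (\<lambda>r. V (f r))) (basis_vec h) (e x)"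
      using iso by (rule module_iso_groupE) blast
    have gE: "act ?E (basis_vec (g [^]\<^bsub>G\<^esub> n)) t = fscale (lam j) t" if t: "t \<in> carrier (tensor_space (V i) (V j))" for t
    proof -
      have "act ?E (basis_vec (g [^]\<^bsub>G\<^esub> n)) t = tmap (V i) (V j) (act (V i) (basis_vec (g [^]\<^bsub>G\<^esub> n))) (act (V j) (basis_vec (g [^]\<^bsub>G\<^esub> n))) t"
        by (simp add: group_tensor_act[OF finite_G VG VG gn t])
      also have "\<dots> = tmap (V i) (V j) (\<lambda>v. v) (\<lambda>w. scl (V j) (lam j) w) t"
        by (rule tmap_cong[OF vV vV vV vV group_repD(2)[OF VG gn] group_repD(2)[OF VG gn] _ _ t])
          (simp_all add: lam i vsp_scl[OF vV])
      also have "\<dots> = fscale (lam j) t"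
        by (simp add: tmap_scl_right[OF vV vV vV vV linear_on_id linear_on_id t] tmap_id[OF vV vV t])
      finally show ?thesis .
    qed
    have "carrier (V (f r)) \<noteq> {0}" using simples by (simp add: complete_simples_def simple_module_def)
    then obtain v where v: "v \<in> carrier (V (f r))" "v \<noteq> 0" using vsp_zero[OF vV] by blast
    \<comment> \<open>The scalars are compared on a nonzero vector placed in summand
      \<open>r\<close>. Its preimage \<open>t\<close> in the tensor product is scaled by
      \<open>lam j\<close>, the vector itself by \<open>lam (f r)\<close>.\<close>
    have "x_at r v \<in> carrier (direct_sum m (\<lambda>r. V (f r)))"
      using r v(1) vsp_zero[OF vV] by (auto simp: direct_sum_simps x_at_def)
    then have "x_at r v \<in> e ` carrier ?E" by (simp only: bij_betw_imp_surj_on[OF e(2)])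
    then obtain t where t: "t \<in> carrier (tensor_space (V i) (V j))" "e t = x_at r v"
      by (elim imageE) simp
    have "scl (V (f r)) (lam (f r)) v = act (direct_sum m (\<lambda>r. V (f r))) (basis_vec (g [^]\<^bsub>G\<^esub> n)) (e t) r"
      using r by (simp add: direct_sum_simps t(2) x_at_simps lam v(1))
    also have "\<dots> = e (fscale (lam j) t) r"
    proof -
      have "t \<in> carrier ?E" using t(1) by simp
      from e(3)[OF gn this] show ?thesis by (simp only: gE[OF t(1)])
    qed
    also have "\<dots> = scl (V (f r)) (lam j) v"
      using linear_onD(3)[OF e(1), of t "lam j"] t by (simp add: direct_sum_simps x_at_simps)
    finally have "scl (V (f r)) (lam (f r) - lam j) v = 0" by (simp add: vsp_scl[OF vV])
    then have "lam (f r) = lam j"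
      using v(2) vector_space.scale_eq_0_iff[of "scl (V (f r))"] vV by (simp add: is_vsp_def)
    then show ?thesis using j by simp
  qed
  then have "\<exists>m (f :: nat \<Rightarrow> 'i). (\<forall>r<m. lam (f r) \<noteq> 1) \<and> module_iso (group_alg G) ?E (direct_sum m (\<lambda>r. V (f r)))"
    using iso by blast
  then show ?thesis
    unfolding Let_def using tensor_isos[where V = V, OF VG lam tau i] by blast
qed

end
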